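(* Let $K$ be an $\mathcal{R}$-dioid (equivalently, a $*$-continuous Kleene algebra). For each $\phi \in K\otimes_{\mathcal R} C_2'$ there are $n \in \mathbb N$, $S \in \{0,1\}^{1\times n}$, $F \in \{0,1\}^{n\times 1}$, $U \in \{0, b, p\}^{n\times n}$, $V \in \{0, d, q\}^{n\times n}$ and $X \in K^{n\times n}$ such that \[ \phi = S(NV)^*N(UN)^*F, \] where $N$ is the least solution of the inequation $y \geq (UyV+X)^*$ in the matrix Kleene algebra $\mathrm{Mat}_{n\times n}(K\otimes_{\mathcal R} C_2')$, and $N \in (Z_{C_2'}K)^{n\times n}$.
   Context: A Kleene algebra is an idempotent semiring $(K,+,\cdot,0,1)$ with a unary operation $^*$ such that $aa^*+1\le a^*$, $a^*a+1\le a^*$, $ax+b\le x \Rightarrow a^*b\le x$ and $xa+b\le x\Rightarrow ba^*\le x$, where $a\le b$ iff $a+b=b$. It is $*$-continuous if $ac^*b=\sup_{n\in\mathbb N} ac^nb$ for all $a,b,c$. For a monoid $M$, $\mathcal R M$ denotes the set of regular (rational) subsets of $M$. An $\mathcal R$-dioid is a dioid in which every regular subset $A$ of its multiplicative monoid has a least upper bound $\sum A$ and $\sum(AB)=(\sum A)(\sum B)$; these are exactly the $*$-continuous Kleene algebras (with $c^*=\sum\{c\}^*$). An $\mathcal R$-morphism is a dioid morphism preserving suprema of regular sets. An $\mathcal R$-congruence on an $\mathcal R$-dioid $D$ is a semiring congruence $\rho$ such that for all regular $U,U'\subseteq D$, if the downward closures of $U/\rho$ and $U'/\rho$ in $D/\rho$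 coincide then $(\sum U)/\rho=(\sum U')/\rho$; for every relation there is a least $\mathcal R$-congruence containing it, and quotients by $\mathcal R$-congruences are $\mathcal R$-dioids. $C_2'$ (polycyclic $\mathcal R$-dioid): let $\Delta_2=\{b,p,d,q\}$ ("opening brackets" $b,p$, "closing brackets" $d,q$); $C_2'=\mathcal R\Delta_2^*/\rho$ where $\mathcal R\Delta_2^*$ is the algebra of regular languages over $\Delta_2$ (union, concatenation, Kleene star) and $\rho$ is the least $\mathcal R$-congruence containing $bd=1$, $pq=1$, $bq=0$, $pd=0$. Letters denote their classes. Tensor product: for $\mathcal R$-dioids $K_1,K_2$, $K_1\otimes_{\mathcal R}K_2$ is the $\mathcal R$-dioid with $\mathcal R$-morphisms $\top_i:K_i\to K_1\otimes_{\mathcal R}K_2$ whose images commute elementwise, universal among such pairs (any pair of elementwise commuting $\mathcal R$-morphisms $f:K_1\to K$, $g:K_2\to K$ factors uniquely as $f=h\circ\top_1$, $g=h\circ\top_2$ with an $\mathcal R$-morphism $h$). Elements of $K$ and $C_2'$ are identified with their images in $K\otimes_{\mathcal R}C_2'$. The centralizer $Z_{C_2'}K$ is the set of elements of $K\otimes_{\mathcal R}C_2'$ commuting with every element of (the image of) $C_2'$. $\mathrm{Mat}_{n\times n}(K)$ denotes $n\times n$ matrices with matrix sum and product and the standard matrix star (defined recursively by the block formula); it is a $*$-continuous Kleene algebra when $K$ is. Entries $0,1$ of boolean matrices are those of the algebra; when an element $c$ of the algebra is multiplied with a matrix, $c$ is identified with the diagonal matrix $c\cdot 1_n$. *)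

theory Defs
  imports Main
begin

record 'a dioid_ops =
  dcar  :: "'a set"
  dadd  :: "'a \<Rightarrow> 'a \<Rightarrow> 'a"
  dmul  :: "'a \<Rightarrow> 'a \<Rightarrow> 'a"
  dzero :: 'a
  dunit :: 'a

definition dioid :: "'a dioid_ops \<Rightarrow> bool" where
  "dioid D \<longleftrightarrow>
     dzero D \<in> dcar D \<and> dunit D \<in> dcar D \<and>
     (\<forall>x\<in>dcar D. \<forall>y\<in>dcar D. dadd D x y \<in> dcar D \<and> dmul D x y \<in> dcar D) \<and>
     (\<forall>x\<in>dcar D. \<forall>y\<in>dcar D. \<forall>z\<in>dcar D.
        dadd D (dadd D x y) z = dadd D x (dadd D y z) \<and>
        dmul D (dmul D x y) z = dmul D x (dmul D y z) \<and>
        dmul D x (dadd D y z) = dadd D (dmul D x y) (dmul D x z) \<and>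
        dmul D (dadd D x y) z = dadd D (dmul D x z) (dmul D y z)) \<and>
     (\<forall>x\<in>dcar D. \<forall>y\<in>dcar D. dadd D x y = dadd D y x) \<and>
     (\<forall>x\<in>dcar D. dadd D x (dzero D) = x \<and> dadd D x x = x \<and>
        dmul D x (dunit D) = x \<and> dmul D (dunit D) x = x \<and>
        dmul D x (dzero D) = dzero D \<and> dmul D (dzero D) x = dzero D)"

definition dle :: "'a dioid_ops \<Rightarrow> 'a \<Rightarrow> 'a \<Rightarrow> bool" where
  "dle D x y \<longleftrightarrow> dadd D x y = y"

definition is_lub :: "'a dioid_ops \<Rightarrow> 'a set \<Rightarrow> 'a \<Rightarrow> bool" where
  "is_lub D A s \<longleftrightarrow> s \<in> dcar D \<and> (\<forall>a\<in>A. dle D a s) \<and>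
     (\<forall>u\<in>dcar D. (\<forall>a\<in>A. dle D a u) \<longrightarrow> dle D s u)"

definition rsum :: "'a dioid_ops \<Rightarrow> 'a set \<Rightarrow> 'a" where
  "rsum D A = (THE s. is_lub D A s)"

definition smul :: "('a \<Rightarrow> 'a \<Rightarrow> 'a) \<Rightarrow> 'a set \<Rightarrow> 'a set \<Rightarrow> 'a set" where
  "smul m A B = {m a b | a b. a \<in> A \<and> b \<in> B}"

inductive_set mclos :: "('a \<Rightarrow> 'a \<Rightarrow> 'a) \<Rightarrow> 'a \<Rightarrow> 'a set \<Rightarrow> 'a set"
  for m :: "'a \<Rightarrow> 'a \<Rightarrow> 'a" and u :: 'a and A :: "'a set" where
  mclos_unit: "u \<in> mclos m u A"
| mclos_step: "a \<in> A \<Longrightarrow> x \<in> mclos m u A \<Longrightarrow> m a x \<in> mclos m u A"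

inductive_set rat :: "'a set \<Rightarrow> ('a \<Rightarrow> 'a \<Rightarrow> 'a) \<Rightarrow> 'a \<Rightarrow> 'a set set"
  for C :: "'a set" and m :: "'a \<Rightarrow> 'a \<Rightarrow> 'a" and u :: 'a where
  rat_empty: "{} \<in> rat C m u"
| rat_single: "a \<in> C \<Longrightarrow> {a} \<in> rat C m u"
| rat_union: "A \<in> rat C m u \<Longrightarrow> B \<in> rat C m u \<Longrightarrow> A \<union> B \<in> rat C m u"
| rat_mult: "A \<in> rat C m u \<Longrightarrow> B \<in> rat C m u \<Longrightarrow> smul m A B \<in> rat C m u"
| rat_star: "A \<in> rat C m u \<Longrightarrow> mclos m u A \<in> rat C m u"

abbreviation Reg :: "'a dioid_ops \<Rightarrow> 'a set set" where
  "Reg D \<equiv> rat (dcar D) (dmul D) (dunit D)"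

definition R_dioid :: "'a dioid_ops \<Rightarrow> bool" where
  "R_dioid D \<longleftrightarrow> dioid D \<and>
     (\<forall>A\<in>Reg D. \<exists>s. is_lub D A s) \<and>
     (\<forall>A\<in>Reg D. \<forall>B\<in>Reg D. rsum D (smul (dmul D) A B) = dmul D (rsum D A) (rsum D B))"

definition rstar :: "'a dioid_ops \<Rightarrow> 'a \<Rightarrow> 'a" where
  "rstar D c = rsum D (mclos (dmul D) (dunit D) {c})"

definition R_morph :: "'a dioid_ops \<Rightarrow> 'b dioid_ops \<Rightarrow> ('a \<Rightarrow> 'b) \<Rightarrow> bool" where
  "R_morph D E f \<longleftrightarrow> f ` dcar D \<subseteq> dcar E \<and>
     f (dzero D) = dzero E \<and> f (dunit D) = dunit E \<and>
     (\<forall>x\<in>dcar D. \<forall>y\<in>dcar D. f (dadd D x y) = dadd E (f x) (f y) \<and>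
        f (dmul D x y) = dmul E (f x) (f y)) \<and>
     (\<forall>A\<in>Reg D. f (rsum D A) = rsum E (f ` A))"

definition R_congruence :: "'a dioid_ops \<Rightarrow> ('a \<times> 'a) set \<Rightarrow> bool" where
  "R_congruence D \<theta> \<longleftrightarrow> equiv (dcar D) \<theta> \<and>
     (\<forall>x x' y y'. (x, x') \<in> \<theta> \<longrightarrow> (y, y') \<in> \<theta> \<longrightarrow>
        (dadd D x y, dadd D x' y') \<in> \<theta> \<and> (dmul D x y, dmul D x' y') \<in> \<theta>) \<and>
     (\<forall>U\<in>Reg D. \<forall>U'\<in>Reg D.
        (\<forall>x\<in>dcar D. (\<exists>u\<in>U. (dadd D x u, u) \<in> \<theta>) \<longleftrightarrow> (\<exists>u\<in>U'. (dadd D x u, u) \<in> \<theta>))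
        \<longrightarrow> (rsum D U, rsum D U') \<in> \<theta>)"

definition least_R_congruence :: "'a dioid_ops \<Rightarrow> ('a \<times> 'a) set \<Rightarrow> ('a \<times> 'a) set" where
  "least_R_congruence D R = \<Inter> {\<theta>. R_congruence D \<theta> \<and> R \<subseteq> \<theta>}"

definition quotient_dioid :: "'a dioid_ops \<Rightarrow> ('a \<times> 'a) set \<Rightarrow> 'a set dioid_ops" where
  "quotient_dioid D \<theta> =
     \<lparr> dcar = dcar D // \<theta>,
       dadd = (\<lambda>X Y. \<theta> `` {dadd D (SOME x. x \<in> X) (SOME y. y \<in> Y)}),
       dmul = (\<lambda>X Y. \<theta> `` {dmul D (SOME x. x \<in> X) (SOME y. y \<in> Y)}),
       dzero = \<theta> `` {dzero D},
       dunit = \<theta> `` {dunit D} \<rparr>"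

text \<open>Brackets: opening b, p; closing d, q.\<close>
datatype delta = Lb | Lp | Ld | Lq

definition RDelta :: "delta list set dioid_ops" where
  "RDelta = \<lparr> dcar = rat UNIV (@) [], dadd = (\<union>), dmul = smul (@),
              dzero = {}, dunit = {[]} \<rparr>"

definition rhoC2 :: "(delta list set \<times> delta list set) set" where
  "rhoC2 = least_R_congruence RDelta
     {({[Lb, Ld]}, {[]}), ({[Lp, Lq]}, {[]}), ({[Lb, Lq]}, {}), ({[Lp, Ld]}, {})}"

definition C2 :: "delta list set set dioid_ops" where
  "C2 = quotient_dioid RDelta rhoC2"

definition letter :: "delta \<Rightarrow> delta list set set" where
  "letter x = rhoC2 `` {{[x]}}"

text \<open>T with t1, t2 is a tensor product of K1 and K2. The universal property is
  required for all target R-dioids whose carrier lies in the type of T.\<close>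
definition is_R_tensor ::
  "'a dioid_ops \<Rightarrow> 'b dioid_ops \<Rightarrow> 't dioid_ops \<Rightarrow> ('a \<Rightarrow> 't) \<Rightarrow> ('b \<Rightarrow> 't) \<Rightarrow> bool" where
  "is_R_tensor K1 K2 T t1 t2 \<longleftrightarrow>
     R_dioid T \<and> R_morph K1 T t1 \<and> R_morph K2 T t2 \<and>
     (\<forall>x\<in>dcar K1. \<forall>y\<in>dcar K2. dmul T (t1 x) (t2 y) = dmul T (t2 y) (t1 x)) \<and>
     (\<forall>(E :: 't dioid_ops) f g.
        R_dioid E \<and> R_morph K1 E f \<and> R_morph K2 E g \<and>
        (\<forall>x\<in>dcar K1. \<forall>y\<in>dcar K2. dmul E (f x) (g y) = dmul E (g y) (f x)) \<longrightarrow>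
        (\<exists>h. R_morph T E h \<and> (\<forall>x\<in>dcar K1. h (t1 x) = f x) \<and> (\<forall>y\<in>dcar K2. h (t2 y) = g y) \<and>
           (\<forall>h'. R_morph T E h' \<and> (\<forall>x\<in>dcar K1. h' (t1 x) = f x) \<and>
                 (\<forall>y\<in>dcar K2. h' (t2 y) = g y) \<longrightarrow> (\<forall>z\<in>dcar T. h' z = h z))))"

definition centralizer :: "'t dioid_ops \<Rightarrow> 'b set \<Rightarrow> ('b \<Rightarrow> 't) \<Rightarrow> 't set" where
  "centralizer T C t2 = {z \<in> dcar T. \<forall>c\<in>C. dmul T z (t2 c) = dmul T (t2 c) z}"

type_synonym 't mat = "nat \<Rightarrow> nat \<Rightarrow> 't"

fun dsum :: "'t dioid_ops \<Rightarrow> (nat \<Rightarrow> 't) \<Rightarrow> nat \<Rightarrow> 't" where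
  "dsum T f 0 = dzero T"
| "dsum T f (Suc n) = dadd T (dsum T f n) (f n)"

definition madd :: "'t dioid_ops \<Rightarrow> 't mat \<Rightarrow> 't mat \<Rightarrow> 't mat" where
  "madd T A B = (\<lambda>i j. dadd T (A i j) (B i j))"

definition mmul :: "'t dioid_ops \<Rightarrow> nat \<Rightarrow> 't mat \<Rightarrow> 't mat \<Rightarrow> 't mat" where
  "mmul T n A B = (\<lambda>i j. dsum T (\<lambda>k. dmul T (A i k) (B k j)) n)"

definition mle :: "'t dioid_ops \<Rightarrow> nat \<Rightarrow> 't mat \<Rightarrow> 't mat \<Rightarrow> bool" where
  "mle T n A B \<longleftrightarrow> (\<forall>i<n. \<forall>j<n. dle T (A i j) (B i j))"

definition mat_over :: "nat \<Rightarrow> 't set \<Rightarrow> 't mat \<Rightarrow> bool" where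
  "mat_over n S A \<longleftrightarrow> (\<forall>i<n. \<forall>j<n. A i j \<in> S)"

text \<open>Standard matrix star by the recursive block formula, splitting off the
  first row/column: for M = [[a, b], [c, D]],
  e = (a + b D* c)*, M* = [[e, e b D*], [D* c e, D* + D* c e b D*]].\<close>
fun mstar :: "'t dioid_ops \<Rightarrow> nat \<Rightarrow> 't mat \<Rightarrow> 't mat" where
  "mstar T 0 M = (\<lambda>i j. dzero T)"
| "mstar T (Suc n) M =
     (let a = M 0 0;
          b = (\<lambda>j. M 0 (Suc j));
          c = (\<lambda>i. M (Suc i) 0);
          Ds = mstar T n (\<lambda>i j. M (Suc i) (Suc j));
          bDs = (\<lambda>j. dsum T (\<lambda>k. dmul T (b k) (Ds k j)) n);
          Dsc = (\<lambda>i. dsum T (\<lambda>k. dmul T (Ds i k) (c k)) n);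
          e = rstar T (dadd T a (dsum T (\<lambda>k. dmul T (bDs k) (c k)) n))
      in (\<lambda>i j. if i = 0 \<and> j = 0 then e
               else if i = 0 then dmul T e (bDs (j - 1))
               else if j = 0 then dmul T (Dsc (i - 1)) e
               else dadd T (Ds (i - 1) (j - 1)) (dmul T (dmul T (Dsc (i - 1)) e) (bDs (j - 1)))))"

definition least_sol :: "'t dioid_ops \<Rightarrow> nat \<Rightarrow> 't mat \<Rightarrow> 't mat \<Rightarrow> 't mat \<Rightarrow> 't mat \<Rightarrow> bool" where
  "least_sol T n U V X N \<longleftrightarrow>
     mat_over n (dcar T) N \<and>
     mle T n (mstar T n (madd T (mmul T n (mmul T n U N) V) X)) N \<and>
     (\<forall>Y. mat_over n (dcar T) Y \<and>
          mle T n (mstar T n (madd T (mmul T n (mmul T n U Y) V) X)) Y \<longrightarrow> mle T n N Y)"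

definition vmv :: "'t dioid_ops \<Rightarrow> nat \<Rightarrow> (nat \<Rightarrow> 't) \<Rightarrow> 't mat \<Rightarrow> (nat \<Rightarrow> 't) \<Rightarrow> 't" where
  "vmv T n S W F = dsum T (\<lambda>i. dmul T (S i) (dsum T (\<lambda>j. dmul T (W i j) (F j)) n)) n"

end

theory Submission
  imports Defs
begin

text \<open>
  Every element of the tensor product is obtained from \<open>K\<close> and the brackets by \<open>+\<close>, \<open>\<cdot>\<close> and \<open>*\<close>, because
  the generated subalgebra has the universal property as well. Hence it is \<open>S A\<^sup>* F\<close> for an automaton
  whose entries are sums of an opening bracket, a closing bracket and an element of \<open>K\<close>, that is,
  \<open>A = U + X + V\<close>. The entry \<open>N i j\<close> is the sum of the walks from \<open>i\<close> to \<open>j\<close> whose brackets are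
  balanced, each of which evaluates to a product of elements of \<open>K\<close>. To see that this sum exists,
  encode the brackets \<open>b, p\<close> as \<open>bp, pp\<close> and \<open>d, q\<close> as \<open>qd, qq\<close>; if \<open>M\<close> is the matrix obtained from
  \<open>A\<close> in this way, all unbalanced walks cancel to \<open>0\<close> in \<open>N = b M\<^sup>* d\<close>. The equation
  \<open>A\<^sup>* = (NV)\<^sup>* N (UN)\<^sup>*\<close> says that the unmatched closing brackets of a walk precede its unmatched
  opening brackets.
\<close>

subsection \<open>Suprema in R-dioids\<close>

text \<open>An R-dioid has suprema of regular sets only, and \<open>T\<close> is known through its
  universal property alone, whereas the values of the balanced walks form a set of context-free
  kind. This is why \<open>N\<close> has to be written as one regular expression that includes
  brackets. Detecting an empty stack takes a third pair of brackets besides the two stack symbols,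
  and only two pairs are given: hence the code words of length two and the bare pair
  \<open>b\<close>, \<open>d\<close> at the ends. Since \<open>K\<close> commutes with the brackets,
  its elements can be pulled out of a framed walk, leaving a bracket word that reduces to 0 or 1.
  Leastness of \<open>N\<close> is required against every matrix over \<open>T\<close>, so balanced
  walks are compared with a solution one symbol at a time, with a bound for each height of the
  stack. Finally, \<open>A\<^sup>*\<close> and \<open>(NV)\<^sup>* N (UN)\<^sup>*\<close> are not
  compared by star identities: the vectors obtained from them are both least among those closed
  under \<open>U\<close>, \<open>X\<close> and \<open>V\<close>.\<close>

locale rdioid =
  fixes T :: "'t dioid_ops"
  assumes R_dioid: "R_dioid T"
begin

abbreviation carrier_set ("\<C>") where "\<C> \<equiv> dcar T"
abbreviation plus (infixl "\<oplus>" 65) where "x \<oplus> y \<equiv> dadd T x y"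
abbreviation times (infixl "\<odot>" 70) where "x \<odot> y \<equiv> dmul T x y"
abbreviation zero ("\<zero>") where "\<zero> \<equiv> dzero T"
abbreviation one ("\<one>") where "\<one> \<equiv> dunit T"

text \<open>Membership in the carrier is built in, so that it travels along chains of inequalities
  instead of being a side condition of each.\<close>

definition le (infix "\<sqsubseteq>" 50) where "x \<sqsubseteq> y \<longleftrightarrow> x \<in> \<C> \<and> y \<in> \<C> \<and> dle T x y"

lemma dioid: "dioid T"
  using R_dioid by (simp add: R_dioid_def)

lemma closed [simp, intro]:
  "\<zero> \<in> \<C>" "\<one> \<in> \<C>"
  "x \<in> \<C> \<Longrightarrow> y \<in> \<C> \<Longrightarrow> x \<oplus> y \<in> \<C>"
  "x \<in> \<C> \<Longrightarrow> y \<in> \<C> \<Longrightarrow> x \<odot> y \<in> \<C>"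
  using dioid by (auto simp: dioid_def)

lemma add_assoc: "x \<in> \<C> \<Longrightarrow> y \<in> \<C> \<Longrightarrow> z \<in> \<C> \<Longrightarrow> (x \<oplus> y) \<oplus> z = x \<oplus> (y \<oplus> z)"
  and mult_assoc: "x \<in> \<C> \<Longrightarrow> y \<in> \<C> \<Longrightarrow> z \<in> \<C> \<Longrightarrow> (x \<odot> y) \<odot> z = x \<odot> (y \<odot> z)"
  and distrib_left: "x \<in> \<C> \<Longrightarrow> y \<in> \<C> \<Longrightarrow> z \<in> \<C> \<Longrightarrow> x \<odot> (y \<oplus> z) = x \<odot> y \<oplus> x \<odot> z"
  and distrib_right: "x \<in> \<C> \<Longrightarrow> y \<in> \<C> \<Longrightarrow> z \<in> \<C> \<Longrightarrow> (x \<oplus> y) \<odot> z = x \<odot> z \<oplus> y \<odot> z"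
  and add_commute: "x \<in> \<C> \<Longrightarrow> y \<in> \<C> \<Longrightarrow> x \<oplus> y = y \<oplus> x"
  using dioid unfolding dioid_def by blast+

lemma unit_simps [simp]:
  "x \<in> \<C> \<Longrightarrow> x \<oplus> \<zero> = x" "x \<in> \<C> \<Longrightarrow> x \<oplus> x = x"
  "x \<in> \<C> \<Longrightarrow> x \<odot> \<one> = x" "x \<in> \<C> \<Longrightarrow> \<one> \<odot> x = x"
  "x \<in> \<C> \<Longrightarrow> x \<odot> \<zero> = \<zero>" "x \<in> \<C> \<Longrightarrow> \<zero> \<odot> x = \<zero>"
  using dioid unfolding dioid_def by blast+

lemma zero_add [simp]: "x \<in> \<C> \<Longrightarrow> \<zero> \<oplus> x = x"
  using add_commute[of \<zero> x] by simp

lemma le_carrier: "x \<sqsubseteq> y \<Longrightarrow> x \<in> \<C>" "x \<sqsubseteq> y \<Longrightarrow> y \<in> \<C>"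
  by (simp_all add: le_def)

lemma le_refl [simp, intro]: "x \<in> \<C> \<Longrightarrow> x \<sqsubseteq> x"
  by (simp add: le_def dle_def)

lemma le_trans [trans]: "x \<sqsubseteq> y \<Longrightarrow> y \<sqsubseteq> z \<Longrightarrow> x \<sqsubseteq> z"
  unfolding le_def dle_def by (metis add_assoc)

lemma le_antisym: "x \<sqsubseteq> y \<Longrightarrow> y \<sqsubseteq> x \<Longrightarrow> x = y"
  unfolding le_def dle_def by (metis add_commute)

lemma zero_le [simp, intro]: "x \<in> \<C> \<Longrightarrow> \<zero> \<sqsubseteq> x"
  by (simp add: le_def dle_def)

lemma add_upper1 [simp]: "x \<in> \<C> \<Longrightarrow> y \<in> \<C> \<Longrightarrow> x \<sqsubseteq> x \<oplus> y"
  by (simp add: le_def dle_def flip: add_assoc)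

lemma add_upper2 [simp]: "x \<in> \<C> \<Longrightarrow> y \<in> \<C> \<Longrightarrow> y \<sqsubseteq> x \<oplus> y"
  using add_upper1[of y x] add_commute[of x y] by simp

lemma add_least: "x \<sqsubseteq> z \<Longrightarrow> y \<sqsubseteq> z \<Longrightarrow> x \<oplus> y \<sqsubseteq> z"
  by (simp add: le_def dle_def add_assoc)

lemma mult_mono: "x \<sqsubseteq> x' \<Longrightarrow> y \<sqsubseteq> y' \<Longrightarrow> x \<odot> y \<sqsubseteq> x' \<odot> y'"
proof -
  assume a: "x \<sqsubseteq> x'" "y \<sqsubseteq> y'"
  note [simp] = le_carrier[OF a(1)] le_carrier[OF a(2)]
  have "x \<odot> y \<oplus> x \<odot> y' = x \<odot> y'"
    using a by (simp add: le_def dle_def flip: distrib_left)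
  then have 1: "x \<odot> y \<sqsubseteq> x \<odot> y'" by (simp add: le_def dle_def)
  have "x \<odot> y' \<oplus> x' \<odot> y' = x' \<odot> y'"
    using a by (simp add: le_def dle_def flip: distrib_right)
  then have "x \<odot> y' \<sqsubseteq> x' \<odot> y'" by (simp add: le_def dle_def)
  with 1 show ?thesis by (rule le_trans)
qed

lemma mult_mono1: "x \<sqsubseteq> x' \<Longrightarrow> y \<in> \<C> \<Longrightarrow> x \<odot> y \<sqsubseteq> x' \<odot> y"
  and mult_mono2: "y \<sqsubseteq> y' \<Longrightarrow> x \<in> \<C> \<Longrightarrow> x \<odot> y \<sqsubseteq> x \<odot> y'"
  by (simp_all add: mult_mono)

text \<open>\<open>csup A s\<close>: \<open>s\<close> is the least upper bound of \<open>A\<close> and stays so under multiplication from both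
  sides. By \<open>*\<close>-continuity this holds for all regular \<open>A\<close>; \<open>below\<close> is the nontrivial half.\<close>

definition below :: "'t \<Rightarrow> 't set \<Rightarrow> bool" where
  "below s A \<longleftrightarrow> s \<in> \<C> \<and> A \<subseteq> \<C> \<and>
     (\<forall>a\<in>\<C>. \<forall>c\<in>\<C>. \<forall>u. u \<in> \<C> \<longrightarrow> (\<forall>w\<in>A. a \<odot> w \<odot> c \<sqsubseteq> u) \<longrightarrow> a \<odot> s \<odot> c \<sqsubseteq> u)"

definition csup :: "'t set \<Rightarrow> 't \<Rightarrow> bool" where
  "csup A s \<longleftrightarrow> below s A \<and> (\<forall>w\<in>A. w \<sqsubseteq> s)"

lemma belowD:
  assumes "below s A" "a \<in> \<C>" "c \<in> \<C>" "u \<in> \<C>" "\<And>w. w \<in> A \<Longrightarrow> a \<odot> w \<odot> c \<sqsubseteq> u"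
  shows "a \<odot> s \<odot> c \<sqsubseteq> u"
  using assms unfolding below_def by blast

lemma belowD_left:
  assumes "below s A" "a \<in> \<C>" "u \<in> \<C>" "\<And>w. w \<in> A \<Longrightarrow> a \<odot> w \<sqsubseteq> u"
  shows "a \<odot> s \<sqsubseteq> u"
  using belowD[OF assms(1,2), of \<one> u] assms by (auto simp: below_def subset_iff)

lemma belowD_right:
  assumes "below s A" "c \<in> \<C>" "u \<in> \<C>" "\<And>w. w \<in> A \<Longrightarrow> w \<odot> c \<sqsubseteq> u"
  shows "s \<odot> c \<sqsubseteq> u"
  using belowD[OF assms(1), of \<one> c u] assms by (auto simp: below_def subset_iff)

lemma belowD_le:
  assumes "below s A" "u \<in> \<C>" "\<And>w. w \<in> A \<Longrightarrow> w \<sqsubseteq> u"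
  shows "s \<sqsubseteq> u"
  using belowD_left[OF assms(1), of \<one> u] assms by (auto simp: below_def subset_iff)

lemma below_carrier: "below s A \<Longrightarrow> s \<in> \<C>" "below s A \<Longrightarrow> A \<subseteq> \<C>"
  by (auto simp: below_def)

lemma below_member: "w \<in> A \<Longrightarrow> A \<subseteq> \<C> \<Longrightarrow> below w A"
  by (auto simp: below_def)

lemma below_zero: "A \<subseteq> \<C> \<Longrightarrow> below \<zero> A"
  by (auto simp: below_def)

lemma below_mono: "below s A \<Longrightarrow> A \<subseteq> B \<Longrightarrow> B \<subseteq> \<C> \<Longrightarrow> below s B"
  unfolding below_def by blast

lemma below_add: "below s A \<Longrightarrow> below t A \<Longrightarrow> below (s \<oplus> t) A"
  unfolding below_def by (auto simp: distrib_left distrib_right intro!: add_least)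

lemma smul_closed: "A \<subseteq> \<C> \<Longrightarrow> B \<subseteq> \<C> \<Longrightarrow> smul (\<odot>) A B \<subseteq> \<C>"
  by (auto simp: smul_def)

text \<open>The two-sided contexts in \<open>below\<close> pay off here: \<open>s\<close> is
  replaced by members of \<open>A\<close> in the context \<open>a\<close>,
  \<open>t \<odot> c\<close>, then \<open>t\<close> by members of \<open>B\<close> in the context
  \<open>a \<odot> x\<close>, \<open>c\<close>.\<close>

lemma below_mult:
  assumes s: "below s A" and t: "below t B"
  shows "below (s \<odot> t) (smul (\<odot>) A B)"
  unfolding below_def
proof (intro conjI ballI allI impI)
  note [simp] = below_carrier(1)[OF s] below_carrier(1)[OF t]
  have A: "x \<in> A \<Longrightarrow> x \<in> \<C>" and B: "y \<in> B \<Longrightarrow> y \<in> \<C>" for x y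
    using below_carrier[OF s] below_carrier[OF t] by auto
  show "s \<odot> t \<in> \<C>" by simp
  show "smul (\<odot>) A B \<subseteq> \<C>" using A B by (auto simp: smul_def)
  fix a c u assume [simp]: "a \<in> \<C>" "c \<in> \<C>" "u \<in> \<C>"
    and h: "\<forall>w\<in>smul (\<odot>) A B. a \<odot> w \<odot> c \<sqsubseteq> u"
  have "a \<odot> s \<odot> (t \<odot> c) \<sqsubseteq> u"
  proof (rule belowD[OF s])
    fix x assume x: "x \<in> A" note [simp] = A[OF x]
    have "a \<odot> x \<odot> t \<odot> c \<sqsubseteq> u"
    proof (rule belowD[OF t])
      fix y assume y: "y \<in> B"
      with x have "x \<odot> y \<in> smul (\<odot>) A B" by (auto simp: smul_def)
      with h B[OF y] show "a \<odot> x \<odot> y \<odot> c \<sqsubseteq> u" by (auto simp: mult_assoc)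
    qed simp_all
    then show "a \<odot> x \<odot> (t \<odot> c) \<sqsubseteq> u" by (simp add: mult_assoc)
  qed simp_all
  then show "a \<odot> (s \<odot> t) \<odot> c \<sqsubseteq> u" by (simp add: mult_assoc)
qed

lemma csup_carrier: "csup A s \<Longrightarrow> s \<in> \<C>" "csup A s \<Longrightarrow> A \<subseteq> \<C>"
  by (auto simp: csup_def below_def)

lemma csup_is_lub: "csup A s \<Longrightarrow> is_lub T A s"
  unfolding is_lub_def
proof (intro conjI allI ballI impI)
  assume s: "csup A s"
  show "s \<in> \<C>" by (rule csup_carrier(1)[OF s])
  fix u assume u: "u \<in> \<C>" "\<forall>a\<in>A. dle T a u"
  have "s \<sqsubseteq> u"
    by (rule belowD_le[of s A]) (use s u csup_carrier[OF s] in \<open>auto simp: csup_def le_def\<close>)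
  then show "dle T s u" by (simp add: le_def)
qed (auto simp: csup_def le_def)

lemma is_lub_unique: "is_lub T A s \<Longrightarrow> is_lub T A t \<Longrightarrow> s = t"
  by (rule le_antisym) (auto simp: is_lub_def le_def)

lemma rsum_eqI: "is_lub T A s \<Longrightarrow> rsum T A = s"
  unfolding rsum_def by (rule the_equality) (auto intro: is_lub_unique)

lemma mclos_closed: "A \<subseteq> \<C> \<Longrightarrow> mclos (\<odot>) \<one> A \<subseteq> \<C>"
proof
  fix x assume A: "A \<subseteq> \<C>" and "x \<in> mclos (\<odot>) \<one> A"
  from this(2) show "x \<in> \<C>" by induction (use A in auto)
qed

lemma Reg_closed: "A \<in> Reg T \<Longrightarrow> A \<subseteq> \<C>"
  by (induction rule: rat.induct) (simp_all add: smul_closed mclos_closed)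

text \<open>The outer factors are absorbed into the set: \<open>{a} A {c}\<close> is regular again,
  and the product law for regular sums turns its supremum into
  \<open>a \<odot> rsum T A \<odot> c\<close>.\<close>

lemma csup_rsum:
  assumes A: "A \<in> Reg T"
  shows "csup A (rsum T A)"
proof -
  have lub: "is_lub T B (rsum T B)" if B: "B \<in> Reg T" for B
  proof -
    obtain s where s: "is_lub T B s" using R_dioid B unfolding R_dioid_def by blast
    with rsum_eqI[OF s] show ?thesis by simp
  qed
  have sing: "rsum T {x} = x" if "x \<in> \<C>" for x
    using that by (intro rsum_eqI) (auto simp: is_lub_def dle_def)
  have [simp]: "rsum T A \<in> \<C>" using lub[OF A] by (simp add: is_lub_def)
  show ?thesis
    unfolding csup_def below_def
  proof (intro conjI ballI allI impI)
    show "A \<subseteq> \<C>" by (rule Reg_closed[OF A])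
    fix a c u assume [simp]: "a \<in> \<C>" "c \<in> \<C>" "u \<in> \<C>"
      and h: "\<forall>w\<in>A. a \<odot> w \<odot> c \<sqsubseteq> u"
    let ?B = "smul (\<odot>) (smul (\<odot>) {a} A) {c}"
    have aA: "smul (\<odot>) {a} A \<in> Reg T"
      by (intro rat_mult rat_single A) simp_all
    have B: "?B \<in> Reg T"
      by (intro rat_mult rat_single aA) simp_all
    have rsum_mult: "rsum T (smul (\<odot>) B D) = rsum T B \<odot> rsum T D"
      if "B \<in> Reg T" "D \<in> Reg T" for B D
      using R_dioid that unfolding R_dioid_def by blast
    have "rsum T ?B = a \<odot> rsum T A \<odot> c"
      using aA A by (subst rsum_mult | simp add: rat_single sing)+
    with lub[OF B] have "is_lub T ?B (a \<odot> rsum T A \<odot> c)" by simp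
    moreover have "dle T w u" if "w \<in> ?B" for w
      using that h by (auto simp: smul_def le_def)
    ultimately show "a \<odot> rsum T A \<odot> c \<sqsubseteq> u"
      unfolding is_lub_def le_def by simp
  next
    fix w assume "w \<in> A"
    then show "w \<sqsubseteq> rsum T A"
      using lub[OF A] Reg_closed[OF A] by (auto simp: is_lub_def le_def)
  qed simp
qed

section \<open>The star as a supremum of powers\<close>

lemma csup_rstar: "x \<in> \<C> \<Longrightarrow> csup (mclos (\<odot>) \<one> {x}) (rstar T x)"
  unfolding rstar_def by (intro csup_rsum rat_star rat_single)

lemma rstar_closed [simp, intro]: "x \<in> \<C> \<Longrightarrow> rstar T x \<in> \<C>"
  by (rule csup_carrier(1)[OF csup_rstar])

lemma rstar_ge_one [simp]: "x \<in> \<C> \<Longrightarrow> \<one> \<sqsubseteq> rstar T x"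
  using csup_rstar[of x] mclos_unit[of \<one> "(\<odot>)" "{x}"] unfolding csup_def by blast

lemma rstar_unfold:
  assumes [simp]: "x \<in> \<C>"
  shows "x \<odot> rstar T x \<sqsubseteq> rstar T x"
proof (rule belowD_left[where A = "mclos (\<odot>) \<one> {x}"])
  show "below (rstar T x) (mclos (\<odot>) \<one> {x})"
    using csup_rstar[of x] by (simp add: csup_def)
  fix w assume "w \<in> mclos (\<odot>) \<one> {x}"
  then have "x \<odot> w \<in> mclos (\<odot>) \<one> {x}" by (simp add: mclos_step)
  then show "x \<odot> w \<sqsubseteq> rstar T x"
    using csup_rstar[of x] unfolding csup_def by simp
qed simp_all

text \<open>Continuity reduces the claim to the powers of \<open>x\<close>, which \<open>u\<close>
  absorbs one factor at a time.\<close>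

lemma rstar_induct:
  assumes [simp]: "x \<in> \<C>" "c \<in> \<C>" and "c \<sqsubseteq> u" "x \<odot> u \<sqsubseteq> u"
  shows "rstar T x \<odot> c \<sqsubseteq> u"
proof (rule belowD_right[where A = "mclos (\<odot>) \<one> {x}"])
  show "u \<in> \<C>" by (rule le_carrier(2)[OF assms(3)])
  fix w assume "w \<in> mclos (\<odot>) \<one> {x}"
  then show "w \<odot> c \<sqsubseteq> u"
  proof induction
    case mclos_unit then show ?case using assms by simp
  next
    case (mclos_step a w)
    have "w \<in> \<C>" using mclos_step mclos_closed[of "{x}"] by auto
    then have "x \<odot> w \<odot> c \<sqsubseteq> x \<odot> u" using mclos_step by (simp add: mult_assoc mult_mono2)
    also have "\<dots> \<sqsubseteq> u" by fact
    finally show ?case using mclos_step(1) by simp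
  qed
qed (use csup_rstar[of x] in \<open>simp_all add: csup_def\<close>)

text \<open>A product of copies of \<open>s\<close> is bounded by exchanging its factors, from left
  to right, for members of \<open>A\<close>; the result is an element of
  \<open>mclos (\<odot>) \<one> A\<close>.\<close>

lemma below_star:
  assumes s: "below s A"
  shows "below (rstar T s) (mclos (\<odot>) \<one> A)"
  unfolding below_def
proof (intro conjI ballI allI impI)
  note [simp] = below_carrier(1)[OF s]
  have A: "x \<in> A \<Longrightarrow> x \<in> \<C>" for x using below_carrier[OF s] by auto
  show "rstar T s \<in> \<C>" by simp
  show mA: "mclos (\<odot>) \<one> A \<subseteq> \<C>" using A by (intro mclos_closed) auto
  fix a c u assume [simp]: "a \<in> \<C>" "c \<in> \<C>" "u \<in> \<C>"
    and h: "\<forall>w\<in>mclos (\<odot>) \<one> A. a \<odot> w \<odot> c \<sqsubseteq> u"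
  show "a \<odot> rstar T s \<odot> c \<sqsubseteq> u"
  proof (rule belowD)
    show "below (rstar T s) (mclos (\<odot>) \<one> {s})" using csup_rstar[of s] by (simp add: csup_def)
    fix w assume w: "w \<in> mclos (\<odot>) \<one> {s}"
    \<comment> \<open>The left context varies because every factor already exchanged moves into
      it.\<close>
    have "a' \<in> \<C> \<Longrightarrow> \<forall>w\<in>mclos (\<odot>) \<one> A. a' \<odot> w \<odot> c \<sqsubseteq> u \<Longrightarrow> a' \<odot> w \<odot> c \<sqsubseteq> u" for a'
      using w
    proof (induction arbitrary: a')
      case mclos_unit then show ?case by (blast intro: mclos.mclos_unit)
    next
      case (mclos_step x w)
      have w [simp]: "w \<in> \<C>" using mclos_step(2) mclos_closed[of "{s}"] by auto
      have [simp]: "a' \<in> \<C>" by fact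
      have "a' \<odot> s \<odot> (w \<odot> c) \<sqsubseteq> u"
      proof (rule belowD[OF s])
        fix y assume y: "y \<in> A" note [simp] = A[OF y]
        have "a' \<odot> y \<odot> w \<odot> c \<sqsubseteq> u"
        proof (rule mclos_step.IH, simp, intro ballI)
          fix v assume v: "v \<in> mclos (\<odot>) \<one> A"
          have "v \<in> \<C>" using v mA by auto
          moreover have "y \<odot> v \<in> mclos (\<odot>) \<one> A" using y v by (rule mclos.mclos_step)
          ultimately show "a' \<odot> y \<odot> v \<odot> c \<sqsubseteq> u"
            using mclos_step.prems by (auto simp: mult_assoc)
        qed
        then show "a' \<odot> y \<odot> (w \<odot> c) \<sqsubseteq> u" by (simp add: mult_assoc)
      qed simp_all
      with mclos_step(1) show ?case by (simp add: mult_assoc)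
    qed
    then show "a \<odot> w \<odot> c \<sqsubseteq> u" using h by simp
  qed simp_all
qed

lemma csup_star:
  assumes "csup A s"
  shows "csup (mclos (\<odot>) \<one> A) (rstar T s)"
  unfolding csup_def
proof (intro conjI ballI)
  show "below (rstar T s) (mclos (\<odot>) \<one> A)" using assms below_star by (simp add: csup_def)
  note [simp] = csup_carrier(1)[OF assms]
  fix w assume "w \<in> mclos (\<odot>) \<one> A"
  then show "w \<sqsubseteq> rstar T s"
  proof induction
    case (mclos_step a x)
    then have "a \<odot> x \<sqsubseteq> s \<odot> rstar T s" using assms by (intro mult_mono) (auto simp: csup_def)
    also have "\<dots> \<sqsubseteq> rstar T s" by (simp add: rstar_unfold)
    finally show ?case .
  qed simp
qed

lemma dsum_closed [simp, intro]: "(\<And>k. k < n \<Longrightarrow> f k \<in> \<C>) \<Longrightarrow> dsum T f n \<in> \<C>"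
  by (induction n) auto

lemma dsum_upper:
  assumes "k < n" "\<And>k. k < n \<Longrightarrow> f k \<in> \<C>"
  shows "f k \<sqsubseteq> dsum T f n"
  using assms
proof (induction n)
  case (Suc n)
  then have [simp]: "f n \<in> \<C>" "dsum T f n \<in> \<C>" by simp_all
  show ?case
  proof (cases "k = n")
    case True then show ?thesis by simp
  next
    case False
    with Suc have "f k \<sqsubseteq> dsum T f n" by simp
    also have "\<dots> \<sqsubseteq> dsum T f n \<oplus> f n" by simp
    finally show ?thesis by simp
  qed
qed simp

lemma below_dsum: "(\<And>k. k < n \<Longrightarrow> below (f k) A) \<Longrightarrow> A \<subseteq> \<C> \<Longrightarrow> below (dsum T f n) A"
  by (induction n) (auto intro: below_zero below_add)

lemma dsum_below:
  assumes "\<And>k. k < n \<Longrightarrow> f k \<in> \<C>"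
  shows "below (dsum T f n) (f ` {..<n})"
  using assms by (intro below_dsum) (auto intro: below_member)

lemma dsum_least: "(\<And>k. k < n \<Longrightarrow> f k \<sqsubseteq> u) \<Longrightarrow> u \<in> \<C> \<Longrightarrow> dsum T f n \<sqsubseteq> u"
  by (rule belowD_le[OF dsum_below]) (auto dest: le_carrier)

lemma dsum_least_left:
  assumes "\<And>k. k < n \<Longrightarrow> f k \<in> \<C>" "x \<in> \<C>" "u \<in> \<C>" "\<And>k. k < n \<Longrightarrow> x \<odot> f k \<sqsubseteq> u"
  shows "x \<odot> dsum T f n \<sqsubseteq> u"
  by (rule belowD_left[OF dsum_below]) (use assms in auto)

lemma dsum_least_right:
  assumes "\<And>k. k < n \<Longrightarrow> f k \<in> \<C>" "x \<in> \<C>" "u \<in> \<C>" "\<And>k. k < n \<Longrightarrow> f k \<odot> x \<sqsubseteq> u"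
  shows "dsum T f n \<odot> x \<sqsubseteq> u"
  by (rule belowD_right[OF dsum_below]) (use assms in auto)

subsection \<open>Matrices\<close>

abbreviation is_mat :: "nat \<Rightarrow> 't mat \<Rightarrow> bool" where "is_mat n A \<equiv> mat_over n \<C> A"

lemma is_matD [simp]: "is_mat n A \<Longrightarrow> i < n \<Longrightarrow> j < n \<Longrightarrow> A i j \<in> \<C>"
  by (simp add: mat_over_def)

lemma is_mat_madd [simp, intro]: "is_mat n A \<Longrightarrow> is_mat n B \<Longrightarrow> is_mat n (madd T A B)"
  by (simp add: mat_over_def madd_def)

lemma is_mat_mmul [simp, intro]: "is_mat n A \<Longrightarrow> is_mat n B \<Longrightarrow> is_mat n (mmul T n A B)"
  by (simp add: mat_over_def mmul_def)

lemma mmul_closed [simp]: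
  "is_mat n A \<Longrightarrow> is_mat n B \<Longrightarrow> i < n \<Longrightarrow> j < n \<Longrightarrow> mmul T n A B i j \<in> \<C>"
  using is_mat_mmul by (rule is_matD)

lemma mmul_upper:
  "is_mat n A \<Longrightarrow> is_mat n B \<Longrightarrow> i < n \<Longrightarrow> k < n \<Longrightarrow> j < n \<Longrightarrow> A i k \<odot> B k j \<sqsubseteq> mmul T n A B i j"
  unfolding mmul_def by (rule dsum_upper[where f = "\<lambda>k. A i k \<odot> B k j"]) auto

lemma mmul_le:
  assumes "is_mat n A" "is_mat n B" "i < n" "j < n" "a \<in> \<C>" "c \<in> \<C>" "u \<in> \<C>"
    and "\<And>k. k < n \<Longrightarrow> a \<odot> (A i k \<odot> B k j) \<odot> c \<sqsubseteq> u"
  shows "a \<odot> mmul T n A B i j \<odot> c \<sqsubseteq> u"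
  unfolding mmul_def by (rule belowD[OF dsum_below]) (use assms in auto)

lemma mmul_le_left:
  assumes "is_mat n A" "is_mat n B" "i < n" "j < n" "c \<in> \<C>" "u \<in> \<C>"
    and "\<And>k. k < n \<Longrightarrow> c \<odot> (A i k \<odot> B k j) \<sqsubseteq> u"
  shows "c \<odot> mmul T n A B i j \<sqsubseteq> u"
  unfolding mmul_def by (rule dsum_least_left) (use assms in auto)

lemma mmul_le_right:
  assumes "is_mat n A" "is_mat n B" "i < n" "j < n" "c \<in> \<C>" "u \<in> \<C>"
    and "\<And>k. k < n \<Longrightarrow> A i k \<odot> (B k j \<odot> c) \<sqsubseteq> u"
  shows "mmul T n A B i j \<odot> c \<sqsubseteq> u"
  unfolding mmul_def by (rule dsum_least_right) (use assms in \<open>auto simp: mult_assoc\<close>)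

section \<open>Walks and the block formula for the matrix star\<close>

inductive walk :: "nat \<Rightarrow> 't mat \<Rightarrow> nat \<Rightarrow> 't \<Rightarrow> nat \<Rightarrow> bool" for n M j where
  walk_Nil: "j < n \<Longrightarrow> walk n M j \<one> j"
| walk_Cons: "i < n \<Longrightarrow> k < n \<Longrightarrow> walk n M j w k \<Longrightarrow> walk n M j (M i k \<odot> w) i"

definition walks :: "nat \<Rightarrow> 't mat \<Rightarrow> nat \<Rightarrow> nat \<Rightarrow> 't set" where
  "walks n M i j = {w. walk n M j w i}"

lemma walks_closed: "is_mat n M \<Longrightarrow> walks n M i j \<subseteq> \<C>"
proof
  fix w assume M: "is_mat n M" and "w \<in> walks n M i j"
  from this(2)[unfolded walks_def, simplified] show "w \<in> \<C>"
    by induction (use M in auto)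
qed

lemma walk_append:
  assumes M: "is_mat n M"
  shows "walk n M j v i \<Longrightarrow> walk n M k w j \<Longrightarrow> walk n M k (v \<odot> w) i"
proof (induction rule: walk.induct)
  case walk_Nil
  then have "w \<in> \<C>" using walks_closed[OF M] by (auto simp: walks_def)
  with walk_Nil show ?case by simp
next
  case (walk_Cons i l v)
  then have "v \<in> \<C>" "w \<in> \<C>" using walks_closed[OF M] by (auto simp: walks_def)
  with walk_Cons M walk.walk_Cons[of i n l M k "v \<odot> w"] show ?case by (simp add: mult_assoc)
qed

lemma below_walks_mult:
  assumes "is_mat n M" "below s (walks n M i j)" "below t (walks n M j k)"
  shows "below (s \<odot> t) (walks n M i k)"
  by (rule below_mono[OF below_mult[OF assms(2,3)] _ walks_closed[OF assms(1)]])
    (auto simp: smul_def walks_def intro: walk_append[OF assms(1)])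

lemma below_walks_star:
  assumes "is_mat n M" "i < n" "below s (walks n M i i)"
  shows "below (rstar T s) (walks n M i i)"
proof (rule below_mono[OF below_star[OF assms(3)] _ walks_closed[OF assms(1)]], rule subsetI)
  fix w assume "w \<in> mclos (\<odot>) \<one> (walks n M i i)"
  then show "w \<in> walks n M i i"
  proof induction
    case mclos_unit then show ?case by (simp add: walks_def walk_Nil assms(2))
  next
    case (mclos_step a x) then show ?case by (auto simp: walks_def intro: walk_append[OF assms(1), of i a i])
  qed
qed

lemma below_walks_edge:
  assumes "is_mat n M" "i < n" "j < n"
  shows "below (M i j) (walks n M i j)"
  by (rule below_member[OF _ walks_closed[OF assms(1)]])
    (use walk_Cons[OF assms(2,3) walk_Nil[OF assms(3)], of M] assms in \<open>simp add: walks_def\<close>)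

lemma walks_shift:
  "walks n (\<lambda>i j. M (Suc i) (Suc j)) i j \<subseteq> walks (Suc n) M (Suc i) (Suc j)"
proof
  fix w assume "w \<in> walks n (\<lambda>i j. M (Suc i) (Suc j)) i j"
  then have "walk n (\<lambda>i j. M (Suc i) (Suc j)) j w i" by (simp add: walks_def)
  then show "w \<in> walks (Suc n) M (Suc i) (Suc j)"
    by induction (auto simp: walks_def intro: walk.intros)
qed

text \<open>The block formula uses sums, products and stars only, and each of them stays below the
  corresponding set of walks: walks concatenate, and loops at a state iterate. Walks of the lower
  right block are walks of \<open>M\<close> after a shift of the indices.\<close>

lemma below_mstar: "is_mat n M \<Longrightarrow> i < n \<Longrightarrow> j < n \<Longrightarrow> below (mstar T n M i j) (walks n M i j)"
proof (induction n arbitrary: M i j)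
  case (Suc n)
  note W = walks_closed[OF Suc.prems(1)]
  define Ds where "Ds = mstar T n (\<lambda>i j. M (Suc i) (Suc j))"
  define bDs where "bDs = (\<lambda>j. dsum T (\<lambda>k. M 0 (Suc k) \<odot> Ds k j) n)"
  define Dsc where "Dsc = (\<lambda>i. dsum T (\<lambda>k. Ds i k \<odot> M (Suc k) 0) n)"
  define e where "e = rstar T (M 0 0 \<oplus> dsum T (\<lambda>k. bDs k \<odot> M (Suc k) 0) n)"
  note edge = below_walks_edge[OF Suc.prems(1)] and mult = below_walks_mult[OF Suc.prems(1)]
  have Ds: "below (Ds k l) (walks (Suc n) M (Suc k) (Suc l))" if "k < n" "l < n" for k l
    unfolding Ds_def
    by (rule below_mono[OF Suc.IH walks_shift W]) (use Suc.prems that in \<open>auto simp: mat_over_def\<close>)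
  have bDs: "below (bDs k) (walks (Suc n) M 0 (Suc k))" if "k < n" for k
    unfolding bDs_def using that by (intro below_dsum W mult[OF edge Ds]) auto
  have Dsc: "below (Dsc k) (walks (Suc n) M (Suc k) 0)" if "k < n" for k
    unfolding Dsc_def using that by (intro below_dsum W mult[OF Ds edge]) auto
  have e: "below e (walks (Suc n) M 0 0)"
    unfolding e_def using Suc.prems
    by (intro below_walks_star below_add below_dsum W mult[OF bDs edge] edge) auto
  have eq: "mstar T (Suc n) M i j = (if i = 0 \<and> j = 0 then e
               else if i = 0 then e \<odot> bDs (j - 1)
               else if j = 0 then Dsc (i - 1) \<odot> e
               else Ds (i - 1) (j - 1) \<oplus> (Dsc (i - 1) \<odot> e) \<odot> bDs (j - 1))"
    by (simp add: Let_def Ds_def bDs_def Dsc_def e_def)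
  show ?case
    unfolding eq using Suc.prems
      e mult[OF e bDs, of "j - 1"] mult[OF Dsc e, of "i - 1"]
      below_add[OF Ds mult[OF mult[OF Dsc e] bDs], of "i - 1" "j - 1"]
    by (cases i; cases j) (simp_all del: mstar.simps)
qed simp

lemma is_mat_mstar [simp, intro]: "is_mat n M \<Longrightarrow> is_mat n (mstar T n M)"
  using below_carrier(1)[OF below_mstar] by (simp add: mat_over_def)

lemma mstar_closed [simp]: "is_mat n M \<Longrightarrow> i < n \<Longrightarrow> j < n \<Longrightarrow> mstar T n M i j \<in> \<C>"
  using is_mat_mstar by (rule is_matD)

text \<open>With \<open>mstar_induct\<close> this makes column \<open>j\<close> of the star the
  least vector that is closed under \<open>M\<close> and is above \<open>\<one>\<close> at
  \<open>j\<close>. In the block formula the cases rest on \<open>f = a + b D\<^sup>* c\<close>,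
  whose star \<open>e\<close> absorbs it on the left.\<close>

lemma mstar_laws:
  "is_mat n M \<Longrightarrow> (\<forall>i<n. \<one> \<sqsubseteq> mstar T n M i i) \<and>
     (\<forall>i<n. \<forall>k<n. \<forall>j<n. M i k \<odot> mstar T n M k j \<sqsubseteq> mstar T n M i j)"
proof (induction n arbitrary: M)
  case (Suc n)
  let ?D = "\<lambda>i j. M (Suc i) (Suc j)"
  define Ds where "Ds = mstar T n ?D"
  define bDs where "bDs = (\<lambda>j. dsum T (\<lambda>k. M 0 (Suc k) \<odot> Ds k j) n)"
  define Dsc where "Dsc = (\<lambda>i. dsum T (\<lambda>k. Ds i k \<odot> M (Suc k) 0) n)"
  define f where "f = M 0 0 \<oplus> dsum T (\<lambda>k. bDs k \<odot> M (Suc k) 0) n"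
  define e where "e = rstar T f"
  have M [simp]: "i < Suc n \<Longrightarrow> j < Suc n \<Longrightarrow> M i j \<in> \<C>" for i j using Suc.prems by simp
  have D: "is_mat n ?D" by (simp add: mat_over_def)
  have Ds [simp]: "i < n \<Longrightarrow> j < n \<Longrightarrow> Ds i j \<in> \<C>" for i j
    using is_mat_mstar[OF D] by (simp add: Ds_def)
  have one: "i < n \<Longrightarrow> \<one> \<sqsubseteq> Ds i i" and step: "i < n \<Longrightarrow> k < n \<Longrightarrow> j < n \<Longrightarrow> M (Suc i) (Suc k) \<odot> Ds k j \<sqsubseteq> Ds i j" for i k j
    using Suc.IH[OF D] by (auto simp: Ds_def)
  have bDs [simp]: "k < n \<Longrightarrow> bDs k \<in> \<C>" and Dsc [simp]: "k < n \<Longrightarrow> Dsc k \<in> \<C>" for k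
    by (auto simp: bDs_def Dsc_def)
  have f [simp]: "f \<in> \<C>" unfolding f_def by (auto simp: bDs_def)
  then have e [simp]: "e \<in> \<C>" by (simp add: e_def)
  have e1: "\<one> \<sqsubseteq> e" and fe: "f \<odot> e \<sqsubseteq> e" by (simp_all add: e_def rstar_unfold)
  have le_e: "x \<odot> e \<odot> z \<sqsubseteq> e \<odot> z" if "x \<sqsubseteq> f" "z \<in> \<C>" for x z
    using le_trans[OF mult_mono1[OF that(1) e] fe] that by (intro mult_mono1)
  have e_ge: "z \<sqsubseteq> e \<odot> z" if "z \<in> \<C>" for z
    using mult_mono1[OF e1 that] that by simp
  have bD: "k < n \<Longrightarrow> l < n \<Longrightarrow> M 0 (Suc k) \<odot> Ds k l \<sqsubseteq> bDs l" for k l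
    unfolding bDs_def by (rule dsum_upper[where f = "\<lambda>k. M 0 (Suc k) \<odot> Ds k l"]) auto
  have Dc: "k < n \<Longrightarrow> l < n \<Longrightarrow> Ds k l \<odot> M (Suc l) 0 \<sqsubseteq> Dsc k" for k l
    unfolding Dsc_def by (rule dsum_upper[where f = "\<lambda>l. Ds k l \<odot> M (Suc l) 0"]) auto
  have af: "M 0 0 \<sqsubseteq> f" unfolding f_def by (rule add_upper1) auto
  have bDcf: "bDs l \<odot> M (Suc l) 0 \<sqsubseteq> f" if "l < n" for l
  proof -
    have "bDs l \<odot> M (Suc l) 0 \<sqsubseteq> dsum T (\<lambda>k. bDs k \<odot> M (Suc k) 0) n"
      by (rule dsum_upper[where f = "\<lambda>k. bDs k \<odot> M (Suc k) 0"]) (use that in auto)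
    also have "\<dots> \<sqsubseteq> f" unfolding f_def by (rule add_upper2) auto
    finally show ?thesis .
  qed
  \<comment> \<open>\<open>f\<close> is built from the product \<open>b D\<^sup>*\<close> times
    \<open>c\<close>, while here \<open>b\<close> meets the product \<open>D\<^sup>* c\<close>; the
    summands of both are the same.\<close>
  have bf: "M 0 (Suc k) \<odot> Dsc k \<sqsubseteq> f" if "k < n" for k
    unfolding Dsc_def
  proof (rule dsum_least_left)
    fix l assume l: "l < n"
    have "M 0 (Suc k) \<odot> Ds k l \<odot> M (Suc l) 0 \<sqsubseteq> bDs l \<odot> M (Suc l) 0"
      by (rule mult_mono1[OF bD]) (use that l in auto)
    also have "\<dots> \<sqsubseteq> f" by (rule bDcf[OF l])
    finally show "M 0 (Suc k) \<odot> (Ds k l \<odot> M (Suc l) 0) \<sqsubseteq> f"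
      using that l by (simp add: mult_assoc)
  qed (use that in auto)
  have c_le: "M (Suc i) 0 \<sqsubseteq> Dsc i" if "i < n" for i
    using le_trans[OF mult_mono1[OF one[OF that], of "M (Suc i) 0"] Dc[of i i]] that by simp
  have D_le: "M (Suc i) (Suc k) \<odot> Dsc k \<sqsubseteq> Dsc i" if "i < n" "k < n" for i k
    unfolding Dsc_def[of]
  proof (rule dsum_least_left)
    fix l assume l: "l < n"
    have "M (Suc i) (Suc k) \<odot> Ds k l \<odot> M (Suc l) 0 \<sqsubseteq> Ds i l \<odot> M (Suc l) 0"
      by (rule mult_mono1[OF step]) (use that l in auto)
    also have "\<dots> \<sqsubseteq> Dsc i" by (rule Dc) (use that l in auto)
    finally show "M (Suc i) (Suc k) \<odot> (Ds k l \<odot> M (Suc l) 0) \<sqsubseteq> dsum T (\<lambda>k. Ds i k \<odot> M (Suc k) 0) n"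
      using that l by (simp add: mult_assoc Dsc_def)
  qed (use that in \<open>auto simp flip: Dsc_def\<close>)
  have eq: "mstar T (Suc n) M i j = (if i = 0 \<and> j = 0 then e
               else if i = 0 then e \<odot> bDs (j - 1)
               else if j = 0 then Dsc (i - 1) \<odot> e
               else Ds (i - 1) (j - 1) \<oplus> (Dsc (i - 1) \<odot> e) \<odot> bDs (j - 1))" for i j
    by (simp add: Let_def Ds_def bDs_def Dsc_def e_def f_def)
  have eq_00: "mstar T (Suc n) M 0 0 = e"
    and eq_0S: "mstar T (Suc n) M 0 (Suc j) = e \<odot> bDs j"
    and eq_S0: "mstar T (Suc n) M (Suc i) 0 = Dsc i \<odot> e"
    and eq_SS: "mstar T (Suc n) M (Suc i) (Suc j) = Ds i j \<oplus> (Dsc i \<odot> e) \<odot> bDs j" for i j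
    by (simp_all add: eq del: mstar.simps)
  note eqs = eq_00 eq_0S eq_S0 eq_SS
  show ?case
  proof (intro conjI allI impI)
    fix i assume "i < Suc n"
    then show "\<one> \<sqsubseteq> mstar T (Suc n) M i i"
      using e1 le_trans[OF one add_upper1]
      by (cases i) (auto simp: eqs simp del: mstar.simps)
  next
    fix i k j assume "i < Suc n" "k < Suc n" "j < Suc n"
    then show "M i k \<odot> mstar T (Suc n) M k j \<sqsubseteq> mstar T (Suc n) M i j"
    proof (cases i; cases k; cases j)
      assume "i = 0" "k = 0" "j = 0"
      then show ?thesis
        using le_e[OF af, of \<one>] by (simp add: eqs del: mstar.simps)
    next
      fix j' assume "i = 0" "k = 0" "j = Suc j'" "j < Suc n"
      then show ?thesis
        using le_e[OF af, of "bDs j'"] by (simp add: eqs mult_assoc del: mstar.simps)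
    next
      fix k' assume "i = 0" "k = Suc k'" "j = 0" "k < Suc n"
      then show ?thesis
        using le_e[OF bf, of k' \<one>] by (simp add: eqs mult_assoc del: mstar.simps)
    next
      fix k' j' assume *: "i = 0" "k = Suc k'" "j = Suc j'" "k < Suc n" "j < Suc n"
      then show ?thesis
        using le_e[OF bf, of k' "bDs j'"] le_trans[OF bD e_ge, of k' j']
        by (auto simp: eqs mult_assoc distrib_left simp del: mstar.simps intro!: add_least)
    next
      fix i' assume "i = Suc i'" "k = 0" "j = 0" "i < Suc n"
      then show ?thesis
        using mult_mono1[OF c_le e] by (simp add: eqs mult_assoc del: mstar.simps)
    next
      fix i' j' assume *: "i = Suc i'" "k = 0" "j = Suc j'" "i < Suc n" "j < Suc n"
      then have "M (Suc i') 0 \<odot> (e \<odot> bDs j') \<sqsubseteq> Dsc i' \<odot> (e \<odot> bDs j')"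
        by (intro mult_mono1 c_le) auto
      also have "\<dots> \<sqsubseteq> Ds i' j' \<oplus> (Dsc i' \<odot> e) \<odot> bDs j'"
        using * by (simp add: mult_assoc)
      finally show ?thesis using * by (simp add: eqs del: mstar.simps)
    next
      fix i' k' assume "i = Suc i'" "k = Suc k'" "j = 0" "i < Suc n" "k < Suc n"
      then show ?thesis
        using mult_mono1[OF D_le e, of i' k'] by (simp add: eqs mult_assoc del: mstar.simps)
    next
      fix i' k' j' assume *: "i = Suc i'" "k = Suc k'" "j = Suc j'" "i < Suc n" "k < Suc n" "j < Suc n"
      let ?u = "Ds i' j' \<oplus> (Dsc i' \<odot> e) \<odot> bDs j'"
      have "M (Suc i') (Suc k') \<odot> Ds k' j' \<sqsubseteq> ?u"
        by (rule le_trans[OF step add_upper1]) (use * in auto)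
      moreover have "M (Suc i') (Suc k') \<odot> Dsc k' \<odot> (e \<odot> bDs j') \<sqsubseteq> Dsc i' \<odot> (e \<odot> bDs j')"
        by (rule mult_mono1[OF D_le]) (use * in auto)
      moreover have "Dsc i' \<odot> (e \<odot> bDs j') \<sqsubseteq> ?u"
        using * by (simp add: mult_assoc)
      ultimately have "M (Suc i') (Suc k') \<odot> Ds k' j' \<oplus> M (Suc i') (Suc k') \<odot> Dsc k' \<odot> (e \<odot> bDs j') \<sqsubseteq> ?u"
        by (blast intro: add_least le_trans)
      then show ?thesis using *
        by (simp add: eqs distrib_left mult_assoc del: mstar.simps)
    qed
  qed
qed simp

lemma mstar_ge_one: "is_mat n M \<Longrightarrow> i < n \<Longrightarrow> \<one> \<sqsubseteq> mstar T n M i i"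
  and mstar_step: "is_mat n M \<Longrightarrow> i < n \<Longrightarrow> k < n \<Longrightarrow> j < n \<Longrightarrow>
    M i k \<odot> mstar T n M k j \<sqsubseteq> mstar T n M i j"
  using mstar_laws[of n M] by auto

text \<open>Walks are bounded from their end: \<open>x j\<close> takes up \<open>c\<close>, and each
  further edge leads from \<open>x k\<close> to \<open>x i\<close>.\<close>

lemma mstar_induct:
  assumes M: "is_mat n M" and ij: "i < n" "j < n" and c: "c \<sqsubseteq> x j"
    and step: "\<And>i k. i < n \<Longrightarrow> k < n \<Longrightarrow> M i k \<odot> x k \<sqsubseteq> x i"
  shows "mstar T n M i j \<odot> c \<sqsubseteq> x i"
proof (rule belowD_right[OF below_mstar[OF M ij]])
  note [simp] = le_carrier[OF c]
  show "x i \<in> \<C>" by (rule le_carrier(2)[OF step[OF ij(1) ij(1)]])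
  fix w assume "w \<in> walks n M i j"
  then have "walk n M j w i" by (simp add: walks_def)
  then show "w \<odot> c \<sqsubseteq> x i"
  proof induction
    case (walk_Cons i k w)
    then have "w \<in> \<C>" using walks_closed[OF M] by (auto simp: walks_def)
    with walk_Cons M have "M i k \<odot> w \<odot> c \<sqsubseteq> M i k \<odot> x k"
      by (simp add: mult_assoc mult_mono2)
    also have "\<dots> \<sqsubseteq> x i" using step walk_Cons by simp
    finally show ?case .
  qed (use c in simp)
qed (use c le_carrier in auto)

text \<open>The half \<open>M\<^sup>* \<le> 1 + M M\<^sup>*\<close> of the unfolding, inside a
  context: a walk is empty, or it has a first edge and a rest that is again below the star.\<close>

lemma mstar_unfold_le:
  assumes M: "is_mat n M" and ij: "i < n" "j < n" and [simp]: "a \<in> \<C>" "c \<in> \<C>" "u \<in> \<C>"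
    and nil: "i = j \<Longrightarrow> a \<odot> c \<sqsubseteq> u"
    and step: "\<And>k. k < n \<Longrightarrow> a \<odot> (M i k \<odot> (mstar T n M k j \<odot> c)) \<sqsubseteq> u"
  shows "a \<odot> (mstar T n M i j \<odot> c) \<sqsubseteq> u"
proof -
  have "a \<odot> mstar T n M i j \<odot> c \<sqsubseteq> u"
  proof (rule belowD[OF below_mstar[OF M ij]])
    fix w assume "w \<in> walks n M i j"
    then have "walk n M j w i" by (simp add: walks_def)
    then show "a \<odot> w \<odot> c \<sqsubseteq> u"
    proof cases
      case walk_Nil with nil show ?thesis by simp
    next
      case (walk_Cons k w')
      have w' [simp]: "w' \<in> \<C>" using walk_Cons walks_closed[OF M] by (auto simp: walks_def)
      have "w' \<odot> \<one> \<sqsubseteq> mstar T n M k j"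
        using walk_Cons(4)
      proof induction
        case walk_Nil then show ?case using mstar_ge_one[OF M] by simp
      next
        case (walk_Cons i k w)
        then have [simp]: "w \<in> \<C>" using walks_closed[OF M] by (auto simp: walks_def)
        have "M i k \<odot> w \<odot> \<one> \<sqsubseteq> M i k \<odot> mstar T n M k j"
          using walk_Cons M by (simp add: mult_mono2)
        also have "\<dots> \<sqsubseteq> mstar T n M i j" using walk_Cons ij M by (intro mstar_step)
        finally show ?case .
      qed
      then have "a \<odot> (M i k \<odot> (w' \<odot> c)) \<sqsubseteq> a \<odot> (M i k \<odot> (mstar T n M k j \<odot> c))"
        using walk_Cons M ij by (intro mult_mono2 mult_mono1) auto
      also have "\<dots> \<sqsubseteq> u" using step walk_Cons by simp
      finally show ?thesis using walk_Cons M ij by (simp add: mult_assoc)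
    qed
  qed simp_all
  then show ?thesis using M ij by (simp add: mult_assoc)
qed

end

context rdioid begin

subsection \<open>Recognition by finite automata\<close>

text \<open>These are the vectors with \<open>A y \<le> y\<close>; as \<open>\<sqsubseteq>\<close>
  includes membership, their entries below \<open>n\<close> lie in the carrier.\<close>

definition closed_vec :: "nat \<Rightarrow> 't mat \<Rightarrow> (nat \<Rightarrow> 't) \<Rightarrow> bool" where
  "closed_vec n A y \<longleftrightarrow> (\<forall>i<n. \<forall>k<n. A i k \<odot> y k \<sqsubseteq> y i)"

text \<open>The vector \<open>x\<close> plays the role of \<open>A\<^sup>* J\<close>, and \<open>\<phi>\<close> that of \<open>I A\<^sup>* J\<close>. The parameters \<open>c\<close>
  make the two least elements compatible with multiplication on the right.\<close>
definition recognizes ::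
  "nat \<Rightarrow> 't mat \<Rightarrow> nat set \<Rightarrow> nat set \<Rightarrow> (nat \<Rightarrow> 't) \<Rightarrow> 't \<Rightarrow> bool" where
  "recognizes n A I J x \<phi> \<longleftrightarrow> \<phi> \<in> \<C> \<and> (\<forall>i<n. x i \<in> \<C>) \<and> closed_vec n A x \<and>
     (\<forall>j<n. j \<in> J \<longrightarrow> \<one> \<sqsubseteq> x j) \<and> (\<forall>i<n. i \<in> I \<longrightarrow> x i \<sqsubseteq> \<phi>) \<and>
     (\<forall>c y. c \<in> \<C> \<longrightarrow> closed_vec n A y \<longrightarrow> (\<forall>j<n. j \<in> J \<longrightarrow> c \<sqsubseteq> y j) \<longrightarrow> (\<forall>i<n. x i \<odot> c \<sqsubseteq> y i)) \<and>
     (\<forall>c z. c \<in> \<C> \<longrightarrow> z \<in> \<C> \<longrightarrow> (\<forall>i<n. i \<in> I \<longrightarrow> x i \<odot> c \<sqsubseteq> z) \<longrightarrow> \<phi> \<odot> c \<sqsubseteq> z)"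

definition recognizable :: "'t set \<Rightarrow> 't set" where
  "recognizable E = {\<phi>. \<exists>n A I J x. mat_over n E A \<and> recognizes n A I J x \<phi>}"

lemma closed_vecD: "closed_vec n A y \<Longrightarrow> i < n \<Longrightarrow> k < n \<Longrightarrow> A i k \<odot> y k \<sqsubseteq> y i"
  by (simp add: closed_vec_def)

lemma closed_vec_carrier: "closed_vec n A y \<Longrightarrow> i < n \<Longrightarrow> y i \<in> \<C>"
  using le_carrier(2)[OF closed_vecD[of n A y i i]] by simp

lemma recognizesD:
  assumes "recognizes n A I J x \<phi>"
  shows "\<phi> \<in> \<C>" "i < n \<Longrightarrow> x i \<in> \<C>" "closed_vec n A x"
    "j < n \<Longrightarrow> j \<in> J \<Longrightarrow> \<one> \<sqsubseteq> x j" "i < n \<Longrightarrow> i \<in> I \<Longrightarrow> x i \<sqsubseteq> \<phi>"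
    "c \<in> \<C> \<Longrightarrow> closed_vec n A y \<Longrightarrow> (\<And>j. j < n \<Longrightarrow> j \<in> J \<Longrightarrow> c \<sqsubseteq> y j) \<Longrightarrow> i < n \<Longrightarrow> x i \<odot> c \<sqsubseteq> y i"
    "c \<in> \<C> \<Longrightarrow> z \<in> \<C> \<Longrightarrow> (\<And>i. i < n \<Longrightarrow> i \<in> I \<Longrightarrow> x i \<odot> c \<sqsubseteq> z) \<Longrightarrow> \<phi> \<odot> c \<sqsubseteq> z"
  using assms by (simp_all add: recognizes_def)

lemma recognizable_edge:
  assumes E: "\<zero> \<in> E" "\<phi> \<in> E" and \<phi> [simp]: "\<phi> \<in> \<C>"
  shows "\<phi> \<in> recognizable E"
proof -
  define A where "A = (\<lambda>i j. if i = (0::nat) \<and> j = (1::nat) then \<phi> else \<zero>)"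
  define x where "x = (\<lambda>i::nat. if i = 0 then \<phi> else \<one>)"
  have two: "i < 2 \<longleftrightarrow> i = 0 \<or> i = 1" for i :: nat by auto
  have "recognizes 2 A {0} {1} x \<phi>"
    unfolding recognizes_def
  proof (intro conjI allI impI)
    fix c y i assume [simp]: "c \<in> \<C>" and y: "closed_vec 2 A y" and c: "\<forall>j<2. j \<in> {1} \<longrightarrow> c \<sqsubseteq> y j"
      and i: "i < (2::nat)"
    have "\<phi> \<odot> c \<sqsubseteq> \<phi> \<odot> y 1" using c by (simp add: mult_mono2)
    also have "\<phi> \<odot> y 1 \<sqsubseteq> y 0" using closed_vecD[OF y, of 0 1] by (simp add: A_def)
    finally show "x i \<odot> c \<sqsubseteq> y i" using i c by (auto simp: two x_def)
  qed (auto simp: closed_vec_def A_def x_def two)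
  moreover have "mat_over 2 E A" using E by (simp add: mat_over_def A_def)
  ultimately show ?thesis unfolding recognizable_def by blast
qed

text \<open>The block matrix with rows \<open>A, L\<close> and \<open>0, B\<close>: the edges in
  \<open>L\<close> lead from the first automaton to the second and none lead back.\<close>

definition join :: "nat \<Rightarrow> 't mat \<Rightarrow> 't mat \<Rightarrow> 't mat \<Rightarrow> 't mat" where
  "join n A B L = (\<lambda>i j. if i < n then (if j < n then A i j else L i (j - n))
     else (if j < n then \<zero> else B (i - n) (j - n)))"

lemma mat_over_join:
  assumes "mat_over n E A" "mat_over m E B" "\<zero> \<in> E" "\<And>i j. L i j \<in> E"
  shows "mat_over (n + m) E (join n A B L)"
  using assms by (auto simp: mat_over_def join_def)

lemma closed_vec_join:
  assumes "is_mat n A" "is_mat m B" "\<And>i j. L i j \<in> \<C>"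
  shows "closed_vec (n + m) (join n A B L) y \<longleftrightarrow>
    closed_vec n A y \<and> closed_vec m B (\<lambda>i. y (n + i)) \<and> (\<forall>i<n. \<forall>j<m. L i j \<odot> y (n + j) \<sqsubseteq> y i)"
    (is "?l \<longleftrightarrow> ?r")
proof
  assume l: ?l
  have "A i k \<odot> y k \<sqsubseteq> y i" if "i < n" "k < n" for i k
    using closed_vecD[OF l, of i k] that by (simp add: join_def)
  moreover have "B i k \<odot> y (n + k) \<sqsubseteq> y (n + i)" if "i < m" "k < m" for i k
    using closed_vecD[OF l, of "n + i" "n + k"] that by (simp add: join_def)
  moreover have "L i k \<odot> y (n + k) \<sqsubseteq> y i" if "i < n" "k < m" for i k
    using closed_vecD[OF l, of i "n + k"] that by (simp add: join_def)
  ultimately show ?r by (simp add: closed_vec_def)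
next
  assume r: ?r
  have car: "y i \<in> \<C>" if "i < n + m" for i
    using r that closed_vec_carrier[of n A y i] closed_vec_carrier[of m B "\<lambda>i. y (n + i)" "i - n"]
    by (cases "i < n") auto
  have L: "L i (k - n) \<odot> y k \<sqsubseteq> y i" if "i < n" "\<not> k < n" "k < n + m" for i k
  proof -
    have "k - n < m" using that by simp
    then have "L i (k - n) \<odot> y (n + (k - n)) \<sqsubseteq> y i" using r that by blast
    then show ?thesis using that by simp
  qed
  have B: "B (i - n) (k - n) \<odot> y k \<sqsubseteq> y i" if "\<not> i < n" "\<not> k < n" "i < n + m" "k < n + m" for i k
    using r that closed_vecD[of m B "\<lambda>i. y (n + i)" "i - n" "k - n"] by simp
  show ?l
    unfolding closed_vec_def
  proof (intro allI impI)
    fix i k assume "i < n + m" "k < n + m"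
    then show "join n A B L i k \<odot> y k \<sqsubseteq> y i"
      using L[of i k] B[of i k] car[of i] car[of k] r closed_vecD[of n A y i k]
      by (simp add: join_def)
  qed
qed

context
  fixes E :: "'t set"
  assumes E0: "\<zero> \<in> E" and E1: "\<one> \<in> E" and E: "E \<subseteq> \<C>"
begin

lemma recognizable_add:
  assumes "\<phi> \<in> recognizable E" "\<psi> \<in> recognizable E"
  shows "\<phi> \<oplus> \<psi> \<in> recognizable E"
proof -
  obtain n A I J x where A: "mat_over n E A" and \<phi>: "recognizes n A I J x \<phi>"
    using assms(1) by (auto simp: recognizable_def)
  obtain m B I' J' x' where B: "mat_over m E B" and \<psi>: "recognizes m B I' J' x' \<psi>"
    using assms(2) by (auto simp: recognizable_def)
  note [simp] = recognizesD(1)[OF \<phi>] recognizesD(1)[OF \<psi>] recognizesD(2)[OF \<phi>] recognizesD(2)[OF \<psi>]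
  let ?I = "I \<inter> {..<n} \<union> (+) n ` I'" and ?J = "J \<inter> {..<n} \<union> (+) n ` J'"
  let ?A = "join n A B (\<lambda>i j. \<zero>)" and ?x = "\<lambda>i. if i < n then x i else x' (i - n)"
  have is_mat: "is_mat n A" "is_mat m B" using A B E by (auto simp: mat_over_def)
  note cl = closed_vec_join[OF is_mat, of "\<lambda>i j. \<zero>"]
  have "recognizes (n + m) ?A ?I ?J ?x (\<phi> \<oplus> \<psi>)"
    unfolding recognizes_def
  proof (intro conjI allI impI)
    show "closed_vec (n + m) ?A ?x"
      using recognizesD(3)[OF \<phi>] recognizesD(3)[OF \<psi>] by (simp add: cl) (simp add: closed_vec_def)
  next
    fix j assume "j < n + m" "j \<in> ?J"
    then show "\<one> \<sqsubseteq> ?x j" using recognizesD(4)[OF \<phi>] recognizesD(4)[OF \<psi>] by auto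
  next
    fix i assume "i < n + m" "i \<in> ?I"
    then show "?x i \<sqsubseteq> \<phi> \<oplus> \<psi>"
      using le_trans[OF recognizesD(5)[OF \<phi>] add_upper1] le_trans[OF recognizesD(5)[OF \<psi>] add_upper2]
      by auto
  next
    fix c y i assume c: "c \<in> \<C>" and y: "closed_vec (n + m) ?A y"
      and J: "\<forall>j<n + m. j \<in> ?J \<longrightarrow> c \<sqsubseteq> y j" and i: "i < n + m"
    have "x i \<odot> c \<sqsubseteq> y i" if "i < n" for i
      using recognizesD(6)[OF \<phi> c, of y i] y J that by (simp add: cl)
    moreover have "x' i \<odot> c \<sqsubseteq> y (n + i)" if "i < m" for i
      using recognizesD(6)[OF \<psi> c, of "\<lambda>i. y (n + i)" i] y J that by (simp add: cl)
    from this[of "i - n"] i have "\<not> i < n \<Longrightarrow> x' (i - n) \<odot> c \<sqsubseteq> y i" by simp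
    ultimately show "?x i \<odot> c \<sqsubseteq> y i" by simp
  next
    fix c z assume c [simp]: "c \<in> \<C>" "z \<in> \<C>" and I: "\<forall>i<n + m. i \<in> ?I \<longrightarrow> ?x i \<odot> c \<sqsubseteq> z"
    have "\<phi> \<odot> c \<sqsubseteq> z"
    proof (rule recognizesD(7)[OF \<phi> c])
      fix i assume "i < n" "i \<in> I" then show "x i \<odot> c \<sqsubseteq> z" using I[rule_format, of i] by simp
    qed
    moreover have "\<psi> \<odot> c \<sqsubseteq> z"
    proof (rule recognizesD(7)[OF \<psi> c])
      fix i assume "i < m" "i \<in> I'" then show "x' i \<odot> c \<sqsubseteq> z" using I[rule_format, of "n + i"] by simp
    qed
    ultimately show "(\<phi> \<oplus> \<psi>) \<odot> c \<sqsubseteq> z" by (simp add: distrib_right add_least)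
  qed auto
  moreover have "mat_over (n + m) E ?A" using A B E0 by (intro mat_over_join)
  ultimately show ?thesis unfolding recognizable_def by blast
qed

text \<open>Serial composition: unit edges join the final states of the first automaton to the
  initial states of the second. From a state of the first block there remains its own part and then
  all of \<open>\<psi>\<close>, whence the entry \<open>x i \<odot> \<psi>\<close>.\<close>

lemma recognizable_mult:
  assumes "\<phi> \<in> recognizable E" "\<psi> \<in> recognizable E"
  shows "\<phi> \<odot> \<psi> \<in> recognizable E"
proof -
  obtain n A I J x where A: "mat_over n E A" and \<phi>: "recognizes n A I J x \<phi>"
    using assms(1) by (auto simp: recognizable_def)
  obtain m B I' J' x' where B: "mat_over m E B" and \<psi>: "recognizes m B I' J' x' \<psi>"
    using assms(2) by (auto simp: recognizable_def)
  note [simp] = recognizesD(1)[OF \<phi>] recognizesD(1)[OF \<psi>] recognizesD(2)[OF \<phi>] recognizesD(2)[OF \<psi>]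
  let ?I = "I \<inter> {..<n}" and ?J = "(+) n ` J'"
  let ?L = "\<lambda>i j. if i \<in> J \<and> j \<in> I' then \<one> else \<zero>"
  let ?A = "join n A B ?L" and ?x = "\<lambda>i. if i < n then x i \<odot> \<psi> else x' (i - n)"
  have is_mat: "is_mat n A" "is_mat m B" using A B E by (auto simp: mat_over_def)
  note [simp] = is_matD[OF is_mat(1)]
  have cl: "closed_vec (n + m) ?A y \<longleftrightarrow>
    closed_vec n A y \<and> closed_vec m B (\<lambda>i. y (n + i)) \<and> (\<forall>i<n. \<forall>j<m. ?L i j \<odot> y (n + j) \<sqsubseteq> y i)" for y
    by (rule closed_vec_join[OF is_mat]) simp
  have "recognizes (n + m) ?A ?I ?J ?x (\<phi> \<odot> \<psi>)"
    unfolding recognizes_def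
  proof (intro conjI allI impI)
    have "A i k \<odot> (x k \<odot> \<psi>) \<sqsubseteq> x i \<odot> \<psi>" if "i < n" "k < n" for i k
      using mult_mono1[OF closed_vecD[OF recognizesD(3)[OF \<phi>] that]] that by (simp add: mult_assoc)
    moreover have "x' j \<sqsubseteq> x i \<odot> \<psi>" if "i < n" "j < m" "i \<in> J" "j \<in> I'" for i j
      using mult_mono[OF recognizesD(4)[OF \<phi> that(1,3)] recognizesD(5)[OF \<psi> that(2,4)]] that by simp
    ultimately show "closed_vec (n + m) ?A ?x"
      using recognizesD(3)[OF \<psi>] unfolding cl by (simp add: closed_vec_def)
  next
    fix j assume "j < n + m" "j \<in> ?J"
    then show "\<one> \<sqsubseteq> ?x j" using recognizesD(4)[OF \<psi>] by auto
  next
    fix i assume "i < n + m" "i \<in> ?I"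
    then show "?x i \<sqsubseteq> \<phi> \<odot> \<psi>"
      using recognizesD(5)[OF \<phi>] by (auto intro: mult_mono1)
  next
    fix c y i assume c [simp]: "c \<in> \<C>" and y: "closed_vec (n + m) ?A y"
      and J: "\<forall>j<n + m. j \<in> ?J \<longrightarrow> c \<sqsubseteq> y j" and i: "i < n + m"
    have y1: "closed_vec n A y" and y2: "closed_vec m B (\<lambda>i. y (n + i))"
      and yL: "\<And>i j. i < n \<Longrightarrow> j < m \<Longrightarrow> i \<in> J \<Longrightarrow> j \<in> I' \<Longrightarrow> \<one> \<odot> y (n + j) \<sqsubseteq> y i"
      using y unfolding cl by force+
    have 2: "x' i \<odot> c \<sqsubseteq> y (n + i)" if "i < m" for i
      using recognizesD(6)[OF \<psi> c y2, of i] J that by simp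
    \<comment> \<open>The final states of the first automaton take up
      \<open>\<psi> \<odot> c\<close>, which then serves as the parameter in the leastness of
      \<open>x\<close>.\<close>
    have "\<psi> \<odot> c \<sqsubseteq> y j" if j: "j < n" "j \<in> J" for j
    proof (rule recognizesD(7)[OF \<psi> c])
      show "y j \<in> \<C>" using closed_vec_carrier[OF y1] j by simp
      fix i assume i: "i < m" "i \<in> I'"
      have "y (n + i) \<in> \<C>" using closed_vec_carrier[OF y2] i by simp
      with 2[OF i(1)] yL[OF j(1) i(1) j(2) i(2)] show "x' i \<odot> c \<sqsubseteq> y j" by (simp add: le_trans)
    qed
    from recognizesD(6)[OF \<phi> _ y1 this] have "x i \<odot> (\<psi> \<odot> c) \<sqsubseteq> y i" if "i < n" for i
      using that by simp
    moreover from 2[of "i - n"] i have "\<not> i < n \<Longrightarrow> x' (i - n) \<odot> c \<sqsubseteq> y i" by simp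
    ultimately show "?x i \<odot> c \<sqsubseteq> y i" by (simp add: mult_assoc)
  next
    fix c z assume c [simp]: "c \<in> \<C>" "z \<in> \<C>" and I: "\<forall>i<n + m. i \<in> ?I \<longrightarrow> ?x i \<odot> c \<sqsubseteq> z"
    have "\<phi> \<odot> (\<psi> \<odot> c) \<sqsubseteq> z"
    proof (rule recognizesD(7)[OF \<phi>])
      fix i assume "i < n" "i \<in> I"
      then show "x i \<odot> (\<psi> \<odot> c) \<sqsubseteq> z" using I[rule_format, of i] by (simp add: mult_assoc)
    qed simp_all
    then show "(\<phi> \<odot> \<psi>) \<odot> c \<sqsubseteq> z" by (simp add: mult_assoc)
  qed auto
  moreover have "mat_over (n + m) E ?A" using A B E0 E1 by (intro mat_over_join) auto
  ultimately show ?thesis unfolding recognizable_def by blast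
qed

text \<open>A hub \<open>n\<close>, initial and final at once, gets unit edges to the initial states
  and from the final states. A walk from the hub to itself is a sequence of accepted walks, hence
  the entry \<open>rstar T \<phi>\<close> there.\<close>

lemma recognizable_star:
  assumes "\<phi> \<in> recognizable E"
  shows "rstar T \<phi> \<in> recognizable E"
proof -
  obtain n A I J x where A: "mat_over n E A" and \<phi>: "recognizes n A I J x \<phi>"
    using assms(1) by (auto simp: recognizable_def)
  note [simp] = recognizesD(1)[OF \<phi>] recognizesD(2)[OF \<phi>]
  let ?s = "rstar T \<phi>"
  define B where "B = (\<lambda>i j. if i < n then (if j < n then A i j else if i \<in> J then \<one> else \<zero>)
    else (if j \<in> I \<and> j < n then \<one> else \<zero>))"
  define x' where "x' = (\<lambda>i. if i < n then x i \<odot> ?s else ?s)"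
  have is_mat: "is_mat n A" using A E by (auto simp: mat_over_def)
  note [simp] = is_matD[OF is_mat]
  have "recognizes (Suc n) B {n} {n} x' ?s"
    unfolding recognizes_def
  proof (intro conjI allI impI)
    show "closed_vec (Suc n) B x'"
      unfolding closed_vec_def
    proof (intro allI impI)
      fix i k assume ik: "i < Suc n" "k < Suc n"
      have "A i k \<odot> (x k \<odot> ?s) \<sqsubseteq> x i \<odot> ?s" if "i < n" "k < n"
        using mult_mono1[OF closed_vecD[OF recognizesD(3)[OF \<phi>] that]] that by (simp add: mult_assoc)
      moreover have "?s \<sqsubseteq> x i \<odot> ?s" if "i < n" "i \<in> J"
        using mult_mono1[OF recognizesD(4)[OF \<phi> that], of ?s] by simp
      moreover have "x k \<odot> ?s \<sqsubseteq> ?s" if "k < n" "k \<in> I"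
        using le_trans[OF mult_mono1[OF recognizesD(5)[OF \<phi> that], of ?s] rstar_unfold] by simp
      ultimately show "B i k \<odot> x' k \<sqsubseteq> x' i" using ik by (simp add: B_def x'_def)
    qed
  next
    fix c y i assume c [simp]: "c \<in> \<C>" and y: "closed_vec (Suc n) B y"
      and J: "\<forall>j<Suc n. j \<in> {n} \<longrightarrow> c \<sqsubseteq> y j" and i: "i < Suc n"
    have [simp]: "i < Suc n \<Longrightarrow> y i \<in> \<C>" for i using closed_vec_carrier[OF y] .
    have y1: "closed_vec n A y"
      unfolding closed_vec_def
    proof (intro allI impI)
      fix i k assume "i < n" "k < n"
      then show "A i k \<odot> y k \<sqsubseteq> y i" using closed_vecD[OF y, of i k] by (simp add: B_def)
    qed
    have yJ: "y n \<sqsubseteq> y j" if "j < n" "j \<in> J" for j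
      using closed_vecD[OF y, of j n] that by (simp add: B_def)
    have yI: "y j \<sqsubseteq> y n" if "j < n" "j \<in> I" for j
      using closed_vecD[OF y, of n j] that by (simp add: B_def)
    have xy: "x i \<odot> z \<sqsubseteq> y i" if "i < n" "z \<sqsubseteq> y n" for i z
      by (rule recognizesD(6)[OF \<phi> le_carrier(1)[OF that(2)] y1 le_trans[OF that(2) yJ] that(1)])
    \<comment> \<open>One tour through the old automaton starts and ends at the hub, so
      \<open>y n\<close> absorbs \<open>\<phi>\<close> and star induction applies.\<close>
    have "\<phi> \<odot> y n \<sqsubseteq> y n"
      by (rule recognizesD(7)[OF \<phi> _ _ le_trans[OF xy yI]]) auto
    then have "?s \<odot> c \<sqsubseteq> y n" using J by (intro rstar_induct) auto
    with xy[of i "?s \<odot> c"] i show "x' i \<odot> c \<sqsubseteq> y i"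
      by (cases "i = n") (auto simp: x'_def mult_assoc)
  qed (auto simp: x'_def)
  moreover have "mat_over (Suc n) E B" using A E0 E1 by (auto simp: mat_over_def B_def)
  ultimately show ?thesis unfolding recognizable_def by blast
qed

end

end

subsection \<open>Pushdown runs\<close>

text \<open>The truth values name the two pairs: \<open>True\<close> will be \<open>b\<close>,
  \<open>d\<close> and \<open>False\<close> will be \<open>p\<close>, \<open>q\<close>.\<close>

locale bracket_dioid = rdioid T for T :: "'t dioid_ops" +
  fixes opn cls :: "bool \<Rightarrow> 't"
  assumes bracket_closed [simp]: "opn \<sigma> \<in> \<C>" "cls \<sigma> \<in> \<C>"
    and bracket_mult: "opn \<sigma> \<odot> cls \<tau> = (if \<sigma> = \<tau> then \<one> else \<zero>)"
begin

text \<open>Labels are kept as data of type \<open>bool option\<close>, because an element of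
  \<open>T\<close> does not determine its bracket: in a trivial \<open>T\<close> all of them
  coincide.\<close>

definition label :: "(bool \<Rightarrow> 't) \<Rightarrow> bool option \<Rightarrow> 't" where
  "label f s = (case s of None \<Rightarrow> \<zero> | Some \<sigma> \<Rightarrow> f \<sigma>)"

lemma label_simps [simp]: "label f None = \<zero>" "label f (Some \<sigma>) = f \<sigma>"
  by (simp_all add: label_def)

lemma label_closed [simp]: "(\<And>\<sigma>. f \<sigma> \<in> \<C>) \<Longrightarrow> label f s \<in> \<C>"
  by (cases s) simp_all

lemma commute_mult:
  assumes [simp]: "x \<in> \<C>" "y \<in> \<C>" "z \<in> \<C>"
    and x: "z \<odot> x = x \<odot> z" and y: "z \<odot> y = y \<odot> z"
  shows "z \<odot> (x \<odot> y) = x \<odot> y \<odot> z"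
proof -
  have "z \<odot> (x \<odot> y) = z \<odot> x \<odot> y" by (simp add: mult_assoc)
  also have "\<dots> = x \<odot> (z \<odot> y)" by (simp add: x mult_assoc)
  also have "\<dots> = x \<odot> y \<odot> z" by (simp add: y mult_assoc)
  finally show ?thesis .
qed

text \<open>Stacks are listed from the top. The closing brackets that empty a stack begin with its
  top, whereas the opening brackets that built it (\<open>opns\<close>) end with it, so that
  matching pairs cancel from the inside.\<close>

fun clss :: "(bool \<Rightarrow> 't) \<Rightarrow> bool list \<Rightarrow> 't" where
  "clss f [] = \<one>"
| "clss f (\<sigma> # s) = f \<sigma> \<odot> clss f s"

fun opns :: "(bool \<Rightarrow> 't) \<Rightarrow> bool list \<Rightarrow> 't" where
  "opns f [] = \<one>"
| "opns f (\<sigma> # s) = opns f s \<odot> f \<sigma>"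

lemma clss_closed [simp]: "(\<And>\<sigma>. f \<sigma> \<in> \<C>) \<Longrightarrow> clss f s \<in> \<C>"
  by (induction s) simp_all

lemma opns_closed [simp]: "(\<And>\<sigma>. f \<sigma> \<in> \<C>) \<Longrightarrow> opns f s \<in> \<C>"
  by (induction s) simp_all

text \<open>The words \<open>b\<close>, \<open>bp\<close>, \<open>pp\<close> form a suffix code, so that three pairs of brackets can be
  simulated by two. One is used as an end marker, the other two replace the given brackets.\<close>
definition opn2 :: "bool \<Rightarrow> 't" where "opn2 \<sigma> = opn \<sigma> \<odot> opn False"
definition cls2 :: "bool \<Rightarrow> 't" where "cls2 \<sigma> = cls False \<odot> cls \<sigma>"

lemma bracket2_closed [simp]: "opn2 \<sigma> \<in> \<C>" "cls2 \<sigma> \<in> \<C>"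
  by (simp_all add: opn2_def cls2_def)

lemma bracket_cancel: "z \<in> \<C> \<Longrightarrow> opn \<sigma> \<odot> (cls \<tau> \<odot> z) = (if \<sigma> = \<tau> then z else \<zero>)"
  by (simp add: bracket_mult flip: mult_assoc)

lemma bracket2_mult: "opn2 \<sigma> \<odot> cls2 \<tau> = (if \<sigma> = \<tau> then \<one> else \<zero>)"
  by (simp add: opn2_def cls2_def mult_assoc bracket_cancel) (simp add: bracket_mult)

text \<open>The end marker \<open>d\<close> annihilates a stack that is not empty, by
  \<open>pd = 0\<close>. Dually, \<open>opn_True_cls2\<close> annihilates a pop from the empty
  stack, by \<open>bq = 0\<close>.\<close>

lemma opn2_cls_True: "opn2 \<sigma> \<odot> cls True = \<zero>"
  by (simp add: opn2_def mult_assoc bracket_mult)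

lemma opn_True_cls2: "opn True \<odot> cls2 \<sigma> = \<zero>"
  by (simp add: cls2_def bracket_cancel)

end

locale pushdown = bracket_dioid T opn cls for T :: "'t dioid_ops" and opn cls +
  fixes n :: nat and u v :: "nat \<Rightarrow> nat \<Rightarrow> bool option" and X :: "'t mat"
  assumes X_closed [simp]: "i < n \<Longrightarrow> j < n \<Longrightarrow> X i j \<in> \<C>"
    and X_opn: "i < n \<Longrightarrow> j < n \<Longrightarrow> X i j \<odot> opn \<sigma> = opn \<sigma> \<odot> X i j"
    and X_cls: "i < n \<Longrightarrow> j < n \<Longrightarrow> X i j \<odot> cls \<sigma> = cls \<sigma> \<odot> X i j"
begin

text \<open>\<open>run j s i w\<close>: started in state \<open>i\<close> with stack \<open>s\<close>, the automaton can reach state \<open>j\<close> with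
  the empty stack along a walk whose \<open>X\<close>-labels multiply to \<open>w\<close>.\<close>
inductive run :: "nat \<Rightarrow> bool list \<Rightarrow> nat \<Rightarrow> 't \<Rightarrow> bool" for j where
  run_Nil: "j < n \<Longrightarrow> run j [] j \<one>"
| run_X: "i < n \<Longrightarrow> k < n \<Longrightarrow> run j s k w \<Longrightarrow> run j s i (X i k \<odot> w)"
| run_push: "i < n \<Longrightarrow> k < n \<Longrightarrow> u i k = Some \<sigma> \<Longrightarrow> run j (\<sigma> # s) k w \<Longrightarrow> run j s i w"
| run_pop: "i < n \<Longrightarrow> k < n \<Longrightarrow> v i k = Some \<sigma> \<Longrightarrow> run j s k w \<Longrightarrow> run j (\<sigma> # s) i w"

lemma run_closed: "run j s i w \<Longrightarrow> w \<in> \<C>"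
  by (induction rule: run.induct) simp_all

text \<open>During the first run \<open>t\<close> lies untouched below \<open>s\<close>; when
  \<open>s\<close> is used up, the second run starts on \<open>t\<close>.\<close>

lemma run_append: "run j s i w \<Longrightarrow> run k t j w' \<Longrightarrow> run k (s @ t) i (w \<odot> w')"
proof (induction rule: run.induct)
  case (run_X i l s w)
  then show ?case using run.run_X[of i l k "s @ t" "w \<odot> w'"] run_closed by (simp add: mult_assoc)
next
  case (run_push i l \<sigma> s w)
  then show ?case using run.run_push[of i l \<sigma> k "s @ t"] by simp
next
  case (run_pop i l \<sigma> s w)
  then show ?case using run.run_pop[of i l \<sigma> k "s @ t"] by simp
qed (simp add: run_closed)

lemma run_commute:
  assumes z: "z \<in> \<C>" "\<And>i j. i < n \<Longrightarrow> j < n \<Longrightarrow> X i j \<odot> z = z \<odot> X i j"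
  shows "run j s i w \<Longrightarrow> w \<odot> z = z \<odot> w"
proof (induction rule: run.induct)
  case (run_X i k s w)
  then show ?case using z run_closed by (metis X_closed mult_assoc)
qed (use z in simp_all)

text \<open>Here \<open>W m\<close> is a bound for the runs started with a stack of height \<open>m\<close>.\<close>
lemma run_le:
  assumes f [simp]: "\<And>\<sigma>. f \<sigma> \<in> \<C>" "\<And>\<sigma>. g \<sigma> \<in> \<C>" and fg: "\<And>\<sigma>. f \<sigma> \<odot> g \<sigma> = \<one>"
    and Xg: "\<And>i j \<sigma>. i < n \<Longrightarrow> j < n \<Longrightarrow> X i j \<odot> g \<sigma> = g \<sigma> \<odot> X i j"
    and c: "c \<sqsubseteq> W 0 j"
    and WX: "\<And>m i k. i < n \<Longrightarrow> k < n \<Longrightarrow> X i k \<odot> W m k \<sqsubseteq> W m i"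
    and Wu: "\<And>m i k. i < n \<Longrightarrow> k < n \<Longrightarrow> label f (u i k) \<odot> W (Suc m) k \<sqsubseteq> W m i"
    and Wv: "\<And>m i k. i < n \<Longrightarrow> k < n \<Longrightarrow> label g (v i k) \<odot> W m k \<sqsubseteq> W (Suc m) i"
  shows "run j s i w \<Longrightarrow> clss g s \<odot> w \<odot> c \<sqsubseteq> W (length s) i"
proof (induction rule: run.induct)
  case run_Nil
  then show ?case using c le_carrier[OF c] by simp
next
  case (run_X i k s w)
  note [simp] = run_closed[OF run_X(3)] le_carrier(1)[OF c]
  \<comment> \<open>Entries of \<open>X\<close> pass the closing brackets of the stack, so the label
    of the edge comes to the front, where \<open>WX\<close> applies.\<close>
  have "X i k \<odot> clss g s = clss g s \<odot> X i k"
  proof (induction s)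
    case (Cons \<sigma> s)
    then show ?case using run_X by (auto intro: commute_mult Xg)
  qed (use run_X in simp)
  then have "clss g s \<odot> (X i k \<odot> w) \<odot> c = X i k \<odot> (clss g s \<odot> w \<odot> c)"
    using run_X by (simp flip: mult_assoc)
  also have "\<dots> \<sqsubseteq> X i k \<odot> W (length s) k"
    using run_X by (intro mult_mono2) auto
  also have "\<dots> \<sqsubseteq> W (length s) i" by (rule WX) fact+
  finally show ?case .
next
  case (run_push i k \<sigma> s w)
  note [simp] = run_closed[OF run_push(4)] le_carrier(1)[OF c]
  \<comment> \<open>A push inserts \<open>\<one> = f \<sigma> \<odot> g \<sigma>\<close>: the
    closing half joins the stack and the opening half is the label of the edge.\<close>
  have "clss g s \<odot> w \<odot> c = f \<sigma> \<odot> g \<sigma> \<odot> (clss g s \<odot> w \<odot> c)"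
    by (simp add: fg)
  also have "\<dots> = f \<sigma> \<odot> (clss g (\<sigma> # s) \<odot> w \<odot> c)"
    by (simp add: mult_assoc)
  also have "\<dots> \<sqsubseteq> f \<sigma> \<odot> W (Suc (length s)) k"
    using run_push by (intro mult_mono2) simp_all
  also have "\<dots> \<sqsubseteq> W (length s) i"
    using Wu[OF run_push(1,2)] run_push(3) by simp
  finally show ?case .
next
  case (run_pop i k \<sigma> s w)
  note [simp] = run_closed[OF run_pop(4)] le_carrier(1)[OF c]
  have "clss g (\<sigma> # s) \<odot> w \<odot> c = g \<sigma> \<odot> (clss g s \<odot> w \<odot> c)"
    by (simp add: mult_assoc)
  also have "\<dots> \<sqsubseteq> g \<sigma> \<odot> W (length s) k"
    using run_pop by (intro mult_mono2) simp_all
  also have "\<dots> \<sqsubseteq> W (Suc (length s)) i"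
    using Wv[OF run_pop(1,2)] run_pop(3) by simp
  finally show ?case by simp
qed

definition U :: "'t mat" where "U = (\<lambda>i j. label opn (u i j))"
definition V :: "'t mat" where "V = (\<lambda>i j. label cls (v i j))"
definition M2 :: "'t mat" where "M2 = (\<lambda>i j. label opn2 (u i j) \<oplus> X i j \<oplus> label cls2 (v i j))"
definition N :: "'t mat" where "N = (\<lambda>i j. opn True \<odot> mstar T n M2 i j \<odot> cls True)"

lemma is_mat [simp]: "is_mat n U" "is_mat n V" "is_mat n X" "is_mat n M2" "is_mat n N"
proof -
  show M2: "is_mat n M2" by (simp add: mat_over_def M2_def)
  then show "is_mat n N" by (simp add: mat_over_def N_def)
qed (simp_all add: mat_over_def U_def V_def)

lemma X_opn2: "i < n \<Longrightarrow> j < n \<Longrightarrow> X i j \<odot> opn2 \<sigma> = opn2 \<sigma> \<odot> X i j"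
  unfolding opn2_def by (rule commute_mult) (simp_all add: X_opn)

lemma X_cls2: "i < n \<Longrightarrow> j < n \<Longrightarrow> X i j \<odot> cls2 \<sigma> = cls2 \<sigma> \<odot> X i j"
  unfolding cls2_def by (rule commute_mult) (simp_all add: X_cls)

lemma X_opns2: "i < n \<Longrightarrow> j < n \<Longrightarrow> X i j \<odot> opns opn2 s = opns opn2 s \<odot> X i j"
proof (induction s)
  case (Cons \<sigma> s)
  then show ?case by (auto intro: commute_mult X_opn2)
qed simp

text \<open>A walk labelled by brackets either cancels to \<open>0\<close> or is a run.\<close>
lemma walk_M2_le:
  assumes "walk n M2 j w i" and c [simp]: "c \<in> \<C>" "z \<in> \<C>"
    and "a \<in> \<C>" "\<And>y. run j s i y \<Longrightarrow> a \<odot> y \<odot> c \<sqsubseteq> z"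
  shows "a \<odot> (opn True \<odot> opns opn2 s \<odot> w \<odot> cls True) \<odot> c \<sqsubseteq> z"
  using assms(1,4,5)
proof (induction arbitrary: a s)
  case walk_Nil
  note [simp] = walk_Nil(2)
  show ?case
  proof (cases s)
    case Nil
    then have "run j s j \<one>" using walk_Nil(1) by (simp add: run_Nil)
    from walk_Nil(3)[OF this] Nil show ?thesis by (simp add: bracket_mult)
  next
    \<comment> \<open>The walk is over and brackets are left on the stack; the top one meets the
      marker \<open>cls True\<close>.\<close>
    case (Cons \<sigma> s')
    have "opn True \<odot> opns opn2 s \<odot> \<one> \<odot> cls True = opn True \<odot> opns opn2 s' \<odot> (opn2 \<sigma> \<odot> cls True)"
      by (simp add: Cons mult_assoc)
    then show ?thesis by (simp add: opn2_cls_True)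
  qed
next
  case (walk_Cons i k w)
  have w [simp]: "w \<in> \<C>"
    using walk_Cons(3) walks_closed[OF is_mat(4)] by (auto simp: walks_def)
  note [simp] = walk_Cons(1,2) walk_Cons.prems(1)
  let ?b = "opn True \<odot> opns opn2 s"
  have "a \<odot> (?b \<odot> (label opn2 (u i k) \<odot> w) \<odot> cls True) \<odot> c \<sqsubseteq> z"
  proof (cases "u i k")
    case (Some \<sigma>)
    have "a \<odot> (opn True \<odot> opns opn2 (\<sigma> # s) \<odot> w \<odot> cls True) \<odot> c \<sqsubseteq> z"
      using Some by (intro walk_Cons) (auto intro!: walk_Cons.prems(2) run_push[of i k])
    then show ?thesis by (simp add: Some mult_assoc)
  qed simp
  moreover have "a \<odot> (?b \<odot> (X i k \<odot> w) \<odot> cls True) \<odot> c \<sqsubseteq> z"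
  proof -
    \<comment> \<open>The entry of \<open>X\<close> leaves the bracket word and is stored in the
      outer factor \<open>a\<close>, which is why \<open>a\<close> varies in the induction.\<close>
    have "(a \<odot> X i k) \<odot> (?b \<odot> w \<odot> cls True) \<odot> c \<sqsubseteq> z"
    proof (rule walk_Cons.IH)
      fix y assume y: "run j s k y"
      have "a \<odot> (X i k \<odot> y) \<odot> c \<sqsubseteq> z" by (rule walk_Cons.prems(2), rule run_X) (use y in simp_all)
      then show "a \<odot> X i k \<odot> y \<odot> c \<sqsubseteq> z" using run_closed[OF y] by (simp add: mult_assoc)
    qed simp
    moreover have "X i k \<odot> ?b = ?b \<odot> X i k"
      by (rule commute_mult) (simp_all add: X_opn X_opns2)
    then have "?b \<odot> (X i k \<odot> w) = X i k \<odot> (?b \<odot> w)"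
      by (simp flip: mult_assoc)
    ultimately show ?thesis by (simp add: mult_assoc)
  qed
  moreover have "a \<odot> (?b \<odot> (label cls2 (v i k) \<odot> w) \<odot> cls True) \<odot> c \<sqsubseteq> z"
  proof (cases "v i k")
    case (Some \<sigma>)
    show ?thesis
    proof (cases s)
      \<comment> \<open>A pop from the empty stack meets the marker \<open>opn True\<close>.\<close>
      case Nil
      have "?b \<odot> (label cls2 (v i k) \<odot> w) = (opn True \<odot> cls2 \<sigma>) \<odot> w"
        by (simp add: Nil Some mult_assoc)
      then show ?thesis by (simp add: opn_True_cls2)
    next
      case (Cons \<tau> s')
      have "?b \<odot> (label cls2 (v i k) \<odot> w) = opn True \<odot> opns opn2 s' \<odot> ((opn2 \<tau> \<odot> cls2 \<sigma>) \<odot> w)"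
        by (simp add: Cons Some mult_assoc)
      moreover have "a \<odot> (opn True \<odot> opns opn2 s' \<odot> w \<odot> cls True) \<odot> c \<sqsubseteq> z" if "\<tau> = \<sigma>"
        using Some Cons that
        by (intro walk_Cons) (auto intro!: walk_Cons.prems(2) run_pop[of i k])
      ultimately show ?thesis by (cases "\<tau> = \<sigma>") (simp_all add: bracket2_mult)
    qed
  qed simp
  ultimately show ?case
    by (simp add: M2_def distrib_left distrib_right add_least)
qed

lemma N_closed [simp]: "i < n \<Longrightarrow> j < n \<Longrightarrow> N i j \<in> \<C>"
  using is_mat(5) by (rule is_matD)

text \<open>For the nontrivial half, each walk of \<open>M2\<close> framed by the markers is 0 or
  the value of a run. Conversely, a run is a walk of \<open>M2\<close> up to cancellation of the
  coded brackets, and the markers around its value cancel as well.\<close>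

lemma csup_N:
  assumes ij: "i < n" "j < n"
  shows "csup {w. run j [] i w} (N i j)"
  unfolding csup_def below_def
proof (intro conjI ballI allI impI)
  fix a c z assume [simp]: "a \<in> \<C>" "c \<in> \<C>" "z \<in> \<C>" and h: "\<forall>w\<in>{w. run j [] i w}. a \<odot> w \<odot> c \<sqsubseteq> z"
  note [simp] = mstar_closed[OF is_mat(4) ij]
  have "(a \<odot> opn True) \<odot> mstar T n M2 i j \<odot> (cls True \<odot> c) \<sqsubseteq> z"
  proof (rule belowD[OF below_mstar[OF is_mat(4) ij]])
    fix w assume w: "w \<in> walks n M2 i j"
    then have [simp]: "w \<in> \<C>" using walks_closed[OF is_mat(4)] by auto
    have "a \<odot> (opn True \<odot> opns opn2 [] \<odot> w \<odot> cls True) \<odot> c \<sqsubseteq> z"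
      by (rule walk_M2_le) (use w h in \<open>auto simp: walks_def\<close>)
    then show "(a \<odot> opn True) \<odot> w \<odot> (cls True \<odot> c) \<sqsubseteq> z" by (simp add: mult_assoc)
  qed simp_all
  then show "a \<odot> N i j \<odot> c \<sqsubseteq> z" by (simp add: N_def mult_assoc)
next
  fix w assume "w \<in> {w. run j [] i w}"
  then have w: "run j [] i w" by simp
  note [simp] = run_closed[OF w] mstar_closed[OF is_mat(4) ij]
  \<comment> \<open>The height does not matter for this bound: the coded brackets are labels of
    \<open>M2\<close>, so one column of its star serves for all heights.\<close>
  let ?W = "\<lambda>m i. mstar T n M2 i j"
  have M2_ge: "label opn2 (u i k) \<sqsubseteq> M2 i k" "X i k \<sqsubseteq> M2 i k" "label cls2 (v i k) \<sqsubseteq> M2 i k"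
    if "i < n" "k < n" for i k
    using that by (auto simp: M2_def intro: le_trans[OF _ add_upper1])
  note step = le_trans[OF mult_mono1 mstar_step[OF is_mat(4)]]
  have "clss cls2 [] \<odot> w \<odot> \<one> \<sqsubseteq> ?W (length ([] :: bool list)) i"
    by (rule run_le[where f = opn2 and W = ?W, OF _ _ _ X_cls2 _ _ _ _ w])
      (use ij in \<open>auto simp: bracket2_mult intro: mstar_ge_one step M2_ge\<close>)
  then have "opn True \<odot> w \<odot> cls True \<sqsubseteq> N i j"
    unfolding N_def by (intro mult_mono) simp_all
  \<comment> \<open>\<open>w\<close> commutes with \<open>cls True\<close>, which thus moves next to
    \<open>opn True\<close>.\<close>
  moreover have "opn True \<odot> w \<odot> cls True = w"
    using run_commute[OF _ X_cls w] by (simp add: mult_assoc bracket_cancel)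
  ultimately show "w \<sqsubseteq> N i j" by simp
qed (use ij run_closed in auto)

lemma run_le_N: "i < n \<Longrightarrow> j < n \<Longrightarrow> run j [] i w \<Longrightarrow> w \<sqsubseteq> N i j"
  using csup_N[of i j] by (simp add: csup_def)

lemma below_N: "i < n \<Longrightarrow> j < n \<Longrightarrow> below (N i j) {w. run j [] i w}"
  using csup_N[of i j] by (simp add: csup_def)

lemma U_closed [simp]: "U i j \<in> \<C>" and V_closed [simp]: "V i j \<in> \<C>"
  by (simp_all add: U_def V_def)

lemma N_ge_one: "i < n \<Longrightarrow> \<one> \<sqsubseteq> N i i"
  by (intro run_le_N run_Nil)

lemma X_N_le:
  assumes "i < n" "k < n" "j < n"
  shows "X i k \<odot> N k j \<sqsubseteq> N i j"
  by (rule belowD_left[OF below_N]) (use assms in \<open>auto intro: run_le_N run_X\<close>)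

lemma N_N_le:
  assumes "i < n" "k < n" "j < n"
  shows "N i k \<odot> N k j \<sqsubseteq> N i j"
proof (rule belowD_left[OF below_N])
  fix w assume w: "w \<in> {w. run j [] k w}"
  show "N i k \<odot> w \<sqsubseteq> N i j"
  proof (rule belowD_right[OF below_N])
    fix w' assume "w' \<in> {w. run k [] i w}"
    with w run_append[of k "[]" i w' j "[]" w] assms show "w' \<odot> w \<sqsubseteq> N i j"
      by (auto intro: run_le_N)
  qed (use assms w run_closed in auto)
qed (use assms in auto)

text \<open>The value \<open>w\<close> moves out from between the two brackets. If they match, it is
  the value of the enclosed run, which is balanced again; otherwise the product is 0.\<close>

lemma UNV_le:
  assumes ij: "i < n" "k < n" "l < n" "j < n"
  shows "U i k \<odot> N k l \<odot> V l j \<sqsubseteq> N i j"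
proof (rule belowD[OF below_N])
  fix w assume "w \<in> {w. run l [] k w}"
  then have w: "run l [] k w" by simp
  note [simp] = run_closed[OF w]
  show "U i k \<odot> w \<odot> V l j \<sqsubseteq> N i j"
  proof (cases "u i k")
    case (Some \<sigma>)
    show ?thesis
    proof (cases "v l j")
      case (Some \<tau>)
      have "U i k \<odot> w \<odot> V l j = (if \<sigma> = \<tau> then w else \<zero>)"
        using run_commute[OF _ X_cls w] Some \<open>u i k = Some \<sigma>\<close>
        by (simp add: U_def V_def mult_assoc bracket_cancel)
      moreover have "run j [] i w" if "\<sigma> = \<tau>"
      proof (rule run_push)
        have "run j [\<sigma>] l \<one>" by (rule run_pop[OF _ _ _ run_Nil]) (use ij Some that in auto)
        with run_append[OF w this] show "run j [\<sigma>] k w" by simp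
      qed (use ij \<open>u i k = Some \<sigma>\<close> in auto)
      ultimately show ?thesis using ij by (auto intro: run_le_N)
    qed (use ij in \<open>simp add: V_def\<close>)
  qed (use ij in \<open>simp add: U_def\<close>)
qed (use ij in auto)

text \<open>Inside a balanced run brackets are pending, so its value is estimated through bounds for
  every height. A constant family \<open>W\<close> shows that closure under \<open>U\<close>,
  \<open>X\<close>, \<open>V\<close> implies closure under \<open>N\<close>; for the leastness of
  \<open>N\<close> the family depends on the height.\<close>

lemma N_vec_le:
  assumes ij: "i < n" "j < n" and c: "c \<sqsubseteq> W 0 j"
    and WX: "\<And>m i k. i < n \<Longrightarrow> k < n \<Longrightarrow> X i k \<odot> W m k \<sqsubseteq> W m i"
    and Wu: "\<And>m i k. i < n \<Longrightarrow> k < n \<Longrightarrow> U i k \<odot> W (Suc m) k \<sqsubseteq> W m i"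
    and Wv: "\<And>m i k. i < n \<Longrightarrow> k < n \<Longrightarrow> V i k \<odot> W m k \<sqsubseteq> W (Suc m) i"
  shows "N i j \<odot> c \<sqsubseteq> W 0 i"
proof (rule belowD_right[OF below_N[OF ij]])
  show "c \<in> \<C>" by (rule le_carrier(1)[OF c])
  show "W 0 i \<in> \<C>" by (rule le_carrier(2)[OF WX[OF ij(1) ij(1)]])
  fix w assume "w \<in> {w. run j [] i w}"
  then have w: "run j [] i w" by simp
  have "clss cls [] \<odot> w \<odot> c \<sqsubseteq> W (length ([] :: bool list)) i"
    by (rule run_le[where f = opn and g = cls and W = W, OF _ _ _ X_cls c WX _ _ w])
      (use Wu Wv in \<open>auto simp: bracket_mult U_def V_def\<close>)
  then show "w \<odot> c \<sqsubseteq> W 0 i" using run_closed[OF w] by simp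
qed

section \<open>The least solution\<close>

definition step :: "'t mat \<Rightarrow> 't mat" where
  "step Y = madd T (mmul T n (mmul T n U Y) V) X"

lemma is_mat_step [simp]: "is_mat n Y \<Longrightarrow> is_mat n (step Y)"
  by (simp add: step_def is_mat_madd is_mat_mmul)

text \<open>\<open>N\<close> absorbs \<open>U N V\<close> and \<open>X\<close> on the left because
  enclosed and concatenated balanced runs are balanced; star induction on the columns of
  \<open>N\<close> does the rest.\<close>

lemma step_N_le: "i < n \<Longrightarrow> j < n \<Longrightarrow> mstar T n (step N) i j \<sqsubseteq> N i j"
proof -
  assume ij: "i < n" "j < n"
  have "mstar T n (step N) i j \<odot> \<one> \<sqsubseteq> N i j"
  proof (rule mstar_induct[where x = "\<lambda>i. N i j", OF _ ij])
    fix i k assume ik: "i < n" "k < n"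
    note [simp] = ij ik
    have "mmul T n (mmul T n U N) V i k \<odot> N k j \<sqsubseteq> N i j"
    proof (rule mmul_le_right)
      fix l assume l [simp]: "l < n"
      show "mmul T n U N i l \<odot> (V l k \<odot> N k j) \<sqsubseteq> N i j"
      proof (rule mmul_le_right)
        fix p assume [simp]: "p < n"
        have "U i p \<odot> N p l \<odot> V l k \<odot> N k j \<sqsubseteq> N i k \<odot> N k j"
          by (intro mult_mono1 UNV_le) simp_all
        also have "\<dots> \<sqsubseteq> N i j" by (rule N_N_le) simp_all
        finally show "U i p \<odot> (N p l \<odot> (V l k \<odot> N k j)) \<sqsubseteq> N i j"
          by (simp add: mult_assoc)
      qed simp_all
    qed (simp_all add: is_mat_mmul)
    moreover have "X i k \<odot> N k j \<sqsubseteq> N i j" by (rule X_N_le) simp_all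
    ultimately show "step N i k \<odot> N k j \<sqsubseteq> N i j"
      by (simp add: step_def madd_def distrib_right add_least is_mat_mmul)
  qed (use ij N_ge_one in auto)
  then show ?thesis using ij by simp
qed

definition vact :: "'t mat \<Rightarrow> (nat \<Rightarrow> 't) \<Rightarrow> nat \<Rightarrow> 't" where
  "vact A x i = dsum T (\<lambda>k. A i k \<odot> x k) n"

lemma vact_closed: "is_mat n A \<Longrightarrow> (\<And>k. k < n \<Longrightarrow> x k \<in> \<C>) \<Longrightarrow> i < n \<Longrightarrow> vact A x i \<in> \<C>"
  unfolding vact_def by auto

lemma vact_upper:
  "is_mat n A \<Longrightarrow> (\<And>k. k < n \<Longrightarrow> x k \<in> \<C>) \<Longrightarrow> i < n \<Longrightarrow> k < n \<Longrightarrow> A i k \<odot> x k \<sqsubseteq> vact A x i"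
  unfolding vact_def by (rule dsum_upper[where f = "\<lambda>k. A i k \<odot> x k"]) auto

lemma vact_le:
  assumes "is_mat n A" "\<And>k. k < n \<Longrightarrow> x k \<in> \<C>" "i < n" "a \<in> \<C>" "z \<in> \<C>"
    and "\<And>k. k < n \<Longrightarrow> a \<odot> (A i k \<odot> x k) \<sqsubseteq> z"
  shows "a \<odot> vact A x i \<sqsubseteq> z"
  unfolding vact_def by (rule dsum_least_left) (use assms in auto)

text \<open>The runs with a stack of height \<open>m\<close> are bounded by \<open>Z(VZ)\<^sup>m\<close>, where \<open>Z = (UYV + X)\<^sup>*\<close>.\<close>
lemma N_least:
  assumes Y: "is_mat n Y" and YY: "\<And>i j. i < n \<Longrightarrow> j < n \<Longrightarrow> mstar T n (step Y) i j \<sqsubseteq> Y i j"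
    and ij: "i < n" "j < n"
  shows "N i j \<sqsubseteq> Y i j"
proof -
  define Z where "Z = mstar T n (step Y)"
  note step_Y = is_mat_step[OF Y]
  have Zm: "is_mat n Z" unfolding Z_def using step_Y by (rule is_mat_mstar)
  note [simp] = is_matD[OF Zm] is_matD[OF Y] is_matD[OF step_Y]
  \<comment> \<open>\<open>g m\<close> is column \<open>j\<close> of \<open>(VZ)\<^sup>m\<close>, so
    \<open>?W m\<close> is column \<open>j\<close> of \<open>Z (VZ)\<^sup>m\<close>.\<close>
  define g where "g = rec_nat (\<lambda>p. if p = j then \<one> else \<zero>) (\<lambda>_ g. vact V (vact Z g))"
  have g0: "g 0 = (\<lambda>p. if p = j then \<one> else \<zero>)" and gS: "g (Suc m) = vact V (vact Z (g m))" for m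
    by (simp_all add: g_def)
  have g [simp]: "p < n \<Longrightarrow> g m p \<in> \<C>" for m p
    by (induction m arbitrary: p) (simp_all add: g0 gS vact_closed Zm)
  let ?W = "\<lambda>m. vact Z (g m)"
  have W [simp]: "p < n \<Longrightarrow> ?W m p \<in> \<C>" for m p by (rule vact_closed[OF Zm]) simp_all
  have stepW: "step Y i k \<odot> ?W m k \<sqsubseteq> ?W m i" if [simp]: "i < n" "k < n" for m i k
  proof (rule vact_le[OF Zm])
    fix p assume [simp]: "p < n"
    have "step Y i k \<odot> Z k p \<odot> g m p \<sqsubseteq> Z i p \<odot> g m p"
      unfolding Z_def by (intro mult_mono1 mstar_step step_Y) simp_all
    also have "\<dots> \<sqsubseteq> ?W m i" by (rule vact_upper[OF Zm]) simp_all
    finally show "step Y i k \<odot> (Z k p \<odot> g m p) \<sqsubseteq> ?W m i" by (simp add: mult_assoc)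
  qed simp_all
  have UYm: "is_mat n (mmul T n U Y)" and UYVm: "is_mat n (mmul T n (mmul T n U Y) V)"
    using Y by (simp_all add: is_mat_mmul)
  have X_step: "X i k \<sqsubseteq> step Y i k" and UYV_step: "mmul T n (mmul T n U Y) V i k \<sqsubseteq> step Y i k"
    if "i < n" "k < n" for i k
    using that UYm UYVm by (simp_all add: step_def madd_def)
  have "N i j \<odot> \<one> \<sqsubseteq> ?W 0 i"
  proof (rule N_vec_le[OF ij])
    have "\<one> \<odot> g 0 j \<sqsubseteq> Z j j \<odot> g 0 j"
      unfolding Z_def using ij by (intro mult_mono1 mstar_ge_one step_Y) simp_all
    also have "\<dots> \<sqsubseteq> ?W 0 j" by (rule vact_upper[OF Zm]) (use ij in simp_all)
    finally show "\<one> \<sqsubseteq> ?W 0 j" by (simp add: g0)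
  next
    fix m i k assume [simp]: "i < n" "k < n"
    show "X i k \<odot> ?W m k \<sqsubseteq> ?W m i"
      by (rule le_trans[OF mult_mono1[OF X_step] stepW]) simp_all
    \<comment> \<open>Here the hypothesis on \<open>Y\<close> enters as \<open>Z \<le> Y\<close>:
      the push together with the following \<open>Z V\<close> is below \<open>U Y V\<close>, a
      summand of \<open>step Y\<close>, which \<open>Z\<close> absorbs.\<close>
    show "U i k \<odot> ?W (Suc m) k \<sqsubseteq> ?W m i"
    proof (rule vact_le[OF Zm])
      fix p assume [simp]: "p < n"
      have "(U i k \<odot> Z k p) \<odot> vact V (?W m) p \<sqsubseteq> ?W m i"
      proof (rule vact_le[OF is_mat(2)])
        fix l assume [simp]: "l < n"
        have "U i k \<odot> Z k p \<odot> V p l \<sqsubseteq> U i k \<odot> Y k p \<odot> V p l"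
          using YY by (intro mult_mono1 mult_mono2) (simp_all add: Z_def)
        also have "\<dots> \<sqsubseteq> mmul T n U Y i p \<odot> V p l"
          using Y by (intro mult_mono1 mmul_upper) simp_all
        also have "\<dots> \<sqsubseteq> mmul T n (mmul T n U Y) V i l"
          using UYm by (intro mmul_upper) simp_all
        also have "\<dots> \<sqsubseteq> step Y i l" by (rule UYV_step) simp_all
        finally have "U i k \<odot> Z k p \<odot> V p l \<odot> ?W m l \<sqsubseteq> step Y i l \<odot> ?W m l"
          by (rule mult_mono1) simp
        also have "\<dots> \<sqsubseteq> ?W m i" by (rule stepW) simp_all
        finally show "(U i k \<odot> Z k p) \<odot> (V p l \<odot> ?W m l) \<sqsubseteq> ?W m i" by (simp add: mult_assoc)
      qed simp_all
      then show "U i k \<odot> (Z k p \<odot> g (Suc m) p) \<sqsubseteq> ?W m i"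
        by (simp add: gS mult_assoc vact_closed)
    qed simp_all
    have "V i k \<odot> ?W m k \<sqsubseteq> g (Suc m) i"
      unfolding gS by (rule vact_upper[OF is_mat(2)]) simp_all
    also have "\<one> \<odot> g (Suc m) i \<sqsubseteq> Z i i \<odot> g (Suc m) i"
      unfolding Z_def by (intro mult_mono1 mstar_ge_one step_Y) simp_all
    then have "g (Suc m) i \<sqsubseteq> Z i i \<odot> g (Suc m) i" by simp
    also have "\<dots> \<sqsubseteq> ?W (Suc m) i" by (rule vact_upper[OF Zm]) simp_all
    finally show "V i k \<odot> ?W m k \<sqsubseteq> ?W (Suc m) i" .
  qed
  \<comment> \<open>\<open>g 0\<close> is the unit vector at \<open>j\<close>, so height 0 leaves
    just the entry of \<open>Z\<close>.\<close>
  also have "?W 0 i \<sqsubseteq> Z i j"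
    unfolding vact_def by (rule dsum_least) (use ij in \<open>auto simp: g0\<close>)
  also have "Z i j \<sqsubseteq> Y i j" unfolding Z_def by (rule YY[OF ij])
  finally show ?thesis using ij by simp
qed

lemma least_sol_N: "least_sol T n U V X N"
  unfolding least_sol_def mle_def step_def[symmetric]
  using N_least step_N_le by (auto simp: le_def)

text \<open>This plays the role of the star of \<open>U + X + V\<close>, by two properties: it
  absorbs \<open>U\<close>, \<open>X\<close> and \<open>V\<close> on the left
  (\<open>U_Q_le\<close>, \<open>X_Q_le\<close>, \<open>V_Q_le\<close>), and every vector closed
  under these three absorbs it (\<open>Q_vec_le\<close>).\<close>

definition Q :: "'t mat" where
  "Q = mmul T n (mmul T n (mstar T n (mmul T n N V)) N) (mstar T n (mmul T n U N))"

lemma is_mat_aux [simp]: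
  "is_mat n (mmul T n N V)" "is_mat n (mmul T n U N)"
  "is_mat n (mstar T n (mmul T n N V))" "is_mat n (mstar T n (mmul T n U N))"
  "is_mat n (mmul T n (mstar T n (mmul T n N V)) N)" "is_mat n Q"
  unfolding Q_def by (simp_all add: is_mat_mmul is_mat_mstar)

lemma Q_closed [simp]: "i < n \<Longrightarrow> j < n \<Longrightarrow> Q i j \<in> \<C>"
  using is_mat_aux(6) by (rule is_matD)

lemma Q_upper:
  assumes [simp]: "i < n" "k < n" "l < n" "j < n"
  shows "mstar T n (mmul T n N V) i k \<odot> (N k l \<odot> mstar T n (mmul T n U N) l j) \<sqsubseteq> Q i j"
proof -
  have "mstar T n (mmul T n N V) i k \<odot> N k l \<odot> mstar T n (mmul T n U N) l j
      \<sqsubseteq> mmul T n (mstar T n (mmul T n N V)) N i l \<odot> mstar T n (mmul T n U N) l j"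
    by (intro mult_mono1 mmul_upper) simp_all
  also have "\<dots> \<sqsubseteq> Q i j" unfolding Q_def by (rule mmul_upper) simp_all
  finally show ?thesis by (simp add: mult_assoc)
qed

lemma Q_upper':
  assumes [simp]: "i < n" "l < n" "j < n"
  shows "N i l \<odot> mstar T n (mmul T n U N) l j \<sqsubseteq> Q i j"
proof -
  let ?c = "N i l \<odot> mstar T n (mmul T n U N) l j"
  have "\<one> \<odot> ?c \<sqsubseteq> mstar T n (mmul T n N V) i i \<odot> ?c"
    by (intro mult_mono1 mstar_ge_one) simp_all
  also have "\<dots> \<sqsubseteq> Q i j" by (rule Q_upper) simp_all
  finally show ?thesis by simp
qed

lemma Q_le:
  assumes [simp]: "i < n" "j < n" "a \<in> \<C>" "z \<in> \<C>"
    and h: "\<And>k l. k < n \<Longrightarrow> l < n \<Longrightarrow>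
      a \<odot> (mstar T n (mmul T n N V) i k \<odot> (N k l \<odot> mstar T n (mmul T n U N) l j)) \<sqsubseteq> z"
  shows "a \<odot> Q i j \<sqsubseteq> z"
  unfolding Q_def
proof (rule mmul_le_left)
  fix l assume [simp]: "l < n"
  let ?R = "mstar T n (mmul T n U N) l j"
  have "a \<odot> mmul T n (mstar T n (mmul T n N V)) N i l \<odot> ?R \<sqsubseteq> z"
  proof (rule mmul_le)
    fix k assume [simp]: "k < n"
    show "a \<odot> (mstar T n (mmul T n N V) i k \<odot> N k l) \<odot> ?R \<sqsubseteq> z"
      using h[of k l] by (simp add: mult_assoc)
  qed simp_all
  then show "a \<odot> (mmul T n (mstar T n (mmul T n N V)) N i l \<odot> ?R) \<sqsubseteq> z"
    by (simp add: mult_assoc)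
qed simp_all

lemma Q_ge_one: "i < n \<Longrightarrow> \<one> \<sqsubseteq> Q i i"
proof -
  assume [simp]: "i < n"
  have "\<one> \<odot> \<one> \<sqsubseteq> N i i \<odot> mstar T n (mmul T n U N) i i"
    by (intro mult_mono N_ge_one mstar_ge_one) simp_all
  also have "\<dots> \<sqsubseteq> Q i i" by (rule Q_upper') simp_all
  finally show ?thesis by simp
qed

lemma NV_Q_le:
  assumes [simp]: "i < n" "k < n" "m < n" "l < n" "j < n"
  shows "mmul T n N V i k \<odot> (mstar T n (mmul T n N V) k m \<odot> (N m l \<odot> mstar T n (mmul T n U N) l j)) \<sqsubseteq> Q i j"
proof -
  let ?S = "mstar T n (mmul T n N V)" and ?c = "N m l \<odot> mstar T n (mmul T n U N) l j"
  have "mmul T n N V i k \<odot> ?S k m \<odot> ?c \<sqsubseteq> ?S i m \<odot> ?c"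
    by (intro mult_mono1 mstar_step) simp_all
  also have "\<dots> \<sqsubseteq> Q i j" by (rule Q_upper) simp_all
  finally show ?thesis by (simp add: mult_assoc)
qed

text \<open>If the factor \<open>(NV)\<^sup>*\<close> is empty, the new \<open>N\<close> merges with
  the middle one, otherwise with the first \<open>N\<close> of \<open>(NV)\<^sup>*\<close>; both
  times by \<open>N N \<le> N\<close>.\<close>

lemma N_Q_le:
  assumes [simp]: "i < n" "k < n" "j < n"
  shows "N i k \<odot> Q k j \<sqsubseteq> Q i j"
proof (rule Q_le)
  fix m l assume [simp]: "m < n" "l < n"
  let ?S = "mstar T n (mmul T n N V)" and ?R = "mstar T n (mmul T n U N) l j"
  show "N i k \<odot> (?S k m \<odot> (N m l \<odot> ?R)) \<sqsubseteq> Q i j"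
  proof (rule mstar_unfold_le)
    assume m: "k = m"
    have "N i k \<odot> N k l \<odot> ?R \<sqsubseteq> N i l \<odot> ?R" by (intro mult_mono1 N_N_le) simp_all
    also have "\<dots> \<sqsubseteq> Q i j" by (rule Q_upper') simp_all
    finally show "N i k \<odot> (N m l \<odot> ?R) \<sqsubseteq> Q i j" by (simp add: m mult_assoc)
  next
    fix p assume [simp]: "p < n"
    have "N i k \<odot> mmul T n N V k p \<sqsubseteq> mmul T n N V i p"
    proof (rule mmul_le_left)
      fix q assume [simp]: "q < n"
      have "N i k \<odot> N k q \<odot> V q p \<sqsubseteq> N i q \<odot> V q p" by (intro mult_mono1 N_N_le) simp_all
      also have "\<dots> \<sqsubseteq> mmul T n N V i p" by (rule mmul_upper) simp_all
      finally show "N i k \<odot> (N k q \<odot> V q p) \<sqsubseteq> mmul T n N V i p" by (simp add: mult_assoc)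
    qed simp_all
    then have "N i k \<odot> mmul T n N V k p \<odot> (?S p m \<odot> (N m l \<odot> ?R))
        \<sqsubseteq> mmul T n N V i p \<odot> (?S p m \<odot> (N m l \<odot> ?R))"
      by (intro mult_mono1) simp_all
    also have "\<dots> \<sqsubseteq> Q i j" by (rule NV_Q_le) simp_all
    finally show "N i k \<odot> (mmul T n N V k p \<odot> (?S p m \<odot> (N m l \<odot> ?R))) \<sqsubseteq> Q i j"
      by (simp add: mult_assoc)
  qed simp_all
qed simp_all

lemma X_Q_le:
  assumes [simp]: "i < n" "k < n" "j < n"
  shows "X i k \<odot> Q k j \<sqsubseteq> Q i j"
proof -
  have "X i k \<odot> \<one> \<sqsubseteq> X i k \<odot> N k k" by (intro mult_mono2 N_ge_one) simp_all
  also have "\<dots> \<sqsubseteq> N i k" by (rule X_N_le) simp_all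
  finally have "X i k \<odot> Q k j \<sqsubseteq> N i k \<odot> Q k j" by (intro mult_mono1) simp_all
  also have "\<dots> \<sqsubseteq> Q i j" by (rule N_Q_le) simp_all
  finally show ?thesis .
qed

lemma V_Q_le:
  assumes [simp]: "i < n" "k < n" "j < n"
  shows "V i k \<odot> Q k j \<sqsubseteq> Q i j"
proof (rule Q_le)
  fix m l assume [simp]: "m < n" "l < n"
  let ?c = "mstar T n (mmul T n N V) k m \<odot> (N m l \<odot> mstar T n (mmul T n U N) l j)"
  have "\<one> \<odot> V i k \<sqsubseteq> N i i \<odot> V i k" by (intro mult_mono1 N_ge_one) simp_all
  also have "\<dots> \<sqsubseteq> mmul T n N V i k" by (rule mmul_upper) simp_all
  finally have "V i k \<odot> ?c \<sqsubseteq> mmul T n N V i k \<odot> ?c" by (intro mult_mono1) simp_all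
  also have "\<dots> \<sqsubseteq> Q i j" by (rule NV_Q_le) simp_all
  finally show "V i k \<odot> ?c \<sqsubseteq> Q i j" .
qed simp_all

text \<open>A new opening bracket is unmatched or matched. If \<open>(NV)\<^sup>*\<close> is empty,
  it extends \<open>(UN)\<^sup>*\<close>, and a diagonal entry of \<open>N\<close> fills the middle;
  otherwise it meets the first closing bracket, \<open>U N V \<le> N\<close>, and
  \<open>N_Q_le\<close> applies.\<close>

lemma U_Q_le:
  assumes [simp]: "i < n" "k < n" "j < n"
  shows "U i k \<odot> Q k j \<sqsubseteq> Q i j"
proof (rule Q_le)
  fix m l assume [simp]: "m < n" "l < n"
  let ?S = "mstar T n (mmul T n N V)" and ?R = "mstar T n (mmul T n U N)"
  show "U i k \<odot> (?S k m \<odot> (N m l \<odot> ?R l j)) \<sqsubseteq> Q i j"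
  proof (rule mstar_unfold_le)
    assume m: "k = m"
    have "U i k \<odot> N k l \<odot> ?R l j \<sqsubseteq> mmul T n U N i l \<odot> ?R l j"
      by (intro mult_mono1 mmul_upper) simp_all
    also have "\<dots> \<sqsubseteq> \<one> \<odot> ?R i j" using mstar_step[of n "mmul T n U N" i l j] by simp
    also have "\<dots> \<sqsubseteq> N i i \<odot> ?R i j" by (intro mult_mono1 N_ge_one) simp_all
    also have "\<dots> \<sqsubseteq> Q i j" by (rule Q_upper') simp_all
    finally show "U i k \<odot> (N m l \<odot> ?R l j) \<sqsubseteq> Q i j" by (simp add: m mult_assoc)
  next
    fix p assume [simp]: "p < n"
    have "U i k \<odot> mmul T n N V k p \<sqsubseteq> N i p"
      using UNV_le[of i k _ p] by (intro mmul_le_left) (simp_all add: mult_assoc)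
    then have "U i k \<odot> mmul T n N V k p \<odot> (?S p m \<odot> (N m l \<odot> ?R l j))
        \<sqsubseteq> N i p \<odot> (?S p m \<odot> (N m l \<odot> ?R l j))"
      by (intro mult_mono1) simp_all
    also have "\<dots> \<sqsubseteq> N i p \<odot> Q p j" by (intro mult_mono2 Q_upper) simp_all
    also have "\<dots> \<sqsubseteq> Q i j" by (rule N_Q_le) simp_all
    finally show "U i k \<odot> (mmul T n N V k p \<odot> (?S p m \<odot> (N m l \<odot> ?R l j))) \<sqsubseteq> Q i j"
      by (simp add: mult_assoc)
  qed simp_all
qed simp_all

text \<open>Closure under \<open>U\<close>, \<open>X\<close>, \<open>V\<close> passes to
  \<open>N\<close> by a constant family of bounds, then to \<open>NV\<close> and \<open>UN\<close>,
  to their stars, and to the product.\<close>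

lemma Q_vec_le:
  assumes [simp]: "i < n" "j < n"
    and x [simp]: "\<And>i. i < n \<Longrightarrow> x i \<in> \<C>"
    and Xx: "\<And>i k. i < n \<Longrightarrow> k < n \<Longrightarrow> X i k \<odot> x k \<sqsubseteq> x i"
    and Ux: "\<And>i k. i < n \<Longrightarrow> k < n \<Longrightarrow> U i k \<odot> x k \<sqsubseteq> x i"
    and Vx: "\<And>i k. i < n \<Longrightarrow> k < n \<Longrightarrow> V i k \<odot> x k \<sqsubseteq> x i"
  shows "Q i j \<odot> x j \<sqsubseteq> x i"
proof -
  have N: "N i k \<odot> x k \<sqsubseteq> x i" if "i < n" "k < n" for i k
    by (rule N_vec_le[where W = "\<lambda>m. x"]) (use that Xx Ux Vx in auto)
  have "mmul T n N V i k \<odot> x k \<sqsubseteq> x i" if "i < n" "k < n" for i k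
    using that by (intro mmul_le_right) (auto intro: le_trans[OF mult_mono2[OF Vx] N])
  then have S: "mstar T n (mmul T n N V) i k \<odot> x k \<sqsubseteq> x i" if "i < n" "k < n" for i k
    using that by (intro mstar_induct[where x = x]) auto
  have "mmul T n U N i k \<odot> x k \<sqsubseteq> x i" if "i < n" "k < n" for i k
    using that by (intro mmul_le_right) (auto intro: le_trans[OF mult_mono2[OF N] Ux])
  then have R: "mstar T n (mmul T n U N) i k \<odot> x k \<sqsubseteq> x i" if "i < n" "k < n" for i k
    using that by (intro mstar_induct[where x = x]) auto
  show ?thesis
    unfolding Q_def
  proof (rule mmul_le_right)
    fix l assume [simp]: "l < n"
    have "mmul T n (mstar T n (mmul T n N V)) N i l \<odot> x l \<sqsubseteq> x i"
      by (intro mmul_le_right) (auto intro: le_trans[OF mult_mono2[OF N] S])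
    then show "mmul T n (mstar T n (mmul T n N V)) N i l \<odot> (mstar T n (mmul T n U N) l j \<odot> x j) \<sqsubseteq> x i"
      by (intro le_trans[OF mult_mono2[OF R]]) auto
  qed simp_all
qed

text \<open>Both \<open>x\<close> and \<open>y = Q F\<close> are least among the vectors that are
  closed under \<open>A\<close> and above \<open>\<one>\<close> on \<open>J\<close>, so they agree
  below \<open>n\<close>.\<close>

lemma recognizes_eq_vmv:
  assumes A: "\<And>i j. i < n \<Longrightarrow> j < n \<Longrightarrow> A i j = U i j \<oplus> X i j \<oplus> V i j"
    and \<phi>: "recognizes n A I J x \<phi>"
  shows "\<phi> = vmv T n (\<lambda>i. if i \<in> I then \<one> else \<zero>) Q (\<lambda>j. if j \<in> J then \<one> else \<zero>)"
proof (rule le_antisym)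
  let ?S = "\<lambda>i. if i \<in> I then \<one> else \<zero>" and ?F = "\<lambda>j. if j \<in> J then \<one> else \<zero>"
  note [simp] = recognizesD(1)[OF \<phi>] recognizesD(2)[OF \<phi>]
  define y where "y = vact Q ?F"
  have y [simp]: "i < n \<Longrightarrow> y i \<in> \<C>" for i unfolding y_def by (rule vact_closed) simp_all
  have v: "vmv T n ?S Q ?F = dsum T (\<lambda>i. ?S i \<odot> y i) n"
    by (simp add: vmv_def y_def vact_def)
  have Q_y: "Q i j \<sqsubseteq> y i" if "i < n" "j < n" "j \<in> J" for i j
    using vact_upper[of Q ?F i j] that by (simp add: y_def)
  have Ay: "a \<odot> y k \<sqsubseteq> y i" if "a \<in> \<C>" "i < n" "k < n" "\<And>j. j < n \<Longrightarrow> a \<odot> Q k j \<sqsubseteq> Q i j" for a i k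
    unfolding y_def[THEN fun_cong, of k]
  proof (rule vact_le)
    fix j assume j: "j < n"
    show "a \<odot> (Q k j \<odot> ?F j) \<sqsubseteq> y i"
      using le_trans[OF that(4)[OF j] Q_y[OF that(2) j]] that j by simp
  qed (use that in simp_all)
  have cl: "closed_vec n A y"
    unfolding closed_vec_def
  proof (intro allI impI)
    fix i k assume ik [simp]: "i < n" "k < n"
    have "U i k \<odot> y k \<sqsubseteq> y i" "X i k \<odot> y k \<sqsubseteq> y i" "V i k \<odot> y k \<sqsubseteq> y i"
      by (rule Ay; simp add: U_Q_le X_Q_le V_Q_le)+
    then show "A i k \<odot> y k \<sqsubseteq> y i" by (simp add: A distrib_right add_least)
  qed
  have "x i \<odot> \<one> \<sqsubseteq> y i" if "i < n" for i
    using that le_trans[OF Q_ge_one Q_y]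
    by (intro recognizesD(6)[OF \<phi> _ cl]) simp_all
  moreover have "y i \<sqsubseteq> vmv T n ?S Q ?F" if "i < n" "i \<in> I" for i
    unfolding v using dsum_upper[of i n "\<lambda>i. ?S i \<odot> y i"] that by simp
  ultimately have "\<phi> \<odot> \<one> \<sqsubseteq> vmv T n ?S Q ?F"
    by (intro recognizesD(7)[OF \<phi>]) (auto simp: v intro: le_trans)
  then show "\<phi> \<sqsubseteq> vmv T n ?S Q ?F" by simp

  have parts: "U i k \<odot> x k \<sqsubseteq> x i" "X i k \<odot> x k \<sqsubseteq> x i" "V i k \<odot> x k \<sqsubseteq> x i"
    if [simp]: "i < n" "k < n" for i k
  proof -
    have 1: "U i k \<oplus> X i k \<sqsubseteq> A i k" "V i k \<sqsubseteq> A i k" by (simp_all add: A)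
    have 2: "U i k \<sqsubseteq> A i k" "X i k \<sqsubseteq> A i k" by (rule le_trans[OF _ 1(1)]; simp)+
    note * = closed_vecD[OF recognizesD(3)[OF \<phi>] that]
    show "U i k \<odot> x k \<sqsubseteq> x i" "X i k \<odot> x k \<sqsubseteq> x i" "V i k \<odot> x k \<sqsubseteq> x i"
      using 1 2 by (auto intro: le_trans[OF mult_mono1 *])
  qed
  have "y i \<sqsubseteq> x i" if i: "i < n" for i
  proof -
    have "\<one> \<odot> y i \<sqsubseteq> x i"
      unfolding y_def
    proof (rule vact_le)
      fix j assume j: "j < n"
      have "Q i j \<odot> \<one> \<sqsubseteq> Q i j \<odot> x j" if "j \<in> J"
        using recognizesD(4)[OF \<phi> j that] i j by (simp add: mult_mono2 del: unit_simps)
      also have "Q i j \<odot> x j \<sqsubseteq> x i"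
        by (rule Q_vec_le) (use i j parts in auto)
      finally show "\<one> \<odot> (Q i j \<odot> ?F j) \<sqsubseteq> x i" using i j by simp
    qed (use i in simp_all)
    then show ?thesis using i by simp
  qed
  then show "vmv T n ?S Q ?F \<sqsubseteq> \<phi>"
    unfolding v by (intro dsum_least) (auto intro: le_trans recognizesD(5)[OF \<phi>])
qed

text \<open>The value of a run is a product of entries of \<open>X\<close>, and commutation with
  \<open>z\<close> passes to the supremum because multiplication by \<open>z\<close> preserves it.
  With \<open>z\<close> ranging over the image of \<open>C2\<close> this puts \<open>N\<close> into
  the centralizer.\<close>

lemma N_commute:
  assumes ij: "i < n" "j < n"
    and z: "z \<in> \<C>" "\<And>i j. i < n \<Longrightarrow> j < n \<Longrightarrow> X i j \<odot> z = z \<odot> X i j"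
  shows "N i j \<odot> z = z \<odot> N i j"
proof (rule le_antisym)
  have w: "w \<odot> z = z \<odot> w" "w \<sqsubseteq> N i j" if "run j [] i w" for w
    using run_commute[OF z that] run_le_N[OF ij that] by auto
  show "N i j \<odot> z \<sqsubseteq> z \<odot> N i j"
    by (rule belowD_right[OF below_N[OF ij] z(1)]) (use ij z w in \<open>auto intro: mult_mono2\<close>)
  show "z \<odot> N i j \<sqsubseteq> N i j \<odot> z"
    by (rule belowD_left[OF below_N[OF ij] z(1)]) (use ij z w in \<open>auto simp flip: w(1) intro: mult_mono1\<close>)
qed

end

subsection \<open>Generation of the tensor product\<close>

lemma rat_subset:
  assumes "u \<in> C" "\<And>x y. x \<in> C \<Longrightarrow> y \<in> C \<Longrightarrow> m x y \<in> C" "A \<in> rat C m u"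
  shows "A \<subseteq> C"
  using assms(3)
proof induction
  case (rat_star A)
  have "x \<in> C" if "x \<in> mclos m u A" for x
    using that by induction (use rat_star assms in auto)
  then show ?case by blast
qed (use assms in \<open>auto simp: smul_def\<close>)

lemma image_mclos:
  assumes C: "u \<in> C" "\<And>x y. x \<in> C \<Longrightarrow> y \<in> C \<Longrightarrow> m x y \<in> C" "A \<subseteq> C"
    and f: "f u = u'" "\<And>x y. x \<in> C \<Longrightarrow> y \<in> C \<Longrightarrow> f (m x y) = m' (f x) (f y)"
  shows "f ` mclos m u A = mclos m' u' (f ` A)"
proof -
  have "x \<in> C \<and> f x \<in> mclos m' u' (f ` A)" if "x \<in> mclos m u A" for x
    using that
  proof induction
    case (mclos_step a x)
    then have "f (m a x) = m' (f a) (f x)" "f a \<in> f ` A" using C f by auto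
    moreover have "m' (f a) (f x) \<in> mclos m' u' (f ` A)"
      using calculation(2) mclos_step.IH by (blast intro: mclos.mclos_step)
    ultimately show ?case using mclos_step C by auto
  next
    case mclos_unit
    then show ?case using C(1) f(1) mclos.mclos_unit[of u' m' "f ` A"] by simp
  qed
  moreover have "\<exists>x\<in>mclos m u A. x \<in> C \<and> y = f x" if "y \<in> mclos m' u' (f ` A)" for y
    using that
  proof induction
    case mclos_unit
    have "u \<in> mclos m u A" by (rule mclos.mclos_unit)
    then show ?case using C(1) f(1) by blast
  next
    case (mclos_step b y)
    then obtain a x where ax: "a \<in> A" "b = f a" "x \<in> mclos m u A" "x \<in> C" "y = f x" by blast
    then have "m a x \<in> mclos m u A" by (intro mclos.mclos_step)
    moreover have "m a x \<in> C" "m' b y = f (m a x)" using ax C f by auto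
    ultimately show ?case by blast
  qed
  ultimately show ?thesis by blast
qed

lemma image_smul:
  assumes "A \<subseteq> C" "B \<subseteq> C" "\<And>x y. x \<in> C \<Longrightarrow> y \<in> C \<Longrightarrow> f (m x y) = m' (f x) (f y)"
  shows "f ` smul m A B = smul m' (f ` A) (f ` B)"
proof
  show "f ` smul m A B \<subseteq> smul m' (f ` A) (f ` B)"
    using assms unfolding smul_def by blast
  show "smul m' (f ` A) (f ` B) \<subseteq> f ` smul m A B"
  proof
    fix z assume "z \<in> smul m' (f ` A) (f ` B)"
    then obtain a b where ab: "a \<in> A" "b \<in> B" "z = m' (f a) (f b)" by (auto simp: smul_def)
    then have "a \<in> C" "b \<in> C" using assms(1,2) by auto
    with ab(3) have "z = f (m a b)" by (simp add: assms(3))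
    moreover have "m a b \<in> smul m A B" using ab by (auto simp: smul_def)
    ultimately show "z \<in> f ` smul m A B" by blast
  qed
qed

lemma image_rat:
  assumes C: "u \<in> C" "\<And>x y. x \<in> C \<Longrightarrow> y \<in> C \<Longrightarrow> m x y \<in> C"
    and f: "f u = u'" "\<And>x y. x \<in> C \<Longrightarrow> y \<in> C \<Longrightarrow> f (m x y) = m' (f x) (f y)" "f ` C \<subseteq> C'"
    and A: "A \<in> rat C m u"
  shows "f ` A \<in> rat C' m' u'"
  using A
proof induction
  case (rat_single a)
  then show ?case using f(3) by (auto intro: rat.rat_single)
next
  case (rat_mult A B)
  have "f ` smul m A B = smul m' (f ` A) (f ` B)"
    using rat_mult rat_subset[OF C] f(2) by (intro image_smul)
  then show ?case using rat_mult by (simp add: rat.rat_mult)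
next
  case (rat_star A)
  have "f ` mclos m u A = mclos m' u' (f ` A)"
    using rat_star rat_subset[OF C] f C by (intro image_mclos)
  then show ?case using rat_star by (simp add: rat.rat_star)
qed (auto simp: image_Un intro: rat.intros)

context rdioid begin

section \<open>Subalgebras generated by a set\<close>

inductive_set gen :: "'t set \<Rightarrow> 't set" for B where
  gen_base: "x \<in> B \<Longrightarrow> x \<in> gen B"
| gen_zero: "\<zero> \<in> gen B"
| gen_one: "\<one> \<in> gen B"
| gen_add: "x \<in> gen B \<Longrightarrow> y \<in> gen B \<Longrightarrow> x \<oplus> y \<in> gen B"
| gen_mult: "x \<in> gen B \<Longrightarrow> y \<in> gen B \<Longrightarrow> x \<odot> y \<in> gen B"
| gen_star: "x \<in> gen B \<Longrightarrow> rstar T x \<in> gen B"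

lemma gen_closed: "B \<subseteq> \<C> \<Longrightarrow> gen B \<subseteq> \<C>"
proof
  fix x assume B: "B \<subseteq> \<C>" and "x \<in> gen B"
  from this(2) show "x \<in> \<C>" by induction (simp_all add: subsetD[OF B])
qed

lemma csup_add: "csup A s \<Longrightarrow> csup B t \<Longrightarrow> csup (A \<union> B) (s \<oplus> t)"
  unfolding csup_def
proof (intro conjI ballI)
  assume st: "below s A \<and> (\<forall>w\<in>A. w \<sqsubseteq> s)" "below t B \<and> (\<forall>w\<in>B. w \<sqsubseteq> t)"
  then have [simp]: "s \<in> \<C>" "t \<in> \<C>" and AB: "A \<union> B \<subseteq> \<C>" by (auto dest: below_carrier)
  show "below (s \<oplus> t) (A \<union> B)"
    using below_mono[OF _ Un_upper1 AB] below_mono[OF _ Un_upper2 AB] st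
    by (intro below_add) simp_all
  fix w assume "w \<in> A \<union> B"
  then show "w \<sqsubseteq> s \<oplus> t"
    using st le_trans[OF _ add_upper1[of s t], of w] le_trans[OF _ add_upper2[of s t], of w] by auto
qed

lemma csup_mult: "csup A s \<Longrightarrow> csup B t \<Longrightarrow> csup (smul (\<odot>) A B) (s \<odot> t)"
  unfolding csup_def
proof (intro conjI ballI)
  assume st: "below s A \<and> (\<forall>w\<in>A. w \<sqsubseteq> s)" "below t B \<and> (\<forall>w\<in>B. w \<sqsubseteq> t)"
  then show "below (s \<odot> t) (smul (\<odot>) A B)" by (simp add: below_mult)
  fix w assume "w \<in> smul (\<odot>) A B"
  then show "w \<sqsubseteq> s \<odot> t" using st by (auto simp: smul_def mult_mono)
qed

text \<open>By induction on the regular expression, its value in \<open>T\<close> is a supremum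
  inside \<open>gen B\<close>. The stronger notion \<open>csup\<close> is carried along because it
  survives products and stars.\<close>

lemma csup_Reg_gen:
  assumes B: "B \<subseteq> \<C>"
  shows "A \<in> rat (gen B) (\<odot>) \<one> \<Longrightarrow> \<exists>s\<in>gen B. csup A s"
proof (induction rule: rat.induct)
  case rat_empty
  have "csup {} \<zero>" by (simp add: csup_def below_zero)
  with gen_zero show ?case by blast
next
  case (rat_single a)
  then have "a \<in> \<C>" using gen_closed[OF B] by blast
  then have "csup {a} a" by (simp add: csup_def below_member)
  with rat_single show ?case by blast
next
  case (rat_union A A')
  then obtain s t where "s \<in> gen B" "t \<in> gen B" "csup A s" "csup A' t" by blast
  then show ?case using gen_add csup_add by (intro bexI[of _ "s \<oplus> t"])
next
  case (rat_mult A A')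
  then obtain s t where "s \<in> gen B" "t \<in> gen B" "csup A s" "csup A' t" by blast
  then show ?case using gen_mult csup_mult by (intro bexI[of _ "s \<odot> t"])
next
  case (rat_star A)
  then obtain s where "s \<in> gen B" "csup A s" by blast
  then show ?case using gen_star csup_star by (intro bexI[of _ "rstar T s"])
qed

lemma sub_rsum:
  assumes B: "B \<subseteq> \<C>" and s: "s \<in> gen B" "csup A s"
  shows "is_lub (T\<lparr>dcar := gen B\<rparr>) A s" "rsum (T\<lparr>dcar := gen B\<rparr>) A = s" "rsum T A = s"
proof -
  have lub: "is_lub T A s" by (rule csup_is_lub[OF s(2)])
  then show "rsum T A = s" by (rule rsum_eqI)
  show 1: "is_lub (T\<lparr>dcar := gen B\<rparr>) A s"
    using lub s gen_closed[OF B] by (auto simp: is_lub_def dle_def)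
  have "t = s" if "is_lub (T\<lparr>dcar := gen B\<rparr>) A t" for t
  proof (rule le_antisym)
    show "t \<sqsubseteq> s" "s \<sqsubseteq> t"
      using that 1 gen_closed[OF B] by (auto simp: is_lub_def le_def dle_def)
  qed
  with 1 show "rsum (T\<lparr>dcar := gen B\<rparr>) A = s"
    unfolding rsum_def by (intro the_equality)
qed

lemma rsum_sub:
  assumes "B \<subseteq> \<C>" "A \<in> rat (gen B) (\<odot>) \<one>"
  shows "rsum (T\<lparr>dcar := gen B\<rparr>) A = rsum T A"
  using csup_Reg_gen[OF assms] sub_rsum[OF assms(1)] by auto

lemma R_dioid_sub:
  assumes B: "B \<subseteq> \<C>"
  shows "R_dioid (T\<lparr>dcar := gen B\<rparr>)"
  unfolding R_dioid_def
proof (intro conjI ballI)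
  have G: "x \<in> gen B \<Longrightarrow> x \<in> \<C>" for x using gen_closed[OF B] by auto
  show "Defs.dioid (T\<lparr>dcar := gen B\<rparr>)"
    unfolding dioid_def
    by (auto intro: gen_zero gen_one gen_add gen_mult
        simp: G add_assoc mult_assoc distrib_left distrib_right intro: add_commute[OF G G])
  fix A assume "A \<in> Reg (T\<lparr>dcar := gen B\<rparr>)"
  then have A: "A \<in> rat (gen B) (\<odot>) \<one>" by simp
  then obtain s where s: "s \<in> gen B" "csup A s" using csup_Reg_gen[OF B] by blast
  then show "\<exists>s. is_lub (T\<lparr>dcar := gen B\<rparr>) A s" using sub_rsum[OF B] by blast
  fix A' assume "A' \<in> Reg (T\<lparr>dcar := gen B\<rparr>)"
  then obtain t where t: "t \<in> gen B" "csup A' t" using csup_Reg_gen[OF B, of A'] by auto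
  show "rsum (T\<lparr>dcar := gen B\<rparr>) (smul (dmul (T\<lparr>dcar := gen B\<rparr>)) A A') =
    dmul (T\<lparr>dcar := gen B\<rparr>) (rsum (T\<lparr>dcar := gen B\<rparr>) A) (rsum (T\<lparr>dcar := gen B\<rparr>) A')"
    using sub_rsum(2)[OF B gen_mult[OF s(1) t(1)] csup_mult[OF s(2) t(2)]]
      sub_rsum(2)[OF B s] sub_rsum(2)[OF B t] by simp
qed

text \<open>A morphism takes regular sets of \<open>D\<close> to regular sets of the subalgebra, and
  there the sums agree with those of \<open>T\<close>.\<close>

lemma R_morph_into_sub:
  assumes B: "B \<subseteq> \<C>" and D: "Defs.dioid D" and f: "R_morph D T f" "f ` dcar D \<subseteq> gen B"
  shows "R_morph D (T\<lparr>dcar := gen B\<rparr>) f"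
proof -
  have "f (rsum D A) = rsum (T\<lparr>dcar := gen B\<rparr>) (f ` A)" if A: "A \<in> Reg D" for A
  proof -
    have "f ` A \<in> rat (gen B) (\<odot>) \<one>"
      by (rule image_rat[OF _ _ _ _ f(2) A]) (use D f(1) in \<open>auto simp: dioid_def R_morph_def\<close>)
    then have "rsum (T\<lparr>dcar := gen B\<rparr>) (f ` A) = rsum T (f ` A)" by (rule rsum_sub[OF B])
    with A f(1) show ?thesis by (simp add: R_morph_def)
  qed
  with f show ?thesis by (simp add: R_morph_def)
qed

lemma R_morph_from_sub:
  assumes B: "B \<subseteq> \<C>" and D: "Defs.dioid D" and f: "R_morph D (T\<lparr>dcar := gen B\<rparr>) f"
  shows "R_morph D T f"
proof -
  have fD: "f ` dcar D \<subseteq> gen B" using f by (simp add: R_morph_def)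
  have "f (rsum D A) = rsum T (f ` A)" if A: "A \<in> Reg D" for A
  proof -
    have "f ` A \<in> rat (gen B) (\<odot>) \<one>"
      by (rule image_rat[OF _ _ _ _ fD A]) (use D f in \<open>auto simp: dioid_def R_morph_def\<close>)
    then have "rsum (T\<lparr>dcar := gen B\<rparr>) (f ` A) = rsum T (f ` A)" by (rule rsum_sub[OF B])
    with A f show ?thesis by (simp add: R_morph_def)
  qed
  with f fD gen_closed[OF B] show ?thesis by (auto simp: R_morph_def)
qed

end

text \<open>By uniqueness, the identity of \<open>T\<close> factors through the subalgebra generated by the images.\<close>
lemma tensor_generated:
  fixes T :: "'t dioid_ops"
  assumes ten: "is_R_tensor K1 K2 T t1 t2"
    and K: "dioid K1" "dioid K2"
    and B: "B \<subseteq> dcar T" "t1 ` dcar K1 \<subseteq> rdioid.gen T B" "t2 ` dcar K2 \<subseteq> rdioid.gen T B"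
  shows "dcar T \<subseteq> rdioid.gen T B"
proof -
  have RT: "R_dioid T" and m1: "R_morph K1 T t1" and m2: "R_morph K2 T t2"
    and com: "\<forall>x\<in>dcar K1. \<forall>y\<in>dcar K2. dmul T (t1 x) (t2 y) = dmul T (t2 y) (t1 x)"
    using ten by (auto simp: is_R_tensor_def)
  have univ: "\<exists>h. R_morph T E h \<and> (\<forall>x\<in>dcar K1. h (t1 x) = f x) \<and> (\<forall>y\<in>dcar K2. h (t2 y) = g y) \<and>
           (\<forall>h'. R_morph T E h' \<and> (\<forall>x\<in>dcar K1. h' (t1 x) = f x) \<and>
                 (\<forall>y\<in>dcar K2. h' (t2 y) = g y) \<longrightarrow> (\<forall>z\<in>dcar T. h' z = h z))"
    if "R_dioid E" "R_morph K1 E f" "R_morph K2 E g"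
      "\<forall>x\<in>dcar K1. \<forall>y\<in>dcar K2. dmul E (f x) (g y) = dmul E (g y) (f x)"
    for E :: "'t dioid_ops" and f g
    using ten that unfolding is_R_tensor_def by blast
  interpret rdioid T by unfold_locales (rule RT)
  \<comment> \<open>The subalgebra keeps the type of \<open>T\<close>, as a target of the universal
    property must.\<close>
  let ?E = "T\<lparr>dcar := gen B\<rparr>"
  obtain h where h: "R_morph T ?E h" "\<forall>x\<in>dcar K1. h (t1 x) = t1 x" "\<forall>y\<in>dcar K2. h (t2 y) = t2 y"
    using univ[OF R_dioid_sub[OF B(1)] R_morph_into_sub[OF B(1) K(1) m1 B(2)]
        R_morph_into_sub[OF B(1) K(2) m2 B(3)]] com by auto
  have hT: "R_morph T T h" by (rule R_morph_from_sub[OF B(1) dioid h(1)])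
  have idT: "R_morph T T (\<lambda>x. x)" by (simp add: R_morph_def)
  \<comment> \<open>\<open>h\<close> followed by the inclusion and the identity both extend
    \<open>t1\<close> and \<open>t2\<close>, so uniqueness makes them equal.\<close>
  have "h z = z" if "z \<in> dcar T" for z
    using univ[OF RT m1 m2 com] hT h(2,3) idT that by metis
  then show ?thesis using h(1) by (force simp: R_morph_def)
qed

subsection \<open>The polycyclic dioid\<close>

lemma smul_append_assoc: "smul (@) (smul (@) A B) C = smul (@) A (smul (@) B C)"
proof (rule set_eqI, rule iffI)
  fix w assume "w \<in> smul (@) (smul (@) A B) C"
  then obtain a b c where "a \<in> A" "b \<in> B" "c \<in> C" "w = (a @ b) @ c" by (auto simp: smul_def)
  then show "w \<in> smul (@) A (smul (@) B C)" unfolding smul_def append_assoc by blast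
next
  fix w assume "w \<in> smul (@) A (smul (@) B C)"
  then obtain a b c where "a \<in> A" "b \<in> B" "c \<in> C" "w = a @ (b @ c)" by (auto simp: smul_def)
  then show "w \<in> smul (@) (smul (@) A B) C" unfolding smul_def append_assoc[symmetric] by blast
qed

lemma smul_append_simps:
  "smul (@) A (B \<union> C) = smul (@) A B \<union> smul (@) A C"
  "smul (@) (A \<union> B) C = smul (@) A C \<union> smul (@) B C"
  "smul (@) A {[]} = A" "smul (@) {[]} A = A" "smul (@) A {} = {}" "smul (@) {} A = {}"
  by (auto simp: smul_def)

lemma dioid_RDelta: "dioid RDelta"
  unfolding dioid_def RDelta_def
  by (simp add: smul_append_assoc smul_append_simps rat.intros Un_ac)

lemma Union_smul: "\<Union>(smul (smul m) A B) = smul m (\<Union>A) (\<Union>B)"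
  unfolding smul_def by blast

lemma Union_mclos: "\<Union>(mclos (smul (@)) {[]} A) = mclos (@) [] (\<Union>A)"
proof
  have "L \<subseteq> mclos (@) [] (\<Union>A)" if "L \<in> mclos (smul (@)) {[]} A" for L
    using that by induction (auto simp: smul_def intro: mclos.intros)
  then show "\<Union>(mclos (smul (@)) {[]} A) \<subseteq> mclos (@) [] (\<Union>A)" by blast
  have "\<exists>L\<in>mclos (smul (@)) {[]} A. w \<in> L" if "w \<in> mclos (@) [] (\<Union>A)" for w
    using that
  proof induction
    case mclos_unit
    show ?case by (rule bexI[OF _ mclos.mclos_unit]) simp
  next
    case (mclos_step a x)
    then obtain L L' where "L \<in> A" "a \<in> L" "L' \<in> mclos (smul (@)) {[]} A" "x \<in> L'" by blast
    then have "smul (@) L L' \<in> mclos (smul (@)) {[]} A" by (intro mclos.mclos_step)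
    moreover have "a @ x \<in> smul (@) L L'"
      using \<open>a \<in> L\<close> \<open>x \<in> L'\<close> by (auto simp: smul_def)
    ultimately show ?case by blast
  qed
  then show "mclos (@) [] (\<Union>A) \<subseteq> \<Union>(mclos (smul (@)) {[]} A)" by blast
qed

text \<open>Union turns the regular operations on families of languages into those on languages.
  Hence sums in the algebra of regular languages are plain unions.\<close>

lemma Union_Reg_RDelta: "\<U> \<in> Reg RDelta \<Longrightarrow> \<Union>\<U> \<in> dcar RDelta"
proof -
  have "\<U> \<in> rat (rat UNIV (@) []) (smul (@)) {[]} \<Longrightarrow> \<Union>\<U> \<in> rat UNIV (@) []"
    by (induction rule: rat.induct) (auto simp: Union_smul Union_mclos intro: rat.intros)
  then show "\<U> \<in> Reg RDelta \<Longrightarrow> \<Union>\<U> \<in> dcar RDelta" by (simp add: RDelta_def)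
qed

lemma rsum_RDelta: "\<U> \<in> Reg RDelta \<Longrightarrow> rsum RDelta \<U> = \<Union>\<U>"
  unfolding rsum_def
proof (rule the_equality)
  assume U: "\<U> \<in> Reg RDelta"
  then show 1: "is_lub RDelta \<U> (\<Union>\<U>)"
    using Union_Reg_RDelta[OF U] by (auto simp: is_lub_def dle_def RDelta_def)
  show "s = \<Union>\<U>" if s: "is_lub RDelta \<U> s" for s
  proof
    have "dle RDelta s (\<Union>\<U>)" using 1 s unfolding is_lub_def by blast
    then show "s \<subseteq> \<Union>\<U>" by (auto simp: dle_def RDelta_def)
    show "\<Union>\<U> \<subseteq> s" using s by (auto simp: is_lub_def dle_def RDelta_def)
  qed
qed

section \<open>Existence of the least R-congruence\<close>

lemma R_congruence_le_trans:
  assumes \<theta>: "R_congruence RDelta \<theta>" and C: "x \<in> dcar RDelta" "w \<in> dcar RDelta"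
    and le: "(x \<union> v, v) \<in> \<theta>" "(v \<union> w, w) \<in> \<theta>"
  shows "(x \<union> w, w) \<in> \<theta>"
proof -
  have eq: "equiv (dcar RDelta) \<theta>"
    and cong: "\<And>x x' y y'. (x, x') \<in> \<theta> \<Longrightarrow> (y, y') \<in> \<theta> \<Longrightarrow> (x \<union> y, x' \<union> y') \<in> \<theta>"
    using \<theta> unfolding R_congruence_def by (auto simp: RDelta_def)
  have refl: "(z, z) \<in> \<theta>" if "z \<in> dcar RDelta" for z
    using eq that by (auto simp: equiv_def refl_on_def)
  have sym: "(w, v \<union> w) \<in> \<theta>" using eq le(2) by (auto simp: equiv_def sym_def)
  have trans: "(a, b) \<in> \<theta> \<Longrightarrow> (b, c) \<in> \<theta> \<Longrightarrow> (a, c) \<in> \<theta>" for a b c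
    using eq unfolding equiv_def trans_def by blast
  have "(x \<union> w, x \<union> (v \<union> w)) \<in> \<theta>" by (rule cong[OF refl[OF C(1)] sym])
  moreover have "(x \<union> (v \<union> w), v \<union> w) \<in> \<theta>"
    using cong[OF le(1) refl[OF C(2)]] by (simp add: Un_assoc)
  ultimately show ?thesis using le(2) trans by blast
qed

text \<open>R-congruences are closed under intersection, which is not evident for the condition on
  regular sets: its premise for the intersection must yield the premise for each larger
  \<open>\<theta>\<close>. It does, since it says that each member of one set is below a member of
  the other, and this passes to \<open>\<theta>\<close>.\<close>

lemma R_congruence_rhoC2: "R_congruence RDelta rhoC2"
  and rhoC2_relations:
    "({[Lb, Ld]}, {[]}) \<in> rhoC2" "({[Lp, Lq]}, {[]}) \<in> rhoC2"
    "({[Lb, Lq]}, {}) \<in> rhoC2" "({[Lp, Ld]}, {}) \<in> rhoC2"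
proof -
  let ?R = "{({[Lb, Ld]}, {[]}), ({[Lp, Lq]}, {[]}), ({[Lb, Lq]}, {}), ({[Lp, Ld]}, {})}"
  let ?F = "{\<theta>. R_congruence RDelta \<theta> \<and> ?R \<subseteq> \<theta>}"
  have rho: "rhoC2 = \<Inter>?F" by (simp add: rhoC2_def least_R_congruence_def)
  show "({[Lb, Ld]}, {[]}) \<in> rhoC2" "({[Lp, Lq]}, {[]}) \<in> rhoC2"
    "({[Lb, Lq]}, {}) \<in> rhoC2" "({[Lp, Ld]}, {}) \<in> rhoC2"
    unfolding rho by (intro InterI; simp)+
  let ?C = "dcar RDelta"
  \<comment> \<open>The total relation belongs to the family; an empty family would have an
    intersection that leaves the carrier.\<close>
  have total: "?C \<times> ?C \<in> ?F"
  proof -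
    have "equiv ?C (?C \<times> ?C)" by (auto simp: equiv_def refl_on_def sym_def trans_def)
    moreover have "?R \<subseteq> ?C \<times> ?C" by (auto simp: RDelta_def intro: rat.intros)
    moreover have "dadd RDelta x y \<in> ?C" "dmul RDelta x y \<in> ?C" if "x \<in> ?C" "y \<in> ?C" for x y
      using that by (auto simp: RDelta_def intro: rat.intros)
    ultimately show ?thesis
      using Union_Reg_RDelta rsum_RDelta by (simp add: R_congruence_def)
  qed
  have eq: "equiv ?C \<theta>" if "\<theta> \<in> ?F" for \<theta> using that by (simp add: R_congruence_def)
  have E: "equiv ?C rhoC2"
  proof (rule equivI)
    show "rhoC2 \<subseteq> ?C \<times> ?C" unfolding rho by (rule Inter_lower[OF total])
    show "refl_on ?C rhoC2"
    proof (rule refl_onI)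
      fix x assume "x \<in> ?C"
      then show "(x, x) \<in> rhoC2"
        unfolding rho by (intro InterI) (drule eq, simp add: equiv_def refl_on_def)
    qed
    show "sym rhoC2"
    proof (rule symI)
      fix x y assume xy: "(x, y) \<in> rhoC2"
      show "(y, x) \<in> rhoC2"
        unfolding rho
      proof
        fix \<theta> assume \<theta>: "\<theta> \<in> ?F"
        have "sym \<theta>" using eq[OF \<theta>] by (simp add: equiv_def)
        from symD[OF this InterD[OF xy[unfolded rho] \<theta>]] show "(y, x) \<in> \<theta>" .
      qed
    qed
    show "trans rhoC2"
    proof (rule transI)
      fix x y z assume xy: "(x, y) \<in> rhoC2" and yz: "(y, z) \<in> rhoC2"
      show "(x, z) \<in> rhoC2"
        unfolding rho
      proof
        fix \<theta> assume \<theta>: "\<theta> \<in> ?F"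
        have "trans \<theta>" using eq[OF \<theta>] by (simp add: equiv_def)
        from transD[OF this InterD[OF xy[unfolded rho] \<theta>] InterD[OF yz[unfolded rho] \<theta>]]
        show "(x, z) \<in> \<theta>" .
      qed
    qed
  qed
  show "R_congruence RDelta rhoC2"
    unfolding R_congruence_def
  proof (intro conjI allI ballI impI)
    show "equiv ?C rhoC2" by (rule E)
    fix x x' y y' assume xy: "(x, x') \<in> rhoC2" "(y, y') \<in> rhoC2"
    have "(dadd RDelta x y, dadd RDelta x' y') \<in> \<theta> \<and> (dmul RDelta x y, dmul RDelta x' y') \<in> \<theta>"
      if "\<theta> \<in> ?F" for \<theta>
    proof -
      note * = InterD[OF xy(1)[unfolded rho] that] InterD[OF xy(2)[unfolded rho] that]
      then show ?thesis using that unfolding R_congruence_def by simp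
    qed
    then show "(dadd RDelta x y, dadd RDelta x' y') \<in> rhoC2" "(dmul RDelta x y, dmul RDelta x' y') \<in> rhoC2"
      unfolding rho by (simp_all only: Inter_iff) blast+
  next
    fix U U' assume U: "U \<in> Reg RDelta" "U' \<in> Reg RDelta"
      and same: "\<forall>x\<in>?C. (\<exists>u\<in>U. (dadd RDelta x u, u) \<in> rhoC2) \<longleftrightarrow> (\<exists>u\<in>U'. (dadd RDelta x u, u) \<in> rhoC2)"
    have sub: "V \<subseteq> ?C" if "V \<in> Reg RDelta" for V
      by (rule rat_subset[OF _ _ that]) (use dioid_RDelta in \<open>simp_all add: dioid_def\<close>)
    show "(rsum RDelta U, rsum RDelta U') \<in> rhoC2"
      unfolding rho
    proof
      fix \<theta> assume "\<theta> \<in> ?F"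
      then have \<theta>: "R_congruence RDelta \<theta>" and rho\<theta>: "rhoC2 \<subseteq> \<theta>"
        unfolding rho by (simp, rule Inter_lower)
      \<comment> \<open>The premise is applied to \<open>v\<close> itself, which is below some
        \<open>v'\<close> of the other set modulo \<open>rhoC2\<close>; then \<open>x\<close> is
        below \<open>v'\<close> modulo \<open>\<theta>\<close> by transitivity.\<close>
      have le: "\<exists>u\<in>V'. (dadd RDelta x u, u) \<in> \<theta>"
        if V: "V \<subseteq> ?C" "V' \<subseteq> ?C" and x: "x \<in> ?C" and v: "v \<in> V" "(dadd RDelta x v, v) \<in> \<theta>"
          and VV': "\<forall>x\<in>?C. (\<exists>u\<in>V. (dadd RDelta x u, u) \<in> rhoC2) \<longrightarrow> (\<exists>u\<in>V'. (dadd RDelta x u, u) \<in> rhoC2)"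
        for V V' x v
      proof -
        have vC: "v \<in> ?C" using V v by auto
        then have "(v, v) \<in> rhoC2" using E by (auto simp: equiv_def refl_on_def)
        then have "\<exists>u\<in>V. (dadd RDelta v u, u) \<in> rhoC2"
          using v(1) by (intro bexI[of _ v]) (simp_all add: RDelta_def)
        then obtain v' where v': "v' \<in> V'" "(v \<union> v', v') \<in> \<theta>"
          using VV' vC rho\<theta> by (auto simp: RDelta_def)
        have "(x \<union> v', v') \<in> \<theta>"
          by (rule R_congruence_le_trans[OF \<theta> x]) (use V v v' in \<open>auto simp: RDelta_def\<close>)
        then show ?thesis using v'(1) by (auto simp: RDelta_def)
      qed
      have "\<forall>x\<in>?C. (\<exists>u\<in>U. (dadd RDelta x u, u) \<in> \<theta>) \<longleftrightarrow> (\<exists>u\<in>U'. (dadd RDelta x u, u) \<in> \<theta>)"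
      proof (intro ballI iffI)
        fix x assume x: "x \<in> ?C" and "\<exists>u\<in>U. (dadd RDelta x u, u) \<in> \<theta>"
        then obtain v where v: "v \<in> U" "(dadd RDelta x v, v) \<in> \<theta>" by blast
        show "\<exists>u\<in>U'. (dadd RDelta x u, u) \<in> \<theta>"
          by (rule le[OF sub[OF U(1)] sub[OF U(2)] x v]) (use same in simp)
      next
        fix x assume x: "x \<in> ?C" and "\<exists>u\<in>U'. (dadd RDelta x u, u) \<in> \<theta>"
        then obtain v where v: "v \<in> U'" "(dadd RDelta x v, v) \<in> \<theta>" by blast
        show "\<exists>u\<in>U. (dadd RDelta x u, u) \<in> \<theta>"
          by (rule le[OF sub[OF U(2)] sub[OF U(1)] x v]) (use same in simp)
      qed
      then show "(rsum RDelta U, rsum RDelta U') \<in> \<theta>"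
        using \<theta> U unfolding R_congruence_def by simp
    qed
  qed
qed

section \<open>The quotient algebra\<close>

abbreviation cl :: "delta list set \<Rightarrow> delta list set set" where "cl L \<equiv> rhoC2 `` {L}"

lemma equiv_rhoC2: "equiv (dcar RDelta) rhoC2"
  using R_congruence_rhoC2 by (simp add: R_congruence_def)

lemma cl_eq_iff: "L \<in> dcar RDelta \<Longrightarrow> M \<in> dcar RDelta \<Longrightarrow> cl L = cl M \<longleftrightarrow> (L, M) \<in> rhoC2"
  by (rule eq_equiv_class_iff[OF equiv_rhoC2])

lemma cl_eqI: "(L, M) \<in> rhoC2 \<Longrightarrow> cl L = cl M"
  by (rule equiv_class_eq[OF equiv_rhoC2])

lemma cl_representative:
  assumes "L \<in> dcar RDelta"
  shows "(L, SOME x. x \<in> cl L) \<in> rhoC2"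
proof -
  have "L \<in> cl L" by (rule equiv_class_self[OF equiv_rhoC2 assms])
  then have "(SOME x. x \<in> cl L) \<in> cl L" by (rule someI)
  then show ?thesis by simp
qed

lemma rat_closed [simp]:
  "{} \<in> dcar RDelta" "{w} \<in> dcar RDelta"
  "L \<in> dcar RDelta \<Longrightarrow> M \<in> dcar RDelta \<Longrightarrow> L \<union> M \<in> dcar RDelta"
  "L \<in> dcar RDelta \<Longrightarrow> M \<in> dcar RDelta \<Longrightarrow> smul (@) L M \<in> dcar RDelta"
  "L \<in> dcar RDelta \<Longrightarrow> mclos (@) [] L \<in> dcar RDelta"
  by (simp_all add: RDelta_def rat.intros)

text \<open>The quotient operations choose representatives; the congruence property makes the result
  independent of the choice.\<close>

lemma C2_cl:
  "dzero C2 = cl {}" "dunit C2 = cl {[]}"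
  "L \<in> dcar RDelta \<Longrightarrow> cl L \<in> dcar C2"
  "L \<in> dcar RDelta \<Longrightarrow> M \<in> dcar RDelta \<Longrightarrow> dadd C2 (cl L) (cl M) = cl (L \<union> M)"
  "L \<in> dcar RDelta \<Longrightarrow> M \<in> dcar RDelta \<Longrightarrow> dmul C2 (cl L) (cl M) = cl (smul (@) L M)"
proof -
  show "dzero C2 = cl {}" "dunit C2 = cl {[]}" "L \<in> dcar RDelta \<Longrightarrow> cl L \<in> dcar C2"
    by (auto simp: C2_def quotient_dioid_def RDelta_def intro: quotientI)
  assume LM: "L \<in> dcar RDelta" "M \<in> dcar RDelta"
  have "(dadd RDelta L M, dadd RDelta (SOME x. x \<in> cl L) (SOME x. x \<in> cl M)) \<in> rhoC2 \<and>
    (dmul RDelta L M, dmul RDelta (SOME x. x \<in> cl L) (SOME x. x \<in> cl M)) \<in> rhoC2"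
    by (rule R_congruence_rhoC2[unfolded R_congruence_def, THEN conjunct2, THEN conjunct1, rule_format,
          OF cl_representative[OF LM(1)] cl_representative[OF LM(2)]])
  then have *: "cl (dadd RDelta L M) = cl (dadd RDelta (SOME x. x \<in> cl L) (SOME x. x \<in> cl M))"
    "cl (dmul RDelta L M) = cl (dmul RDelta (SOME x. x \<in> cl L) (SOME x. x \<in> cl M))"
    using cl_eqI by simp_all
  show "dadd C2 (cl L) (cl M) = cl (L \<union> M)"
    using *(1) by (simp add: C2_def quotient_dioid_def RDelta_def)
  show "dmul C2 (cl L) (cl M) = cl (smul (@) L M)"
    using *(2) by (simp add: C2_def quotient_dioid_def RDelta_def)
qed

lemma C2_cases:
  assumes "x \<in> dcar C2"
  obtains L where "L \<in> dcar RDelta" "x = cl L"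
  using assms by (auto simp: C2_def quotient_dioid_def elim: quotientE)

lemma RDelta_laws:
  "dadd RDelta = (\<union>)" "dmul RDelta = smul (@)" "dzero RDelta = {}" "dunit RDelta = {[]}"
  by (simp_all add: RDelta_def)

lemma Ball_C2: "(\<forall>x\<in>dcar C2. P x) \<longleftrightarrow> (\<forall>L\<in>dcar RDelta. P (cl L))"
  by (auto elim!: C2_cases simp: C2_cl(3))

lemma dioid_C2: "dioid C2"
  unfolding dioid_def Ball_C2
  by (simp add: C2_cl smul_append_assoc smul_append_simps Un_ac)

lemma dle_C2: "L \<in> dcar RDelta \<Longrightarrow> M \<in> dcar RDelta \<Longrightarrow> dle C2 (cl L) (cl M) \<longleftrightarrow> (L \<union> M, M) \<in> rhoC2"
  by (simp add: dle_def C2_cl cl_eq_iff)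

text \<open>Leastness rests on the defining condition of an R-congruence. If the class of
  \<open>M\<close> bounds those of all powers of \<open>L\<close>, then the powers together with
  \<open>M\<close> have the same downward closure as \<open>{M}\<close> alone, so the unions
  \<open>L\<^sup>* \<union> M\<close> and \<open>M\<close> are congruent.\<close>

lemma is_lub_C2_star:
  assumes L: "L \<in> dcar RDelta"
  shows "is_lub C2 (mclos (dmul C2) (dunit C2) {cl L}) (cl (mclos (@) [] L))"
  unfolding is_lub_def
proof (intro conjI ballI impI)
  let ?S = "mclos (@) [] L"
  note [simp] = L
  show "cl ?S \<in> dcar C2" by (simp add: C2_cl)
  fix a assume "a \<in> mclos (dmul C2) (dunit C2) {cl L}"
  then have "\<exists>M\<in>dcar RDelta. a = cl M \<and> M \<subseteq> ?S"
  proof induction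
    case mclos_unit
    then show ?case by (intro bexI[of _ "{[]}"]) (auto simp: C2_cl intro: mclos.mclos_unit)
  next
    case (mclos_step a x)
    then obtain M where M: "M \<in> dcar RDelta" "x = cl M" "M \<subseteq> ?S" by blast
    have "smul (@) L M \<subseteq> ?S" using M(3) by (auto simp: smul_def intro: mclos.mclos_step)
    with mclos_step(1) M show ?case by (intro bexI[of _ "smul (@) L M"]) (auto simp: C2_cl)
  qed
  then obtain M where M: "M \<in> dcar RDelta" "a = cl M" "M \<subseteq> ?S" by blast
  then have "M \<union> ?S = ?S" by blast
  with M show "dle C2 a (cl ?S)" by (simp add: dle_def C2_cl)
next
  let ?S = "mclos (@) [] L"
  note [simp] = L
  fix u assume "u \<in> dcar C2" and ub: "\<forall>a\<in>mclos (dmul C2) (dunit C2) {cl L}. dle C2 a u"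
  then obtain M where M [simp]: "M \<in> dcar RDelta" and u: "u = cl M" by (auto elim: C2_cases)
  let ?P = "mclos (smul (@)) {[]} {L}"
  have P: "P \<in> dcar RDelta \<and> (P \<union> M, M) \<in> rhoC2" if "P \<in> ?P" for P
  proof -
    have *: "P \<in> dcar RDelta \<and> cl P \<in> mclos (dmul C2) (dunit C2) {cl L}"
      using that
    proof induction
      case mclos_unit
      show ?case using mclos.mclos_unit[of "dunit C2" "dmul C2" "{cl L}"] by (simp add: C2_cl)
    next
      case (mclos_step a x)
      then show ?case
        using mclos.mclos_step[of "cl L" "{cl L}" "cl x" "dmul C2" "dunit C2"] by (simp add: C2_cl)
    qed
    then have "dle C2 (cl P) u" using ub by blast
    with * show ?thesis by (simp add: u dle_C2)
  qed
  have MM: "(M \<union> M, M) \<in> rhoC2" using equiv_rhoC2 by (simp add: equiv_def refl_on_def)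
  have U: "?P \<union> {M} \<in> Reg RDelta" "{M} \<in> Reg RDelta"
    unfolding RDelta_laws by (intro rat.intros; simp)+
  have "(\<exists>u\<in>?P \<union> {M}. (dadd RDelta x u, u) \<in> rhoC2) \<longleftrightarrow> (\<exists>u\<in>{M}. (dadd RDelta x u, u) \<in> rhoC2)"
    if x: "x \<in> dcar RDelta" for x
    using R_congruence_le_trans[OF R_congruence_rhoC2 x M] P MM by (auto simp: RDelta_laws)
  then have "(rsum RDelta (?P \<union> {M}), rsum RDelta {M}) \<in> rhoC2"
    by (intro R_congruence_rhoC2[unfolded R_congruence_def, THEN conjunct2, THEN conjunct2, rule_format]
        U) simp
  then have "(?S \<union> M, M) \<in> rhoC2"
    unfolding rsum_RDelta[OF U(1)] rsum_RDelta[OF U(2)] by (simp add: Union_mclos Un_commute)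
  then show "dle C2 (cl ?S) u" by (simp add: u dle_C2)
qed

lemma is_lub_le:
  assumes "is_lub D A s" "is_lub D A t"
  shows "dle D s t"
proof -
  have "\<forall>u\<in>dcar D. (\<forall>a\<in>A. dle D a u) \<longrightarrow> dle D s u"
    using assms(1) unfolding is_lub_def by (elim conjE)
  moreover have "t \<in> dcar D" "\<forall>a\<in>A. dle D a t"
    using assms(2) unfolding is_lub_def by blast+
  ultimately show ?thesis by blast
qed

lemma rsum_C2_star:
  assumes "L \<in> dcar RDelta"
  shows "rsum C2 (mclos (dmul C2) (dunit C2) {cl L}) = cl (mclos (@) [] L)"
  unfolding rsum_def
proof (rule the_equality)
  show 1: "is_lub C2 (mclos (dmul C2) (dunit C2) {cl L}) (cl (mclos (@) [] L))"
    by (rule is_lub_C2_star[OF assms])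
  fix s assume s: "is_lub C2 (mclos (dmul C2) (dunit C2) {cl L}) s"
  let ?t = "cl (mclos (@) [] L)"
  have st: "dle C2 s ?t" "dle C2 ?t s"
    by (rule is_lub_le[OF s 1], rule is_lub_le[OF 1 s])
  have "s \<in> dcar C2" using s by (simp add: is_lub_def)
  then obtain M where M: "M \<in> dcar RDelta" "s = cl M" by (rule C2_cases)
  have "dadd C2 s ?t = dadd C2 ?t s" using assms M by (simp add: C2_cl Un_commute)
  then show "s = ?t" using st by (simp add: dle_def)
qed

lemma letter_C2: "letter a \<in> dcar C2"
  by (simp add: letter_def C2_cl)

text \<open>The class of a language is built from letters along a regular expression, and
  \<open>f\<close> preserves each operation; for the star, \<open>rsum_C2_star\<close> presents it
  as a regular sum.\<close>

lemma C2_image_generated: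
  assumes T: "R_dioid T" and f: "R_morph C2 T f" and B: "range (\<lambda>a. f (letter a)) \<subseteq> B"
  shows "f ` dcar C2 \<subseteq> rdioid.gen T B"
proof -
  interpret rdioid T by unfold_locales (rule T)
  have f0: "f (cl {}) = \<zero>" and f1: "f (cl {[]}) = \<one>"
    using f by (simp_all add: R_morph_def flip: C2_cl)
  have fadd: "f (cl (L \<union> M)) = f (cl L) \<oplus> f (cl M)"
    and fmul: "f (cl (smul (@) L M)) = f (cl L) \<odot> f (cl M)"
    if "L \<in> dcar RDelta" "M \<in> dcar RDelta" for L M
    using f that by (simp_all add: R_morph_def C2_cl(3) flip: C2_cl(4,5))
  have fstar: "f (cl (mclos (@) [] L)) = rstar T (f (cl L))" if L: "L \<in> dcar RDelta" for L
  proof -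
    have A: "mclos (dmul C2) (dunit C2) {cl L} \<in> Reg C2"
      by (intro rat.intros C2_cl(3) L)
    have "f ` mclos (dmul C2) (dunit C2) {cl L} = mclos (\<odot>) \<one> (f ` {cl L})"
    proof (rule image_mclos[where C = "dcar C2"])
      show "dunit C2 \<in> dcar C2" "\<And>x y. x \<in> dcar C2 \<Longrightarrow> y \<in> dcar C2 \<Longrightarrow> dmul C2 x y \<in> dcar C2"
        using dioid_C2 by (simp_all add: dioid_def)
      show "f (dunit C2) = \<one>"
        "\<And>x y. x \<in> dcar C2 \<Longrightarrow> y \<in> dcar C2 \<Longrightarrow> f (dmul C2 x y) = f x \<odot> f y"
        using f by (simp_all add: R_morph_def)
      show "{cl L} \<subseteq> dcar C2" using C2_cl(3)[OF L] by simp
    qed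
    with A f show ?thesis
      unfolding rsum_C2_star[OF L, symmetric] rstar_def by (simp add: R_morph_def)
  qed
  have word: "f (cl {w}) \<in> gen B" for w
  proof (induction w)
    case (Cons a w)
    have "f (cl {a # w}) = f (cl (smul (@) {[a]} {w}))" by (simp add: smul_def)
    also have "\<dots> = f (letter a) \<odot> f (cl {w})" by (simp add: fmul letter_def)
    also have "\<dots> \<in> gen B" using B by (intro gen_mult[OF gen_base Cons.IH]) auto
    finally show ?case .
  qed (simp add: f1 gen_one)
  have "f (cl L) \<in> gen B" if "L \<in> rat UNIV (@) []" for L
    using that
  proof induction
    case (rat_union L M)
    then show ?case by (subst fadd) (auto simp: RDelta_def intro: gen_add)
  next
    case (rat_mult L M)
    then show ?case by (subst fmul) (auto simp: RDelta_def intro: gen_mult)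
  next
    case (rat_star L)
    then show ?case by (subst fstar) (auto simp: RDelta_def intro: gen_star)
  qed (simp_all add: f0 gen_zero word)
  then have "f (cl L) \<in> gen B" if "L \<in> dcar RDelta" for L using that by (simp add: RDelta_def)
  then show ?thesis using C2_cases by (metis image_subsetI)
qed

subsection \<open>The normal form\<close>

theorem theorem7:
  fixes K :: "'a dioid_ops" and T :: "'t dioid_ops"
    and t1 :: "'a \<Rightarrow> 't" and t2 :: "delta list set set \<Rightarrow> 't"
  assumes "R_dioid K"
    and "is_R_tensor K C2 T t1 t2"
    and "\<phi> \<in> dcar T"
  shows "\<exists>(n::nat) S F U V X N.
           (\<forall>i<n. S i \<in> {dzero T, dunit T} \<and> F i \<in> {dzero T, dunit T}) \<and>
           (\<forall>i<n. \<forall>j<n. U i j \<in> {dzero T, t2 (letter Lb), t2 (letter Lp)}) \<and>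
           (\<forall>i<n. \<forall>j<n. V i j \<in> {dzero T, t2 (letter Ld), t2 (letter Lq)}) \<and>
           mat_over n (t1 ` dcar K) X \<and>
           least_sol T n U V X N \<and>
           \<phi> = vmv T n S (mmul T n (mmul T n (mstar T n (mmul T n N V)) N)
                                   (mstar T n (mmul T n U N))) F \<and>
           mat_over n (centralizer T (dcar C2) t2) N"
proof -
  have RT: "R_dioid T" and m1: "R_morph K T t1" and m2: "R_morph C2 T t2"
    and com: "\<And>x y. x \<in> dcar K \<Longrightarrow> y \<in> dcar C2 \<Longrightarrow> dmul T (t1 x) (t2 y) = dmul T (t2 y) (t1 x)"
    using assms(2) by (auto simp: is_R_tensor_def)
  have K: "dioid K" using assms(1) by (simp add: R_dioid_def)
  interpret rdioid T by unfold_locales (rule RT)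
  define opn where "opn = (\<lambda>\<sigma>. t2 (letter (if \<sigma> then Lb else Lp)))"
  define cls where "cls = (\<lambda>\<sigma>. t2 (letter (if \<sigma> then Ld else Lq)))"
  have t1C: "x \<in> dcar K \<Longrightarrow> t1 x \<in> \<C>" and t2C: "y \<in> dcar C2 \<Longrightarrow> t2 y \<in> \<C>" for x y
    using m1 m2 by (auto simp: R_morph_def)
  have t2_mult: "t2 (letter a) \<odot> t2 (letter b) = t2 (cl {[a, b]})" for a b
  proof -
    have "t2 (letter a) \<odot> t2 (letter b) = t2 (dmul C2 (letter a) (letter b))"
      using m2 letter_C2 by (simp add: R_morph_def)
    then show ?thesis by (simp add: letter_def C2_cl) (simp add: smul_def)
  qed
  have t2_const: "t2 (cl {}) = \<zero>" "t2 (cl {[]}) = \<one>"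
    using m2 by (simp_all add: R_morph_def flip: C2_cl)
  interpret bracket_dioid T opn cls
  proof
    show "opn \<sigma> \<odot> cls \<tau> = (if \<sigma> = \<tau> then \<one> else \<zero>)" for \<sigma> \<tau>
      using rhoC2_relations[THEN cl_eqI] by (simp add: opn_def cls_def t2_mult t2_const)
  qed (simp_all add: opn_def cls_def t2C letter_C2)
  \<comment> \<open>Edge labels have the shape of an entry of \<open>U + X + V\<close>, so that the
    three matrices can be read off entrywise; brackets and elements of \<open>K\<close> belong to
    \<open>E\<close> by summands 0.\<close>
  define E where "E = {label opn s \<oplus> t1 x \<oplus> label cls t | s x t. x \<in> dcar K}"
  have t1_const: "t1 (dzero K) = \<zero>" "t1 (dunit K) = \<one>" and K_const: "dzero K \<in> dcar K" "dunit K \<in> dcar K"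
    using m1 K by (auto simp: R_morph_def dioid_def)
  have t1E: "t1 x \<in> E" if "x \<in> dcar K" for x
    unfolding E_def using that t1C by (auto intro!: exI[of _ None] exI[of _ x])
  have E0: "\<zero> \<in> E" and E1: "\<one> \<in> E" using t1E K_const t1_const by metis+
  have EC: "E \<subseteq> \<C>" unfolding E_def using t1C by auto
  have opnE: "opn \<sigma> \<in> E" for \<sigma>
  proof -
    have "opn \<sigma> = label opn (Some \<sigma>) \<oplus> t1 (dzero K) \<oplus> label cls None" by (simp add: t1_const)
    then show ?thesis unfolding E_def using K_const by blast
  qed
  have clsE: "cls \<sigma> \<in> E" for \<sigma>
  proof -
    have "cls \<sigma> = label opn None \<oplus> t1 (dzero K) \<oplus> label cls (Some \<sigma>)" by (simp add: t1_const)
    then show ?thesis unfolding E_def using K_const by blast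
  qed
  have letterE: "t2 (letter a) \<in> E" for a
    using opnE[of True] opnE[of False] clsE[of True] clsE[of False]
    by (cases a) (simp_all add: opn_def cls_def)
  have "\<C> \<subseteq> gen E"
  proof (rule tensor_generated[OF assms(2) K dioid_C2 EC])
    show "t1 ` dcar K \<subseteq> gen E" using t1E gen_base by blast
    show "t2 ` dcar C2 \<subseteq> gen E" by (rule C2_image_generated[OF RT m2]) (use letterE in auto)
  qed
  moreover have "z \<in> recognizable E" if "z \<in> gen E" for z
    using that
  proof induction
    case (gen_base x)
    then show ?case using EC E0 by (auto intro: recognizable_edge)
  qed (simp_all add: recognizable_edge E0 E1 recognizable_add[OF E0 E1 EC]
      recognizable_mult[OF E0 E1 EC] recognizable_star[OF E0 E1 EC])
  ultimately obtain n A I J x where A: "mat_over n E A" and \<phi>: "recognizes n A I J x \<phi>"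
    using assms(3) unfolding recognizable_def by blast
  have "\<exists>s y t. A i j = label opn s \<oplus> t1 y \<oplus> label cls t \<and> y \<in> dcar K" if "i < n" "j < n" for i j
    using A that unfolding mat_over_def E_def by blast
  then obtain u Y v where uYv: "\<And>i j. i < n \<Longrightarrow> j < n \<Longrightarrow>
      A i j = label opn (u i j) \<oplus> t1 (Y i j) \<oplus> label cls (v i j) \<and> Y i j \<in> dcar K"
    by metis
  define X where "X = (\<lambda>i j. t1 (Y i j))"
  have X_com: "X i j \<odot> t2 c = t2 c \<odot> X i j" if "i < n" "j < n" "c \<in> dcar C2" for i j c
    using uYv that com by (simp add: X_def)
  interpret pushdown T opn cls n u v X
  proof
    fix i j \<sigma> assume ij: "i < n" "j < n"
    show "X i j \<in> \<C>" using uYv[OF ij] t1C by (simp add: X_def)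
    show "X i j \<odot> opn \<sigma> = opn \<sigma> \<odot> X i j" "X i j \<odot> cls \<sigma> = cls \<sigma> \<odot> X i j"
      unfolding opn_def cls_def by (rule X_com[OF ij letter_C2])+
  qed
  let ?S = "\<lambda>i. if i \<in> I then \<one> else \<zero>" and ?F = "\<lambda>j. if j \<in> J then \<one> else \<zero>"
  have "\<phi> = vmv T n ?S Q ?F"
    by (rule recognizes_eq_vmv[OF _ \<phi>]) (use uYv in \<open>simp add: U_def V_def X_def\<close>)
  moreover have "U i j \<in> {\<zero>, t2 (letter Lb), t2 (letter Lp)}" for i j
    unfolding U_def by (cases "u i j") (auto simp: opn_def)
  moreover have "V i j \<in> {\<zero>, t2 (letter Ld), t2 (letter Lq)}" for i j
    unfolding V_def by (cases "v i j") (auto simp: cls_def)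
  moreover have "mat_over n (t1 ` dcar K) X"
    using uYv by (simp add: mat_over_def X_def)
  moreover have "mat_over n (centralizer T (dcar C2) t2) N"
    using N_commute X_com t2C by (simp add: mat_over_def centralizer_def)
  moreover note least_sol_N
  ultimately show ?thesis
    unfolding Q_def
    by (intro exI[of _ n] exI[of _ ?S] exI[of _ ?F] exI[of _ U] exI[of _ V] exI[of _ X] exI[of _ N]
        conjI allI impI) simp_all
qed

end
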